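(* Let $X\subset\mathbb{P}(V)$ be a compact smooth $m$-dimensional submanifold. Then: 1. The wall $\mathcal{W}_X\subset\operatorname{Hom}(V,W)$ is a smooth hypersurface at any regular point $f_0\in\mathcal{W}_X$. 2. For a regular point $f_0\in\mathcal{W}_X$, denoting $X\cap\mathbb{P}(\ker(f_0))=\{\xi_0\}$, there is a canonical isomorphism $$\psi_{f_0}:N_{\mathcal{W}_X^0,f_0}\to\operatorname{Hom}(\det(Y_{\xi_0}),\det(W)).$$
   Context: $V$ is a real vector space of finite dimension $N$, $\mathbb{P}(V)$ is the projective space of lines in $V$, $X\subset\mathbb{P}(V)$ is a compact smooth (not necessarily algebraic) submanifold of dimension $m<N-1$, $n:=m+1$, and $W$ is a real vector space of dimension $n$. $Y_X\subset X\times V$ is the rank $n$ subbundle whose fibre $Y_l$ at a line $l\in X$ contains $l$ and is such that, under the canonical identification $T_l\mathbb{P}(V)=\operatorname{Hom}(l,V/l)$, one has $T_lX=\operatorname{Hom}(l,Y_l/l)$. The wall associated with $X$ is $\mathcal{W}_X:=\{f\in\operatorname{Hom}(V,W)\mid X\cap\mathbb{P}(\ker(f))\neq\emptyset\}$. A point $f\in\mathcal{W}_X$ is called regular if $f$ is surjective, $X\cap\mathbb{P}(\ker(f))$ consists of a single point $\xi_f$, and $\ker(f)\cap Y_{\xi_f}=\xi_f$. $\mathcal{W}_X^0$ is the subspace of regular points of the wall, and $N_{\mathcal{W}_X^0,f_0}:=\operatorname{Hom}(V,W)/T_{f_0}\mathcal{W}_X^0$ is the normal line of the wall at a regular point $f_0$.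 $\det$ denotes the top exterior power. *)

theory Defs
  imports "HOL-Analysis.Analysis" "HOL-Analysis.Finite_Function_Topology"
begin

section \<open>Smooth maps and submanifolds\<close>

text \<open>Only used for maps with finite-dimensional domain, where a map is k+1 times continuously
  differentiable iff it is differentiable and all its directional derivatives are k times
  continuously differentiable.\<close>

primrec Ck_on :: "nat \<Rightarrow> 'a::real_normed_vector set \<Rightarrow> ('a \<Rightarrow> 'b::real_normed_vector) \<Rightarrow> bool" where
  "Ck_on 0 U f \<longleftrightarrow> continuous_on U f"
| "Ck_on (Suc k) U f \<longleftrightarrow>
     (\<forall>x\<in>U. f differentiable (at x)) \<and>
     (\<forall>v. Ck_on k U (\<lambda>x. frechet_derivative f (at x) v))"

text \<open>On a set that need not be open, smoothness means that the map extends locally to a smooth map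
  on an open set.\<close>

definition smooth_on :: "'a::real_normed_vector set \<Rightarrow> ('a \<Rightarrow> 'b::real_normed_vector) \<Rightarrow> bool" where
  "smooth_on S f \<longleftrightarrow>
     (\<forall>x\<in>S. \<exists>U g. open U \<and> x \<in> U \<and> (\<forall>k. Ck_on k U g) \<and> (\<forall>y\<in>U \<inter> S. g y = f y))"

definition diffeo_betw ::
    "'a::real_normed_vector set \<Rightarrow> 'b::real_normed_vector set \<Rightarrow> ('a \<Rightarrow> 'b) \<Rightarrow> bool" where
  "diffeo_betw S T f \<longleftrightarrow> bij_betw f S T \<and> smooth_on S f \<and> smooth_on T (inv_into S f)"

text \<open>The model space of dimension \<open>k\<close> is taken among the linear subspaces of the ambient space.
  Because smoothness on arbitrary subsets is meant in the extension sense, this describes embedded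
  submanifolds.\<close>

definition submanifold_at :: "nat \<Rightarrow> 'a::real_normed_vector set \<Rightarrow> 'a \<Rightarrow> bool" where
  "submanifold_at k S p \<longleftrightarrow>
     (\<exists>U (L :: 'a set) U' f. openin (top_of_set S) U \<and> p \<in> U \<and>
        subspace L \<and> dim L = k \<and> openin (top_of_set L) U' \<and> diffeo_betw U U' f)"

definition submanifold :: "nat \<Rightarrow> 'a::real_normed_vector set \<Rightarrow> bool" where
  "submanifold k S \<longleftrightarrow> (\<forall>p\<in>S. submanifold_at k S p)"

definition hypersurface_at :: "'a::real_normed_vector set \<Rightarrow> 'a \<Rightarrow> bool" where
  "hypersurface_at S p \<longleftrightarrow> (\<exists>k. Suc k = dim (UNIV :: 'a set) \<and> submanifold_at k S p)"

definition tangent_space :: "'a::real_normed_vector set \<Rightarrow> 'a \<Rightarrow> 'a set" where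
  "tangent_space S p =
     {v. \<exists>c e. (e::real) > 0 \<and> smooth_on {-e<..<e} c \<and> c ` {-e<..<e} \<subseteq> S \<and> c 0 = p \<and>
          (c has_vector_derivative v) (at 0)}"

section \<open>Real vector spaces with explicit carrier\<close>

text \<open>Needed for quotients and spaces of linear maps that depend on a term and hence are not types.\<close>

record 'a rvs =
  car :: "'a set"
  vadd :: "'a \<Rightarrow> 'a \<Rightarrow> 'a"
  vscale :: "real \<Rightarrow> 'a \<Rightarrow> 'a"

definition vsub :: "'a::real_vector set \<Rightarrow> 'a rvs" where
  "vsub E = \<lparr>car = E, vadd = (+), vscale = (*\<^sub>R)\<rparr>"

definition coset :: "'a::real_vector set \<Rightarrow> 'a \<Rightarrow> 'a set" where
  "coset S x = {x + s |s. s \<in> S}"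

text \<open>The quotient of \<open>E\<close> by a linear subspace \<open>S\<close>. In the scaling, adding \<open>S\<close> only matters for the
  scalar 0.\<close>

definition vquot :: "'a::real_vector set \<Rightarrow> 'a set \<Rightarrow> 'a set rvs" where
  "vquot E S =
     \<lparr>car = coset S ` E,
      vadd = (\<lambda>A B. {a + b |a b. a \<in> A \<and> b \<in> B}),
      vscale = (\<lambda>r A. {r *\<^sub>R a + s |a s. a \<in> A \<and> s \<in> S})\<rparr>"

definition vlinear :: "'a rvs \<Rightarrow> 'b rvs \<Rightarrow> ('a \<Rightarrow> 'b) \<Rightarrow> bool" where
  "vlinear A B h \<longleftrightarrow>
     h \<in> car A \<rightarrow> car B \<and>
     (\<forall>x\<in>car A. \<forall>y\<in>car A. h (vadd A x y) = vadd B (h x) (h y)) \<and>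
     (\<forall>r. \<forall>x\<in>car A. h (vscale A r x) = vscale B r (h x))"

definition viso :: "'a rvs \<Rightarrow> 'b rvs \<Rightarrow> ('a \<Rightarrow> 'b) \<Rightarrow> bool" where
  "viso A B h \<longleftrightarrow> vlinear A B h \<and> bij_betw h (car A) (car B)"

definition vHom :: "'a rvs \<Rightarrow> 'b rvs \<Rightarrow> ('a \<Rightarrow> 'b) rvs" where
  "vHom A B =
     \<lparr>car = {h \<in> extensional (car A). vlinear A B h},
      vadd = (\<lambda>h k. \<lambda>x\<in>car A. vadd B (h x) (k x)),
      vscale = (\<lambda>r h. \<lambda>x\<in>car A. vscale B r (h x))\<rparr>"

section \<open>Exterior powers\<close>

text \<open>The \<open>k\<close>-th exterior power of \<open>E\<close> is the free real vector space on the \<open>k\<close>-tuples in \<open>E\<close>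
  modulo multilinearity and the vanishing of tuples with a repeated entry.\<close>

definition tuples :: "nat \<Rightarrow> 'a set \<Rightarrow> 'a list set" where
  "tuples k E = {xs. length xs = k \<and> set xs \<subseteq> E}"

definition gen :: "'a list \<Rightarrow> ('a list, real) poly_mapping" where
  "gen xs = Poly_Mapping.single xs 1"

definition ext_relations :: "nat \<Rightarrow> 'a::real_vector set \<Rightarrow> ('a list, real) poly_mapping set" where
  "ext_relations k E = span
     ({gen (us @ [x + y] @ vs) - gen (us @ [x] @ vs) - gen (us @ [y] @ vs) |us x y vs.
         us @ [x] @ vs \<in> tuples k E \<and> y \<in> E} \<union>
      {gen (us @ [r *\<^sub>R x] @ vs) - r *\<^sub>R gen (us @ [x] @ vs) |us r x vs.
         us @ [x] @ vs \<in> tuples k E} \<union>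
      {gen (us @ [x] @ vs @ [x] @ ws) |us x vs ws.
         us @ [x] @ vs @ [x] @ ws \<in> tuples k E})"

definition ext_power :: "nat \<Rightarrow> 'a::real_vector set \<Rightarrow> ('a list, real) poly_mapping set rvs" where
  "ext_power k E = vquot (span (gen ` tuples k E)) (ext_relations k E)"

definition wedge :: "'a::real_vector set \<Rightarrow> 'a list \<Rightarrow> ('a list, real) poly_mapping set" where
  "wedge E xs = coset (ext_relations (length xs) E) (gen xs)"

definition det_line :: "'a::real_vector set \<Rightarrow> ('a list, real) poly_mapping set rvs" where
  "det_line E = ext_power (dim E) E"

section \<open>Projective space\<close>

definition proj :: "'v::euclidean_space set \<Rightarrow> 'v set set" where
  "proj E = {l. subspace l \<and> dim l = 1 \<and> l \<subseteq> E}"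

text \<open>The quotient topology for \<open>v \<mapsto> span {v}\<close>.\<close>

definition proj_topology :: "'v::euclidean_space set topology" where
  "proj_topology = topology (\<lambda>U. U \<subseteq> proj UNIV \<and> open {v. v \<noteq> 0 \<and> span {v} \<in> U})"

lemma openin_proj_topology:
  fixes U :: "'v::euclidean_space set set"
  shows "openin proj_topology U \<longleftrightarrow> U \<subseteq> proj UNIV \<and> open {v. v \<noteq> 0 \<and> span {v} \<in> U}"
proof -
  have "istopology (\<lambda>U. U \<subseteq> proj (UNIV::'v set) \<and> open {v. v \<noteq> 0 \<and> span {v} \<in> U})"
    unfolding istopology_def
  proof (intro conjI allI impI)
    fix S T :: "'v set set"
    assume S: "S \<subseteq> proj UNIV \<and> open {v. v \<noteq> 0 \<and> span {v} \<in> S}"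
      and T: "T \<subseteq> proj UNIV \<and> open {v. v \<noteq> 0 \<and> span {v} \<in> T}"
    show "S \<inter> T \<subseteq> proj UNIV" using S by blast
    have "{v. v \<noteq> 0 \<and> span {v} \<in> S \<inter> T} =
        {v. v \<noteq> 0 \<and> span {v} \<in> S} \<inter> {v. v \<noteq> 0 \<and> span {v} \<in> T}" by blast
    then show "open {v. v \<noteq> 0 \<and> span {v} \<in> S \<inter> T}" using S T by auto
  next
    fix K :: "'v set set set"
    assume K: "\<forall>S\<in>K. S \<subseteq> proj UNIV \<and> open {v. v \<noteq> 0 \<and> span {v} \<in> S}"
    show "\<Union>K \<subseteq> proj UNIV" using K by blast
    have "{v. v \<noteq> 0 \<and> span {v} \<in> \<Union>K} = (\<Union>S\<in>K. {v. v \<noteq> 0 \<and> span {v} \<in> S})" by blast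
    then show "open {v. v \<noteq> 0 \<and> span {v} \<in> \<Union>K}" using K by auto
  qed
  then show ?thesis
    unfolding proj_topology_def by (simp add: topology_inverse')
qed

text \<open>The standard affine charts identify \<open>{l. a ` l \<noteq> {0}}\<close>, for a linear functional \<open>a\<close>, with
  the affine hyperplane \<open>{v. a v = 1}\<close>; the set below is the image of \<open>X\<close> in that hyperplane.\<close>

definition affine_chart_image :: "'v::euclidean_space set set \<Rightarrow> ('v \<Rightarrow> real) \<Rightarrow> 'v set" where
  "affine_chart_image X a = {v. a v = 1 \<and> span {v} \<in> X}"

definition proj_submanifold :: "nat \<Rightarrow> 'v::euclidean_space set set \<Rightarrow> bool" where
  "proj_submanifold m X \<longleftrightarrow>
     X \<subseteq> proj UNIV \<and> (\<forall>a. linear a \<longrightarrow> submanifold m (affine_chart_image X a))"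

text \<open>The tangent space of \<open>X\<close> at \<open>l\<close> as a subset of \<open>Hom(l, V/l)\<close>: under the canonical
  identification, the velocity at \<open>0\<close> of the curve \<open>t \<mapsto> span {c t}\<close> is the linear map sending \<open>c 0\<close>
  to the class of \<open>c' 0\<close>. It does not depend on the lift \<open>c\<close>.\<close>

definition proj_tangent_space ::
    "'v::euclidean_space set set \<Rightarrow> 'v set \<Rightarrow> ('v \<Rightarrow> 'v set) set" where
  "proj_tangent_space X l =
     {h \<in> car (vHom (vsub l) (vquot UNIV l)).
        \<exists>c e v. (e::real) > 0 \<and> smooth_on {-e<..<e} c \<and>
          (\<forall>t\<in>{-e<..<e}. c t \<noteq> 0 \<and> span {c t} \<in> X) \<and> span {c 0} = l \<and>
          (c has_vector_derivative v) (at 0) \<and> h (c 0) = coset l v}"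

text \<open>The description below is unique, see \<open>vHom_vquot_determines\<close>.\<close>

definition Y_fibre :: "'v::euclidean_space set set \<Rightarrow> 'v set \<Rightarrow> 'v set" where
  "Y_fibre X l =
     (THE Y. subspace Y \<and> l \<subseteq> Y \<and> proj_tangent_space X l = car (vHom (vsub l) (vquot Y l)))"

lemma vHom_vquot_determines:
  fixes Y Y' :: "'v::euclidean_space set"
  assumes l: "l \<in> proj UNIV" and Y: "subspace Y" "l \<subseteq> Y" and Y': "subspace Y'" "l \<subseteq> Y'"
    and eq: "car (vHom (vsub l) (vquot Y l)) = car (vHom (vsub l) (vquot Y' l))"
  shows "Y = Y'"
proof -
  have sl: "subspace l" and "dim l = 1" using l by (auto simp: proj_def)
  then obtain z where z: "z \<in> l" "z \<noteq> 0"
    by (metis dim_eq_0 subsetI singletonI zero_neq_one singleton_iff)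
  have mem: "y \<in> B" if yA: "y \<in> A" and A: "subspace A" "l \<subseteq> A" and B: "subspace B" "l \<subseteq> B"
    and AB: "car (vHom (vsub l) (vquot A l)) \<subseteq> car (vHom (vsub l) (vquot B l))"
    for y and A B :: "'v set"
  proof -
    let ?a = "\<lambda>x. (x \<bullet> z) / (z \<bullet> z)"
    let ?h = "\<lambda>x\<in>l. coset l (?a x *\<^sub>R y)"
    have add: "coset l (u + v) = {a + b |a b. a \<in> coset l u \<and> b \<in> coset l v}" for u v
    proof -
      have "u + v + s \<in> {a + b |a b. a \<in> coset l u \<and> b \<in> coset l v}" if "s \<in> l" for s
      proof -
        have "u + v + s = (u + s) + (v + 0)" by simp
        moreover have "u + s \<in> coset l u" "v + 0 \<in> coset l v"
          using that subspace_0[OF sl] unfolding coset_def by blast+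
        ultimately show ?thesis by blast
      qed
      moreover have "(u + s) + (v + t) \<in> coset l (u + v)" if "s \<in> l" "t \<in> l" for s t
      proof -
        have "(u + s) + (v + t) = (u + v) + (s + t)" by simp
        then show ?thesis using subspace_add[OF sl that] unfolding coset_def by blast
      qed
      ultimately show ?thesis unfolding coset_def by blast
    qed
    have scl: "coset l (r *\<^sub>R u) = {r *\<^sub>R a + s |a s. a \<in> coset l u \<and> s \<in> l}" for r u
    proof -
      have "r *\<^sub>R u + s \<in> {r *\<^sub>R a + s |a s. a \<in> coset l u \<and> s \<in> l}" if "s \<in> l" for s
      proof -
        have "u + 0 \<in> coset l u"
          using subspace_0[OF sl] unfolding coset_def by blast
        then show ?thesis using that by auto
      qed
      moreover have "r *\<^sub>R (u + s) + t \<in> coset l (r *\<^sub>R u)" if "s \<in> l" "t \<in> l" for s t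
      proof -
        have "r *\<^sub>R (u + s) + t = r *\<^sub>R u + (r *\<^sub>R s + t)" by (simp add: algebra_simps)
        then show ?thesis
          using subspace_add[OF sl subspace_scale[OF sl that(1), of r] that(2)]
          unfolding coset_def by blast
      qed
      ultimately show ?thesis unfolding coset_def by blast
    qed
    have "?h \<in> car (vHom (vsub l) (vquot A l))"
      using yA A sl
      by (auto simp: vHom_def vlinear_def vsub_def vquot_def subspace_add subspace_scale
          add[symmetric] scl[symmetric] inner_add_left add_divide_distrib scaleR_add_left)
    then have "?h \<in> car (vHom (vsub l) (vquot B l))" using AB by blast
    then have "?h \<in> l \<rightarrow> coset l ` B"
      by (simp add: vHom_def vlinear_def vsub_def vquot_def)
    then have "?h z \<in> coset l ` B" using z(1) by (rule funcset_mem)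
    moreover have "?h z = coset l y" using z by simp
    ultimately obtain b where b: "b \<in> B" "coset l y = coset l b" by auto
    have "y \<in> coset l y"
      using subspace_0[OF sl] unfolding coset_def by force
    then have "y \<in> coset l b" using b(2) by simp
    then obtain s where "s \<in> l" "y = b + s" unfolding coset_def by blast
    then show ?thesis using b B subspace_add by blast
  qed
  show ?thesis using mem[OF _ Y Y'] mem[OF _ Y' Y] eq by blast
qed

section \<open>The wall\<close>

definition ker :: "('v::real_normed_vector \<Rightarrow>\<^sub>L 'w::real_normed_vector) \<Rightarrow> 'v set" where
  "ker f = {v. blinfun_apply f v = 0}"

definition wall ::
    "'v::euclidean_space set set \<Rightarrow> ('v \<Rightarrow>\<^sub>L 'w::euclidean_space) set" where
  "wall X = {f. X \<inter> proj (ker f) \<noteq> {}}"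

definition regular_wall ::
    "'v::euclidean_space set set \<Rightarrow> ('v \<Rightarrow>\<^sub>L 'w::euclidean_space) set" where
  "regular_wall X =
     {f \<in> wall X. surj (blinfun_apply f) \<and>
        (\<exists>\<xi>. X \<inter> proj (ker f) = {\<xi>} \<and> ker f \<inter> Y_fibre X \<xi> = \<xi>)}"

definition normal_line ::
    "'v::euclidean_space set set \<Rightarrow> ('v \<Rightarrow>\<^sub>L 'w::euclidean_space) \<Rightarrow> ('v \<Rightarrow>\<^sub>L 'w) set rvs" where
  "normal_line X f = vquot UNIV (tangent_space (regular_wall X) f)"

text \<open>The canonical map sends the class of \<open>\<phi>\<close> to
  \<open>y0 \<and> y1 \<and> ... \<and> ym \<mapsto> \<phi> y0 \<and> f y1 \<and> ... \<and> f ym\<close> for \<open>y0\<close> in the line \<open>\<xi>\<close> and \<open>y1, ..., ym\<close> in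
  its fibre \<open>Y\<close>. It is the composition of the map \<open>N \<rightarrow> Hom(\<xi>, W / f Y)\<close> induced by restriction
  to \<open>\<xi>\<close> with the isomorphisms obtained from \<open>det Y = \<xi> \<otimes> det (Y / \<xi>)\<close>,
  \<open>det W = (W / f Y) \<otimes> det (f Y)\<close> and \<open>f : Y / \<xi> \<cong> f Y\<close>; equivalently, it is induced by the
  derivative at \<open>f\<close> of \<open>g \<mapsto> det (g restricted to Y)\<close>.\<close>

definition canonical_normal_map ::
    "'v::euclidean_space set set \<Rightarrow> ('v \<Rightarrow>\<^sub>L 'w::euclidean_space) \<Rightarrow> 'v set \<Rightarrow>
     (('v \<Rightarrow>\<^sub>L 'w) set \<Rightarrow> ('v list, real) poly_mapping set \<Rightarrow> ('w list, real) poly_mapping set) \<Rightarrow> bool" where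
  "canonical_normal_map X f \<xi> \<psi> \<longleftrightarrow>
     (\<forall>\<phi>. \<forall>y0\<in>\<xi>. \<forall>ys. length ys + 1 = dim (Y_fibre X \<xi>) \<and> set ys \<subseteq> Y_fibre X \<xi> \<longrightarrow>
        \<psi> (coset (tangent_space (regular_wall X) f) \<phi>) (wedge (Y_fibre X \<xi>) (y0 # ys)) =
        wedge UNIV (blinfun_apply \<phi> y0 # map (blinfun_apply f) ys))"

end

theory Submission
  imports Defs
begin

text \<open>
  Fix a regular point \<open>f0\<close> of the wall and a vector \<open>z0\<close> spanning the line \<open>\<xi>0\<close>. Let \<open>M\<close> be the image
  of \<open>X\<close> in an affine chart \<open>{v. a v = 1}\<close> through \<open>z0\<close>, and \<open>T\<close> its tangent space at \<open>z0\<close>. The fibre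
  \<open>Y\<close> at \<open>\<xi>0\<close> is spanned by \<open>z0\<close> and \<open>T\<close>, so regularity says that \<open>f0\<close> is injective on \<open>T\<close>, and the
  image \<open>f0(T)\<close> is a hyperplane of \<open>W\<close>. Let \<open>w0\<close> be a unit normal vector of this hyperplane and let
  \<open>s \<phi> = \<phi> z0 \<bullet> w0\<close>, a nonzero linear functional on \<open>Hom(V, W)\<close>.

  The wall is straightened onto the linear hyperplane \<open>{s = 0}\<close>. Let \<open>\<gamma>\<close> parametrize \<open>M\<close> near \<open>z0\<close> by
  \<open>T\<close>, with \<open>\<gamma> 0 = z0\<close> and derivative the identity of \<open>T\<close>, and write \<open>q z0 = s q w0 - f0 (\<tau> q)\<close> with
  \<open>\<tau> q\<close> in \<open>T\<close>. The map \<open>\<Psi> q = q - a \<otimes> (q (\<gamma> (\<tau> q)) - s q w0)\<close> is the correction of \<open>q\<close> that sends the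
  point \<open>\<gamma> (\<tau> q)\<close> of \<open>M\<close> to \<open>s q w0\<close>. Its derivative at \<open>f0\<close> is the identity, hence it is a local
  diffeomorphism. If \<open>s q = 0\<close>, then \<open>\<Psi> q\<close> kills a point of \<open>M\<close> and lies in the wall. Conversely, if
  \<open>\<Psi> q\<close> kills a point \<open>x\<close> of \<open>M\<close> near \<open>z0\<close>, then \<open>q (x - \<gamma> (\<tau> q)) = - s q w0\<close>; but secants of \<open>M\<close>
  near \<open>z0\<close> are almost tangent, and \<open>q\<close> maps them to vectors almost in \<open>f0(T)\<close>, of size comparable to
  the secant (\<open>kernel_point_unique\<close>), so that \<open>x = \<gamma> (\<tau> q)\<close> and \<open>s q = 0\<close>. Compactness of \<open>X\<close> excludes
  points of the kernel far from \<open>z0\<close> (\<open>kernel_point_close\<close>). The resulting \<open>wall_chart\<close> proves the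
  first part of the theorem. The estimate on secants also shows that wall points near \<open>f0\<close> are regular,
  hence the chart computes the tangent space of the regular wall at \<open>f0\<close>: it is \<open>{s = 0}\<close>.

  For the second part, \<open>s\<close> is now a coordinate on the normal line. The map \<open>\<theta> = f0 + a \<otimes> w0\<close> is an
  isomorphism from \<open>Y\<close> to \<open>W\<close>, so the determinant of \<open>W\<close>, composed with \<open>\<theta>\<close> in the case of \<open>Y\<close>,
  gives coordinates on the lines \<open>det W\<close> and \<open>det Y\<close> (\<open>line_coordinate_det_line\<close>). Row operations give
  \<open>det (\<phi> y0, f0 y1, ..., f0 ym) = s \<phi> det (\<theta> y0, ..., \<theta> ym)\<close> for \<open>y0\<close> in \<open>\<xi>0\<close> and \<open>y1, ..., ym\<close> in
  \<open>Y\<close>. In coordinates the canonical formula is therefore the multiplication of real numbers, which is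
  an isomorphism from the first factor to the linear maps between the two lines. It is
  determined by the formula because \<open>Y\<close> has a basis starting with \<open>z0\<close>, whose wedge generates \<open>det Y\<close>.
\<close>

section \<open>A determinant for lists of vectors\<close>

text \<open>The determinant of matrices and the Euclidean structure on tuples are indexed by finite types. A copy
  of the basis as a type makes both available in the dimension of an arbitrary Euclidean space.\<close>

typedef (overloaded) ('a::euclidean_space) basis_index = "Basis :: 'a set"
  using nonempty_Basis by blast

instance basis_index :: (euclidean_space) finite
proof
  have "(UNIV :: 'a basis_index set) = Abs_basis_index ` Basis"
    by (metis UNIV_eq_I Rep_basis_index Rep_basis_index_inverse imageI)
  then show "finite (UNIV :: 'a basis_index set)"
    by (metis finite_Basis finite_imageI)
qed

lemma bij_betw_Rep_basis_index:
  "bij_betw Rep_basis_index UNIV (Basis :: 'a::euclidean_space set)"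
  by (metis Rep_basis_index_inject bij_betw_def inj_onI type_definition.Rep_range
      type_definition_basis_index)

lemma sum_basis_index: "(\<Sum>i\<in>UNIV. h (Rep_basis_index i)) = (\<Sum>b\<in>(Basis :: 'a::euclidean_space set). h b)"
  by (rule sum.reindex_bij_betw[OF bij_betw_Rep_basis_index])

lemma CARD_basis_index: "CARD('a::euclidean_space basis_index) = DIM('a)"
  using bij_betw_same_card[OF bij_betw_Rep_basis_index] by simp

lemma inner_Rep_basis_index:
  "Rep_basis_index i \<bullet> Rep_basis_index j = (if i = j then 1 else 0)"
  using inner_Basis[OF Rep_basis_index[of i] Rep_basis_index[of j]] by (simp add: Rep_basis_index_inject)

text \<open>The enumeration is arbitrary: another choice changes determinants of lists at most by a sign.\<close>

definition basis_num :: "'a::euclidean_space basis_index \<Rightarrow> nat" where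
  "basis_num = (SOME h. bij_betw h UNIV {..<DIM('a)})"

lemma bij_betw_basis_num: "bij_betw (basis_num :: 'a::euclidean_space basis_index \<Rightarrow> nat) UNIV {..<DIM('a)}"
  unfolding basis_num_def
  using someI_ex[OF ex_bij_betw_finite_nat[of "UNIV :: 'a basis_index set"]]
  by (simp add: CARD_basis_index atLeast0LessThan)

definition basis_coords :: "'a::euclidean_space \<Rightarrow> real ^ 'a basis_index" where
  "basis_coords x = (\<chi> j. x \<bullet> Rep_basis_index j)"

lemma basis_coords_add: "basis_coords (x + y) = basis_coords x + basis_coords y"
  and basis_coords_scale: "basis_coords (r *\<^sub>R x) = r *s basis_coords x"
  by (simp_all add: basis_coords_def vec_eq_iff inner_add_left)

definition list_det :: "'a::euclidean_space list \<Rightarrow> real" where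
  "list_det xs = det (\<chi> i. basis_coords (xs ! basis_num i))"

text \<open>The three clauses mirror the three families of relations that define the exterior power.\<close>

definition alternating :: "nat \<Rightarrow> 'a::real_vector set \<Rightarrow> ('a list \<Rightarrow> real) \<Rightarrow> bool" where
  "alternating k E D \<longleftrightarrow>
     (\<forall>us x y vs. us @ [x] @ vs \<in> tuples k E \<and> y \<in> E \<longrightarrow>
        D (us @ [x + y] @ vs) = D (us @ [x] @ vs) + D (us @ [y] @ vs)) \<and>
     (\<forall>us r x vs. us @ [x] @ vs \<in> tuples k E \<longrightarrow>
        D (us @ [r *\<^sub>R x] @ vs) = r * D (us @ [x] @ vs)) \<and>
     (\<forall>us x vs ws. us @ [x] @ vs @ [x] @ ws \<in> tuples k E \<longrightarrow> D (us @ [x] @ vs @ [x] @ ws) = 0)"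

lemma alternating_list_det: "alternating DIM('a) UNIV (list_det :: 'a::euclidean_space list \<Rightarrow> real)"
proof -
  let ?n = "DIM('a)"
  obtain ix :: "nat \<Rightarrow> 'a basis_index" where ix: "\<And>i. i < ?n \<Longrightarrow> basis_num (ix i) = i"
    by (metis bij_betw_basis_num bij_betw_iff_bijections lessThan_iff)
  have inj: "basis_num i = basis_num j \<longleftrightarrow> i = j" for i j :: "'a basis_index"
    using bij_betw_basis_num by (auto simp: bij_betw_def inj_on_def)
  have entry: "(\<chi> i. basis_coords ((us @ [x] @ vs) ! basis_num i)) =
      (\<chi> i. if i = ix (length us) then basis_coords x else basis_coords ((us @ [z] @ vs) ! basis_num i))"
    if "length us < ?n" for us vs :: "'a list" and x z
  proof -
    have "(us @ [x] @ vs) ! k = (if k = length us then x else (us @ [z] @ vs) ! k)" for k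
      by (cases "k < length us") (auto simp: nth_append nth_Cons')
    moreover have "basis_num i = length us \<longleftrightarrow> i = ix (length us)" for i
      using ix[OF that] inj by metis
    ultimately show ?thesis by (simp add: vec_eq_iff)
  qed
  have add: "list_det (us @ [x + y] @ vs) = list_det (us @ [x] @ vs) + list_det (us @ [y] @ vs)"
    if "length us < ?n" for us vs :: "'a list" and x y
    unfolding list_det_def
    by (subst (1 2 3) entry[OF that, where z = 0]) (simp only: basis_coords_add det_row_add)
  have scale: "list_det (us @ [r *\<^sub>R x] @ vs) = r * list_det (us @ [x] @ vs)"
    if "length us < ?n" for us vs :: "'a list" and r x
    unfolding list_det_def
    by (subst (1 2) entry[OF that, where z = 0]) (simp only: basis_coords_scale det_row_mul)
  have rep: "list_det (us @ [x] @ vs @ [x] @ ws) = 0"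
    if "length us + length vs + 1 < ?n" for us vs ws :: "'a list" and x
    unfolding list_det_def
  proof (rule det_identical_rows)
    show "ix (length us) \<noteq> ix (length us + length vs + 1)"
      using ix[of "length us"] ix[OF that] that by force
    have "(us @ [x] @ vs @ [x] @ ws) ! length us = x"
      "(us @ [x] @ vs @ [x] @ ws) ! (length us + length vs + 1) = x"
      by (simp_all add: nth_append)
    then show "row (ix (length us)) (\<chi> i. basis_coords ((us @ [x] @ vs @ [x] @ ws) ! basis_num i)) =
        row (ix (length us + length vs + 1)) (\<chi> i. basis_coords ((us @ [x] @ vs @ [x] @ ws) ! basis_num i))"
      using ix[of "length us"] ix[OF that] that by (simp add: row_def)
  qed
  show ?thesis unfolding alternating_def
    using add scale rep by (auto simp: tuples_def)
qed

lemma
  fixes us vs :: "'a::euclidean_space list"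
  shows list_det_add: "length us + length vs + 1 = DIM('a) \<Longrightarrow>
      list_det (us @ [x + y] @ vs) = list_det (us @ [x] @ vs) + list_det (us @ [y] @ vs)"
    and list_det_scale: "length us + length vs + 1 = DIM('a) \<Longrightarrow>
      list_det (us @ [r *\<^sub>R x] @ vs) = r * list_det (us @ [x] @ vs)"
    and list_det_repeated: "length us + length vs + length ws + 2 = DIM('a) \<Longrightarrow>
      list_det (us @ [x] @ vs @ [x] @ ws) = 0"
  using alternating_list_det[where 'a = 'a] by (simp_all add: alternating_def tuples_def)

text \<open>The terms with \<open>w\<close> in a second slot vanish. In the application \<open>w\<close> is the normal vector along which
  the identification of \<open>Y\<close> with \<open>W\<close> differs from \<open>f0\<close>.\<close>

lemma list_det_shear:
  fixes w :: "'a::euclidean_space"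
  assumes "length us + length vs + 1 = DIM('a)"
  shows "list_det (w # us @ map (\<lambda>v. f v + c v *\<^sub>R w) vs) = list_det (w # us @ map f vs)"
  using assms
proof (induction vs arbitrary: us)
  case (Cons v vs)
  let ?g = "\<lambda>v. f v + c v *\<^sub>R w"
  have "list_det (w # us @ map ?g (v # vs)) = list_det ((w # us) @ [f v + c v *\<^sub>R w] @ map ?g vs)" by simp
  also have "\<dots> = list_det ((w # us) @ [f v] @ map ?g vs) + c v * list_det ((w # us) @ [w] @ map ?g vs)"
    using Cons.prems list_det_add[of "w # us" "map ?g vs"] list_det_scale[of "w # us" "map ?g vs"] by simp
  also have "list_det ((w # us) @ [w] @ map ?g vs) = 0"
    using list_det_repeated[of "[]" us "map ?g vs" w] Cons.prems by simp
  also have "list_det ((w # us) @ [f v] @ map ?g vs) = list_det (w # us @ map f (v # vs))"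
    using Cons.IH[of "us @ [f v]"] Cons.prems by simp
  finally show ?case by simp
qed simp

text \<open>The coordinates of \<open>w\<close> are a nonzero vector in the kernel of the matrix.\<close>

lemma list_det_eq_0:
  fixes xs :: "'a::euclidean_space list"
  assumes "w \<noteq> 0" "length xs = DIM('a)" "\<And>x. x \<in> set xs \<Longrightarrow> x \<bullet> w = 0"
  shows "list_det xs = 0"
proof -
  let ?A = "(\<chi> i. basis_coords (xs ! basis_num i)) :: real ^ 'a basis_index ^ 'a basis_index"
  have "?A *v basis_coords w = 0"
  proof -
    have "(\<Sum>j\<in>UNIV. (x \<bullet> Rep_basis_index j) * (w \<bullet> Rep_basis_index j)) = x \<bullet> w" for x
      unfolding sum_basis_index[of "\<lambda>b. (x \<bullet> b) * (w \<bullet> b)"] by (rule euclidean_inner[symmetric])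
    moreover have "(xs ! basis_num i) \<bullet> w = 0" for i :: "'a basis_index"
    proof -
      have "basis_num i < length xs"
        using bij_betw_basis_num assms(2) by (metis UNIV_I bij_betw_apply lessThan_iff)
      then show ?thesis using assms(3) nth_mem by blast
    qed
    ultimately show ?thesis
      by (simp add: vec_eq_iff matrix_vector_mult_def basis_coords_def)
  qed
  moreover have "basis_coords w \<noteq> 0"
  proof
    assume "basis_coords w = 0"
    then have "w \<bullet> Rep_basis_index j = 0" for j
      by (simp add: basis_coords_def vec_eq_iff)
    then have "w \<bullet> b = 0" if "b \<in> Basis" for b
      using that by (metis Rep_basis_index_cases)
    then show False using assms(1) euclidean_all_zero_iff by blast
  qed
  ultimately have "\<not> invertible ?A"
    using invertible_left_inverse matrix_left_invertible_ker by blast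
  then show ?thesis
    unfolding list_det_def using invertible_det_nz by blast
qed

lemma list_det_nonzero:
  obtains xs :: "'a::euclidean_space list" where "length xs = DIM('a)" "list_det xs \<noteq> 0"
proof -
  obtain ix :: "nat \<Rightarrow> 'a basis_index" where ix: "\<And>i. ix (basis_num i) = i"
    by (metis UNIV_I bij_betw_basis_num bij_betw_iff_bijections)
  let ?xs = "map (\<lambda>k. Rep_basis_index (ix k)) [0..<DIM('a)]"
  have "(\<chi> i. basis_coords (?xs ! basis_num i)) = (mat 1 :: real ^ 'a basis_index ^ 'a basis_index)"
  proof -
    have "basis_num i < DIM('a)" for i :: "'a basis_index"
      using bij_betw_basis_num by (metis UNIV_I bij_betw_apply lessThan_iff)
    then show ?thesis
      by (simp add: vec_eq_iff mat_def basis_coords_def ix inner_Rep_basis_index)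
  qed
  then have "list_det ?xs = 1" unfolding list_det_def by simp
  then show ?thesis using that[of ?xs] by simp
qed


lemma alternating_map:
  assumes D: "alternating k UNIV D" and L: "linear L"
  shows "alternating k E (\<lambda>xs. D (map L xs))"
  using D unfolding alternating_def tuples_def
  by (simp add: linear_add[OF L] linear_scale[OF L])

section \<open>Quotients and one-dimensional spaces\<close>

lemma coset_add:
  assumes "subspace S"
  shows "{a + b |a b. a \<in> coset S x \<and> b \<in> coset S y} = coset S (x + y)"
proof -
  have "\<exists>a b. x + y + s = a + b \<and> (\<exists>s. a = x + s \<and> s \<in> S) \<and> (\<exists>s. b = y + s \<and> s \<in> S)" if "s \<in> S" for s
    by (rule exI[of _ "x + s"], rule exI[of _ y]) (use that assms in \<open>auto simp: subspace_0 intro!: exI[of _ 0]\<close>)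
  moreover have "\<exists>u. x + s + (y + t) = x + y + u \<and> u \<in> S" if "s \<in> S" "t \<in> S" for s t
    using that assms by (intro exI[of _ "s + t"]) (auto simp: subspace_add)
  ultimately show ?thesis unfolding coset_def by blast
qed

lemma coset_scale:
  assumes "subspace S"
  shows "{r *\<^sub>R a + s |a s. a \<in> coset S x \<and> s \<in> S} = coset S (r *\<^sub>R x)"
proof -
  have "\<exists>a t. r *\<^sub>R x + s = r *\<^sub>R a + t \<and> (\<exists>s. a = x + s \<and> s \<in> S) \<and> t \<in> S" if "s \<in> S" for s
    by (rule exI[of _ x], rule exI[of _ s]) (use that assms in \<open>auto simp: subspace_0 intro!: exI[of _ 0]\<close>)
  moreover have "\<exists>u. r *\<^sub>R (x + s) + t = r *\<^sub>R x + u \<and> u \<in> S" if "s \<in> S" "t \<in> S" for s t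
    using that assms by (intro exI[of _ "r *\<^sub>R s + t"]) (auto simp: subspace_add subspace_scale scaleR_add_right)
  ultimately show ?thesis unfolding coset_def by blast
qed

lemma coset_eq_iff:
  assumes "subspace S"
  shows "coset S x = coset S y \<longleftrightarrow> x - y \<in> S"
proof
  assume eq: "coset S x = coset S y"
  have "x \<in> coset S x" using subspace_0[OF assms] unfolding coset_def by force
  then show "x - y \<in> S" using eq unfolding coset_def by auto
next
  assume *: "x - y \<in> S"
  have "x + s \<in> coset S y" "y + s \<in> coset S x" if "s \<in> S" for s
  proof -
    have "x + s = y + ((x - y) + s)" "y + s = x + (s - (x - y))" by simp_all
    then show "x + s \<in> coset S y" "y + s \<in> coset S x"
      using subspace_add[OF assms * that] subspace_diff[OF assms that *] unfolding coset_def by blast+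
  qed
  then show "coset S x = coset S y" unfolding coset_def by blast
qed

text \<open>Closure under the operations is a separate clause because the records carry no axioms of a vector
  space.\<close>

definition line_coordinate :: "'a rvs \<Rightarrow> ('a \<Rightarrow> real) \<Rightarrow> bool" where
  "line_coordinate A \<alpha> \<longleftrightarrow> viso A (vsub UNIV) \<alpha> \<and>
     (\<forall>x\<in>car A. \<forall>y\<in>car A. vadd A x y \<in> car A) \<and> (\<forall>r. \<forall>x\<in>car A. vscale A r x \<in> car A)"

lemma line_coordinateD:
  assumes "line_coordinate A \<alpha>"
  shows "\<And>x y. x \<in> car A \<Longrightarrow> y \<in> car A \<Longrightarrow> vadd A x y \<in> car A"
    and "\<And>r x. x \<in> car A \<Longrightarrow> vscale A r x \<in> car A"
    and "\<And>x y. x \<in> car A \<Longrightarrow> y \<in> car A \<Longrightarrow> \<alpha> (vadd A x y) = \<alpha> x + \<alpha> y"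
    and "\<And>r x. x \<in> car A \<Longrightarrow> \<alpha> (vscale A r x) = r * \<alpha> x"
    and "\<And>x y. x \<in> car A \<Longrightarrow> y \<in> car A \<Longrightarrow> \<alpha> x = \<alpha> y \<Longrightarrow> x = y"
    and "\<And>c. \<exists>x\<in>car A. \<alpha> x = c"
proof -
  show "\<And>x y. x \<in> car A \<Longrightarrow> y \<in> car A \<Longrightarrow> vadd A x y \<in> car A"
    and "\<And>r x. x \<in> car A \<Longrightarrow> vscale A r x \<in> car A"
    and "\<And>x y. x \<in> car A \<Longrightarrow> y \<in> car A \<Longrightarrow> \<alpha> (vadd A x y) = \<alpha> x + \<alpha> y"
    and "\<And>r x. x \<in> car A \<Longrightarrow> \<alpha> (vscale A r x) = r * \<alpha> x"
    using assms by (auto simp: line_coordinate_def viso_def vlinear_def vsub_def)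
  have bij: "bij_betw \<alpha> (car A) UNIV"
    using assms by (simp add: line_coordinate_def viso_def vsub_def)
  then show "\<And>x y. x \<in> car A \<Longrightarrow> y \<in> car A \<Longrightarrow> \<alpha> x = \<alpha> y \<Longrightarrow> x = y"
    by (auto simp: bij_betw_def inj_on_def)
  show "\<exists>x\<in>car A. \<alpha> x = c" for c
    using bij unfolding bij_betw_def by (metis UNIV_I imageE)
qed

text \<open>The first isomorphism theorem for a nonzero functional; it serves both the normal line and the
  determinant lines, which are quotients by the kernel of a functional.\<close>

lemma line_coordinate_vquot:
  assumes E: "subspace E" and s: "linear s" and S: "S = {x \<in> E. s x = 0}" and e: "e \<in> E" "s e \<noteq> (0::real)"
  obtains \<sigma> where "line_coordinate (vquot E S) \<sigma>" "\<And>x. x \<in> E \<Longrightarrow> \<sigma> (coset S x) = s x"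
proof -
  have sS: "subspace S"
    using E s unfolding S subspace_def by (auto simp: linear_0 linear_add linear_scale)
  define \<sigma> where "\<sigma> C = s (SOME x. x \<in> C)" for C
  have \<sigma>: "\<sigma> (coset S x) = s x" for x
  proof -
    have "x + 0 \<in> coset S x" using subspace_0[OF sS] unfolding coset_def by blast
    then have "(SOME y. y \<in> coset S x) \<in> coset S x" by (rule someI)
    then obtain t where "(SOME y. y \<in> coset S x) = x + t" "t \<in> S" unfolding coset_def by blast
    then show ?thesis by (simp add: \<sigma>_def linear_add[OF s] S)
  qed
  have "bij_betw \<sigma> (coset S ` E) UNIV"
    unfolding bij_betw_def
  proof
    have "coset S x = coset S y" if "x \<in> E" "y \<in> E" "s x = s y" for x y
      using that linear_diff[OF s] subspace_diff[OF E]
      unfolding coset_eq_iff[OF sS] by (simp add: S)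
    then show "inj_on \<sigma> (coset S ` E)" unfolding inj_on_def ball_simps \<sigma> by blast
    have "c \<in> \<sigma> ` coset S ` E" for c
      using e subspace_scale[OF E e(1), of "c / s e"] linear_scale[OF s, of "c / s e" e]
      by (intro image_eqI[of _ _ "coset S ((c / s e) *\<^sub>R e)"]) (auto simp: \<sigma>)
    then show "\<sigma> ` coset S ` E = UNIV" by blast
  qed
  then have "line_coordinate (vquot E S) \<sigma>"
    using E unfolding line_coordinate_def viso_def vlinear_def vquot_def vsub_def
    by (auto simp: coset_add[OF sS] coset_scale[OF sS] \<sigma> linear_add[OF s] linear_scale[OF s]
        subspace_add subspace_scale)
  then show ?thesis using \<sigma> that by blast
qed

text \<open>In coordinates, linear maps from \<open>A\<close> to \<open>B\<close> are multiplications by real numbers, so the pairing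
  \<open>\<sigma> n * \<alpha> x\<close> identifies \<open>N\<close> with the space of these maps.\<close>

lemma line_coordinate_Hom:
  assumes N: "line_coordinate N \<sigma>" and A: "line_coordinate A \<alpha>" and B: "line_coordinate B \<beta>"
  obtains \<psi> where "\<psi> \<in> extensional (car N)" "viso N (vHom A B) \<psi>"
    "\<And>n x. n \<in> car N \<Longrightarrow> x \<in> car A \<Longrightarrow> \<psi> n x \<in> car B \<and> \<beta> (\<psi> n x) = \<sigma> n * \<alpha> x"
proof -
  note N = line_coordinateD[OF N] and A = line_coordinateD[OF A] and B = line_coordinateD[OF B]
  obtain b where b: "\<And>c. b c \<in> car B \<and> \<beta> (b c) = c"
    using B(6) by metis
  define \<psi> where "\<psi> = (\<lambda>n\<in>car N. \<lambda>x\<in>car A. b (\<sigma> n * \<alpha> x))"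
  have \<psi>: "\<psi> n x \<in> car B" "\<beta> (\<psi> n x) = \<sigma> n * \<alpha> x" if "n \<in> car N" "x \<in> car A" for n x
    using that b by (auto simp: \<psi>_def)
  have ext: "\<psi> n \<in> extensional (car A)" if "n \<in> car N" for n
    using that by (simp add: \<psi>_def)
  have lin: "vlinear A B (\<psi> n)" if n: "n \<in> car N" for n
    unfolding vlinear_def
    by (auto intro!: B(5) simp: \<psi>[OF n] A(1-4) B(1-4) algebra_simps)
  have mem: "\<psi> n \<in> car (vHom A B)" if "n \<in> car N" for n
    using ext[OF that] lin[OF that] by (simp add: vHom_def)
  have "vlinear N (vHom A B) \<psi>"
    unfolding vlinear_def
  proof (intro conjI ballI allI)
    show "\<psi> \<in> car N \<rightarrow> car (vHom A B)" using mem by blast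
    show "\<psi> (vadd N x y) = vadd (vHom A B) (\<psi> x) (\<psi> y)" if "x \<in> car N" "y \<in> car N" for x y
    proof (rule extensionalityI[of _ "car A"])
      show "\<psi> (vadd N x y) \<in> extensional (car A)" using ext N(1)[OF that] by blast
      show "vadd (vHom A B) (\<psi> x) (\<psi> y) \<in> extensional (car A)" by (simp add: vHom_def)
      show "\<psi> (vadd N x y) z = vadd (vHom A B) (\<psi> x) (\<psi> y) z" if "z \<in> car A" for z
        by (rule B(5)) (use that \<open>x \<in> car N\<close> \<open>y \<in> car N\<close> in
            \<open>simp_all add: vHom_def \<psi> N(1-4) B(1-4) algebra_simps\<close>)
    qed
    show "\<psi> (vscale N r x) = vscale (vHom A B) r (\<psi> x)" if "x \<in> car N" for r x
    proof (rule extensionalityI[of _ "car A"])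
      show "\<psi> (vscale N r x) \<in> extensional (car A)" using ext N(2)[OF that] by blast
      show "vscale (vHom A B) r (\<psi> x) \<in> extensional (car A)" by (simp add: vHom_def)
      show "\<psi> (vscale N r x) z = vscale (vHom A B) r (\<psi> x) z" if "z \<in> car A" for z
        by (rule B(5)) (use that \<open>x \<in> car N\<close> in \<open>simp_all add: vHom_def \<psi> N(1-4) B(1-4)\<close>)
    qed
  qed
  moreover have "bij_betw \<psi> (car N) (car (vHom A B))"
    unfolding bij_betw_def
  proof
    obtain a where a: "a \<in> car A" "\<alpha> a = 1" using A(6) by blast
    show "inj_on \<psi> (car N)"
    proof (rule inj_onI)
      fix x y assume xy: "x \<in> car N" "y \<in> car N" "\<psi> x = \<psi> y"
      then have "\<sigma> x = \<sigma> y" using \<psi>(2)[OF xy(1) a(1)] \<psi>(2)[OF xy(2) a(1)] a(2) by simp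
      then show "x = y" using N(5) xy by blast
    qed
    have "h \<in> \<psi> ` car N" if h: "h \<in> car (vHom A B)" for h
    proof -
      have hA: "\<And>x. x \<in> car A \<Longrightarrow> h x \<in> car B" and hs: "\<And>r x. x \<in> car A \<Longrightarrow> h (vscale A r x) = vscale B r (h x)"
        and hext: "h \<in> extensional (car A)"
        using h by (auto simp: vHom_def vlinear_def)
      obtain n where n: "n \<in> car N" "\<sigma> n = \<beta> (h a)" using N(6) by blast
      have "\<psi> n = h"
      proof (rule extensionalityI[OF ext[OF n(1)] hext])
        fix x assume x: "x \<in> car A"
        have "x = vscale A (\<alpha> x) a" using A(2,4,5) a x by auto
        then have "h x = vscale B (\<alpha> x) (h a)" using hs[OF a(1)] by metis
        then have "\<beta> (h x) = \<beta> (\<psi> n x)" using B(4) hA a(1) \<psi>(2)[OF n(1) x] n(2) by simp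
        then show "\<psi> n x = h x" using B(5) \<psi>(1)[OF n(1) x] hA[OF x] by metis
      qed
      then show ?thesis using n(1) by blast
    qed
    then show "\<psi> ` car N = car (vHom A B)" using mem by blast
  qed
  ultimately have "viso N (vHom A B) \<psi>" by (simp add: viso_def)
  moreover have "\<psi> \<in> extensional (car N)" by (simp add: \<psi>_def)
  ultimately show ?thesis using that \<psi> by blast
qed

lemma vHom_eqI:
  assumes A: "line_coordinate A \<alpha>" and h: "h \<in> car (vHom A B)" and h': "h' \<in> car (vHom A B)"
    and a: "a \<in> car A" "\<alpha> a \<noteq> 0" and eq: "h a = h' a"
  shows "h = h'"
proof (rule extensionalityI)
  show "h \<in> extensional (car A)" "h' \<in> extensional (car A)"
    using h h' by (auto simp: vHom_def)
  fix x assume x: "x \<in> car A"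
  note A = line_coordinateD[OF A]
  have "x = vscale A (\<alpha> x / \<alpha> a) a" using A(2,4,5) a x by auto
  then have "h x = vscale B (\<alpha> x / \<alpha> a) (h a)" "h' x = vscale B (\<alpha> x / \<alpha> a) (h' a)"
    using h h' a(1) by (auto simp: vHom_def vlinear_def) metis+
  then show "h x = h' x" using eq by simp
qed

section \<open>Exterior powers\<close>

lemma lookup_scaleR: "Poly_Mapping.lookup (r *\<^sub>R p) x = r * Poly_Mapping.lookup p x"
proof -
  have "finite {i. r * Poly_Mapping.lookup p i \<noteq> 0}"
    by (rule finite_subset[OF _ finite_keys[of p]]) (auto simp: in_keys_iff)
  then show ?thesis by (simp add: scaleR_poly_mapping_def Abs_poly_mapping_inverse)
qed

definition lin_ext :: "('b \<Rightarrow> real) \<Rightarrow> ('b, real) poly_mapping \<Rightarrow> real" where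
  "lin_ext D p = (\<Sum>x\<in>Poly_Mapping.keys p. Poly_Mapping.lookup p x * D x)"

lemma lin_ext_superset:
  assumes "finite K" "Poly_Mapping.keys p \<subseteq> K"
  shows "lin_ext D p = (\<Sum>x\<in>K. Poly_Mapping.lookup p x * D x)"
  unfolding lin_ext_def using assms by (intro sum.mono_neutral_left) (auto simp: in_keys_iff)

lemma linear_lin_ext: "linear (lin_ext D)"
proof
  fix p q :: "('a, real) poly_mapping" and r :: real
  let ?K = "Poly_Mapping.keys p \<union> Poly_Mapping.keys q"
  have "lin_ext D (p + q) = (\<Sum>x\<in>?K. Poly_Mapping.lookup (p + q) x * D x)"
    by (rule lin_ext_superset) (use keys_add[of p q] in auto)
  also have "\<dots> = lin_ext D p + lin_ext D q"
    by (simp add: lin_ext_superset[of ?K] lookup_add distrib_right sum.distrib)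
  finally show "lin_ext D (p + q) = lin_ext D p + lin_ext D q" .
  have "lin_ext D (r *\<^sub>R p) = (\<Sum>x\<in>Poly_Mapping.keys p. Poly_Mapping.lookup (r *\<^sub>R p) x * D x)"
    by (rule lin_ext_superset) (auto simp: in_keys_iff lookup_scaleR)
  then show "lin_ext D (r *\<^sub>R p) = r *\<^sub>R lin_ext D p"
    by (simp add: lookup_scaleR lin_ext_def sum_distrib_left mult.assoc)
qed

lemma lin_ext_gen [simp]: "lin_ext D (gen xs) = D xs"
  by (simp add: lin_ext_def gen_def)

lemma lin_ext_relations:
  assumes D: "alternating k E D" and p: "p \<in> ext_relations k E"
  shows "lin_ext D p = 0"
proof (rule linear_eq_0_on_span[OF linear_lin_ext _ p[unfolded ext_relations_def]])
  fix q
  assume q: "q \<in> {gen (us @ [x + y] @ vs) - gen (us @ [x] @ vs) - gen (us @ [y] @ vs) |us x y vs.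
         us @ [x] @ vs \<in> tuples k E \<and> y \<in> E} \<union>
      {gen (us @ [r *\<^sub>R x] @ vs) - r *\<^sub>R gen (us @ [x] @ vs) |us r x vs.
         us @ [x] @ vs \<in> tuples k E} \<union>
      {gen (us @ [x] @ vs @ [x] @ ws) |us x vs ws.
         us @ [x] @ vs @ [x] @ ws \<in> tuples k E}"
  note lin = linear_diff[OF linear_lin_ext] linear_scale[OF linear_lin_ext]
  from q consider
      us x y vs where "q = gen (us @ [x + y] @ vs) - gen (us @ [x] @ vs) - gen (us @ [y] @ vs)"
        "us @ [x] @ vs \<in> tuples k E" "y \<in> E"
    | us r x vs where "q = gen (us @ [r *\<^sub>R x] @ vs) - r *\<^sub>R gen (us @ [x] @ vs)" "us @ [x] @ vs \<in> tuples k E"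
    | us x vs ws where "q = gen (us @ [x] @ vs @ [x] @ ws)" "us @ [x] @ vs @ [x] @ ws \<in> tuples k E"
    by blast
  then show "lin_ext D q = 0"
  proof cases
    case 1
    then show ?thesis using D unfolding 1(1) lin lin_ext_gen alternating_def by simp
  next
    case 2
    then show ?thesis using D unfolding 2(1) lin lin_ext_gen alternating_def by simp
  next
    case 3
    then show ?thesis using D unfolding 3(1) lin_ext_gen alternating_def by simp
  qed
qed

text \<open>The rules of calculation in the exterior power, phrased as closure properties of a subspace that
  contains the relations: for the span of one generator and the relations they
  show that this generator spans the quotient.\<close>

lemma
  assumes S: "subspace S" "ext_relations k E \<subseteq> S"
  shows gen_add: "us @ [x] @ vs \<in> tuples k E \<Longrightarrow> y \<in> E \<Longrightarrow>
      gen (us @ [x] @ vs) \<in> S \<Longrightarrow> gen (us @ [y] @ vs) \<in> S \<Longrightarrow> gen (us @ [x + y] @ vs) \<in> S"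
    and gen_scale: "us @ [x] @ vs \<in> tuples k E \<Longrightarrow> gen (us @ [x] @ vs) \<in> S \<Longrightarrow> gen (us @ [r *\<^sub>R x] @ vs) \<in> S"
    and gen_repeated: "us @ [x] @ vs @ [x] @ ws \<in> tuples k E \<Longrightarrow> gen (us @ [x] @ vs @ [x] @ ws) \<in> S"
    and gen_swap: "subspace E \<Longrightarrow> us @ [x, y] @ vs \<in> tuples k E \<Longrightarrow> gen (us @ [x, y] @ vs) \<in> S \<Longrightarrow> gen (us @ [y, x] @ vs) \<in> S"
proof -
  have add: "gen (us @ [x + y] @ vs) - gen (us @ [x] @ vs) - gen (us @ [y] @ vs) \<in> S"
    if "us @ [x] @ vs \<in> tuples k E" "y \<in> E" for us x y vs
    using that by (intro subsetD[OF S(2)]) (unfold ext_relations_def, rule span_base, blast)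
  have scale: "gen (us @ [r *\<^sub>R x] @ vs) - r *\<^sub>R gen (us @ [x] @ vs) \<in> S"
    if "us @ [x] @ vs \<in> tuples k E" for us r x vs
    using that by (intro subsetD[OF S(2)]) (unfold ext_relations_def, rule span_base, blast)
  have rep: "gen (us @ [x] @ vs @ [x] @ ws) \<in> S" if "us @ [x] @ vs @ [x] @ ws \<in> tuples k E" for us x vs ws
    using that by (intro subsetD[OF S(2)]) (unfold ext_relations_def, rule span_base, blast)
  show "gen (us @ [x + y] @ vs) \<in> S"
    if "us @ [x] @ vs \<in> tuples k E" "y \<in> E" "gen (us @ [x] @ vs) \<in> S" "gen (us @ [y] @ vs) \<in> S"
    using subspace_add[OF S(1) subspace_add[OF S(1) add[OF that(1,2)] that(4)] that(3)] by simp
  show "gen (us @ [r *\<^sub>R x] @ vs) \<in> S" if "us @ [x] @ vs \<in> tuples k E" "gen (us @ [x] @ vs) \<in> S"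
    using subspace_add[OF S(1) scale[OF that(1), of r] subspace_scale[OF S(1) that(2), of r]] by simp
  show "gen (us @ [x] @ vs @ [x] @ ws) \<in> S" if "us @ [x] @ vs @ [x] @ ws \<in> tuples k E"
    using rep[OF that] .
  show "gen (us @ [y, x] @ vs) \<in> S"
    if E: "subspace E" and xy: "us @ [x, y] @ vs \<in> tuples k E" and g: "gen (us @ [x, y] @ vs) \<in> S"
  proof -
    have mem: "set us \<subseteq> E" "set vs \<subseteq> E" "x \<in> E" "y \<in> E" "x + y \<in> E" "length us + 2 + length vs = k"
      using xy E by (auto simp: tuples_def subspace_add)
    have r: "gen (us @ [z, z] @ vs) \<in> S" if "z \<in> E" for z
      using rep[of us z "[]" vs] mem that by (simp add: tuples_def)
    have a1: "gen (us @ [x + y, x + y] @ vs) - gen (us @ [x, x + y] @ vs) - gen (us @ [y, x + y] @ vs) \<in> S"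
      using add[of us x "(x + y) # vs" y] mem by (simp add: tuples_def)
    have a2: "gen (us @ [x, x + y] @ vs) - gen (us @ [x, x] @ vs) - gen (us @ [x, y] @ vs) \<in> S"
      using add[of "us @ [x]" x vs y] mem by (simp add: tuples_def)
    have a3: "gen (us @ [y, x + y] @ vs) - gen (us @ [y, x] @ vs) - gen (us @ [y, y] @ vs) \<in> S"
      using add[of "us @ [y]" x vs y] mem by (simp add: tuples_def)
    have "gen (us @ [y, x] @ vs) =
       gen (us @ [x + y, x + y] @ vs)
       - (gen (us @ [x + y, x + y] @ vs) - gen (us @ [x, x + y] @ vs) - gen (us @ [y, x + y] @ vs))
       - (gen (us @ [x, x + y] @ vs) - gen (us @ [x, x] @ vs) - gen (us @ [x, y] @ vs))
       - (gen (us @ [y, x + y] @ vs) - gen (us @ [y, x] @ vs) - gen (us @ [y, y] @ vs))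
       - gen (us @ [x, x] @ vs) - gen (us @ [x, y] @ vs) - gen (us @ [y, y] @ vs)"
      by simp
    also have "\<dots> \<in> S"
      by (intro subspace_diff[OF S(1) subspace_diff[OF S(1) subspace_diff[OF S(1)
              subspace_diff[OF S(1) subspace_diff[OF S(1) subspace_diff[OF S(1)]]]]]]
            r a1 a2 a3 g mem)
    finally show ?thesis .
  qed
qed

text \<open>A vector is carried across \<open>as\<close> by successive transpositions of neighbours.\<close>

lemma gen_move:
  assumes S: "subspace S" "ext_relations k E \<subseteq> S" and E: "subspace E"
  shows "us @ x # as @ bs \<in> tuples k E \<Longrightarrow> gen (us @ as @ x # bs) \<in> S \<Longrightarrow> gen (us @ x # as @ bs) \<in> S"
proof (induction as arbitrary: us)
  case (Cons a as)
  have "gen ((us @ [a]) @ x # as @ bs) \<in> S"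
    by (rule Cons.IH) (use Cons.prems in \<open>auto simp: tuples_def\<close>)
  then show ?case
    using gen_swap[OF S E, of us a x "as @ bs"] Cons.prems(1) by (auto simp: tuples_def)
qed simp

lemma gen_permute:
  assumes S: "subspace S" "ext_relations k E \<subseteq> S" and E: "subspace E"
  shows "mset xs = mset ys \<Longrightarrow> us @ xs \<in> tuples k E \<Longrightarrow> gen (us @ ys) \<in> S \<Longrightarrow> gen (us @ xs) \<in> S"
proof (induction xs arbitrary: us ys)
  case (Cons x xs)
  have "x \<in> set ys" using Cons.prems(1) by (metis list.set_intros(1) set_mset_mset)
  then obtain as bs where ys: "ys = as @ x # bs" by (meson split_list)
  have ms: "mset xs = mset (as @ bs)" using Cons.prems(1) ys by simp
  then have sets: "set xs = set as \<union> set bs" "length xs = length as + length bs"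
    by (metis set_append set_mset_mset, metis length_append size_mset)
  have "gen (us @ x # as @ bs) \<in> S"
    by (rule gen_move[OF S E]) (use Cons.prems ys sets in \<open>auto simp: tuples_def\<close>)
  then have "gen ((us @ [x]) @ as @ bs) \<in> S" by simp
  then have "gen ((us @ [x]) @ xs) \<in> S"
    by (rule Cons.IH[OF ms, rotated]) (use Cons.prems in \<open>auto simp: tuples_def\<close>)
  then show ?case by simp
qed simp

text \<open>The entries are replaced by basis vectors one after the other, using linearity in each slot. A
  tuple of basis vectors either has a repetition or is a permutation of \<open>bs\<close>.\<close>

lemma gen_in_span_basis:
  assumes E: "subspace E" and bs: "distinct bs" "set bs \<subseteq> E" "E \<subseteq> span (set bs)" "length bs = k"
    and xs: "xs \<in> tuples k E"
  shows "gen xs \<in> span (insert (gen bs) (ext_relations k E))"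
proof -
  let ?S = "span (insert (gen bs) (ext_relations k E))"
  have S: "subspace ?S" "ext_relations k E \<subseteq> ?S"
    by (auto intro: span_base)
  have basis: "gen us \<in> ?S" if "set us \<subseteq> set bs" "length us = k" for us
  proof (cases "distinct us")
    case True
    have "set us = set bs"
      using that True bs by (metis List.finite_set card_subset_eq distinct_card)
    then have "mset us = mset bs" using True bs(1) set_eq_iff_mset_eq_distinct by blast
    then show ?thesis
      using gen_permute[OF S E, of us bs "[]"] that bs(2) by (auto simp: tuples_def intro: span_base)
  next
    case False
    then obtain as z cs ds where "us = as @ [z] @ cs @ [z] @ ds"
      using not_distinct_decomp by blast
    then show ?thesis
      using gen_repeated[OF S, of as z cs ds] that bs(2) by (auto simp: tuples_def)
  qed
  have "gen (us @ xs) \<in> ?S" if "set us \<subseteq> set bs" "set xs \<subseteq> E" "length us + length xs = k" for us xs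
    using that
  proof (induction xs arbitrary: us)
    case Nil
    then show ?case using basis by simp
  next
    case (Cons x xs)
    let ?P = "{x \<in> E. gen (us @ [x] @ xs) \<in> ?S}"
    have tup: "us @ [z] @ xs \<in> tuples k E" if "z \<in> E" for z
      using Cons.prems bs(2) that by (auto simp: tuples_def)
    have 0: "gen (us @ [z] @ xs) \<in> ?S" if "z \<in> set bs" for z
      using Cons.IH[of "us @ [z]"] Cons.prems that by auto
    have "subspace ?P"
    proof (rule subspaceI)
      have "gen (us @ [0 *\<^sub>R b] @ xs) \<in> ?S" if "b \<in> set bs" for b
        by (rule gen_scale[OF S]) (use that bs(2) tup 0 in auto)
      moreover have "\<exists>b. b \<in> set bs" using Cons.prems(3) bs(4) by (cases bs) auto
      ultimately show "0 \<in> ?P" using subspace_0[OF E] by auto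
      show "x + y \<in> ?P" if "x \<in> ?P" "y \<in> ?P" for x y
        using that gen_add[OF S tup] subspace_add[OF E] by auto
      show "c *\<^sub>R x \<in> ?P" if "x \<in> ?P" for c x
        using that gen_scale[OF S tup] subspace_scale[OF E] by auto
    qed
    then have "span (set bs) \<subseteq> ?P"
      by (rule span_minimal[rotated]) (use 0 bs(2) in auto)
    moreover have "x \<in> span (set bs)" using Cons.prems(2) bs(3) by auto
    ultimately show ?case by auto
  qed
  from this[of "[]" xs] xs show ?thesis by (simp add: tuples_def)
qed


lemma ext_relations_subset:
  assumes "subspace E"
  shows "ext_relations k E \<subseteq> span (gen ` tuples k E)"
proof -
  have g: "gen xs \<in> span (gen ` tuples k E)" if "xs \<in> tuples k E" for xs
    using that by (blast intro: span_base)
  have mem: "us @ [z] @ vs \<in> tuples k E" if "us @ [x] @ vs \<in> tuples k E" "z \<in> E" for us x z vs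
    using that by (auto simp: tuples_def)
  have "gen (us @ [x + y] @ vs) - gen (us @ [x] @ vs) - gen (us @ [y] @ vs) \<in> span (gen ` tuples k E)"
    if "us @ [x] @ vs \<in> tuples k E" "y \<in> E" for us x y vs
  proof -
    have "x + y \<in> E" using that assms by (auto simp: tuples_def subspace_add)
    then show ?thesis using that mem by (intro span_diff g) blast+
  qed
  moreover have "gen (us @ [r *\<^sub>R x] @ vs) - r *\<^sub>R gen (us @ [x] @ vs) \<in> span (gen ` tuples k E)"
    if "us @ [x] @ vs \<in> tuples k E" for us r x vs
  proof -
    have "r *\<^sub>R x \<in> E" using that assms by (auto simp: tuples_def subspace_scale)
    then show ?thesis using that mem by (intro span_diff span_scale g) blast+
  qed
  ultimately show ?thesis
    unfolding ext_relations_def using g by (intro span_minimal subspace_span) blast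
qed

lemma list_basis_exists:
  fixes E :: "'a::euclidean_space set"
  assumes E: "subspace E" and A: "A \<subseteq> E" "independent A"
  obtains bs where "distinct bs" "set bs \<subseteq> E" "E \<subseteq> span (set bs)" "length bs = dim E" "A \<subseteq> set bs"
proof -
  obtain B where B: "A \<subseteq> B" "B \<subseteq> E" "independent B" "E \<subseteq> span B"
    using maximal_independent_subset_extend[OF A] by blast
  have "finite B" "card B = dim E"
    using B by (auto simp: independent_imp_finite dim_unique intro: dim_unique[symmetric])
  moreover obtain bs where "set bs = B" "distinct bs" using finite_distinct_list[OF \<open>finite B\<close>] by blast
  ultimately show ?thesis using B that distinct_card by metis
qed

text \<open>The wedge of a basis spans the exterior power, and the alternating form obtained from the
  determinant by transport along \<open>\<theta>\<close> does not vanish on it. Therefore the relations are exactly the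
  kernel of the linear extension of this form, which becomes a coordinate on the quotient.\<close>

lemma line_coordinate_det_line:
  fixes E :: "'a::euclidean_space set" and \<theta> :: "'a \<Rightarrow> 'w::euclidean_space"
  assumes E: "subspace E" and \<theta>: "linear \<theta>" "inj_on \<theta> E" and dim: "dim E = DIM('w)"
  obtains \<alpha> where "line_coordinate (det_line E) \<alpha>"
    "\<And>xs. xs \<in> tuples (dim E) E \<Longrightarrow> wedge E xs \<in> car (det_line E) \<and> \<alpha> (wedge E xs) = list_det (map \<theta> xs)"
    "\<And>bs. distinct bs \<Longrightarrow> set bs \<subseteq> E \<Longrightarrow> E \<subseteq> span (set bs) \<Longrightarrow> length bs = dim E \<Longrightarrow>
       list_det (map \<theta> bs) \<noteq> 0"
proof -
  let ?D = "\<lambda>xs. list_det (map \<theta> xs)" and ?R = "ext_relations (dim E) E"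
  let ?G = "span (gen ` tuples (dim E) E)"
  have D: "alternating (dim E) E ?D"
    unfolding dim by (rule alternating_map[OF alternating_list_det \<theta>(1)])
  have spanR: "span ?R = ?R" unfolding ext_relations_def by (rule span_span)
  have decomp: "\<exists>c. p - c *\<^sub>R gen bs \<in> ?R"
    if "distinct bs" "set bs \<subseteq> E" "E \<subseteq> span (set bs)" "length bs = dim E" "p \<in> ?G" for bs p
  proof -
    have "?G \<subseteq> span (insert (gen bs) ?R)"
      using gen_in_span_basis[OF E that(1-4)] by (intro span_minimal subspace_span) blast
    then show ?thesis using that(5) span_breakdown_eq[of p "gen bs" ?R] spanR by auto
  qed
  have lin_ext_eq: "lin_ext ?D p = c * ?D bs" if "p - c *\<^sub>R gen bs \<in> ?R" for p c bs
    using lin_ext_relations[OF D that] linear_diff[OF linear_lin_ext, of ?D p "c *\<^sub>R gen bs"]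
      linear_scale[OF linear_lin_ext, of ?D c "gen bs"] by simp
  have img: "\<theta> ` E = UNIV"
  proof -
    have "dim (\<theta> ` E) = DIM('w)"
      using dim_image_eq[OF \<theta>(1), of E] \<theta>(2) E dim by (simp add: span_eq_iff[THEN iffD2])
    then show ?thesis
      using dim_eq_full[of "\<theta> ` E"] linear_subspace_image[OF \<theta>(1) E] span_eq_iff by metis
  qed
  obtain ws :: "'w list" where ws: "length ws = DIM('w)" "list_det ws \<noteq> 0"
    by (rule list_det_nonzero)
  define xs0 where "xs0 = map (inv_into E \<theta>) ws"
  have "inv_into E \<theta> w \<in> E" "\<theta> (inv_into E \<theta> w) = w" for w
    using img by (simp_all add: inv_into_into f_inv_into_f)
  then have xs0: "xs0 \<in> tuples (dim E) E" "map \<theta> xs0 = ws"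
    using ws(1) dim by (auto simp: tuples_def xs0_def intro: map_idI)
  have nz: "?D bs \<noteq> 0"
    if bs: "distinct bs" "set bs \<subseteq> E" "E \<subseteq> span (set bs)" "length bs = dim E" for bs
  proof -
    obtain c where "gen xs0 - c *\<^sub>R gen bs \<in> ?R"
      using decomp[OF bs, of "gen xs0"] xs0(1) by (blast intro: span_base)
    then have "?D xs0 = c * ?D bs" using lin_ext_eq by fastforce
    then show ?thesis using xs0(2) ws(2) by auto
  qed
  obtain bs where bs: "distinct bs" "set bs \<subseteq> E" "E \<subseteq> span (set bs)" "length bs = dim E"
    using list_basis_exists[OF E, of "{}"] by (auto simp: independent_empty)
  have "?R = {p \<in> ?G. lin_ext ?D p = 0}"
  proof
    show "?R \<subseteq> {p \<in> ?G. lin_ext ?D p = 0}"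
      using ext_relations_subset[OF E] lin_ext_relations[OF D] by blast
    show "{p \<in> ?G. lin_ext ?D p = 0} \<subseteq> ?R"
    proof
      fix p assume p: "p \<in> {p \<in> ?G. lin_ext ?D p = 0}"
      then obtain c where c: "p - c *\<^sub>R gen bs \<in> ?R" using decomp[OF bs] by blast
      then have "c = 0" using lin_ext_eq[OF c] nz[OF bs] p by simp
      then show "p \<in> ?R" using c by simp
    qed
  qed
  moreover have "gen xs0 \<in> ?G" "lin_ext ?D (gen xs0) \<noteq> 0"
    using xs0 ws by (auto intro: span_base)
  ultimately obtain \<alpha> where \<alpha>: "line_coordinate (vquot ?G ?R) \<alpha>"
      "\<And>p. p \<in> ?G \<Longrightarrow> \<alpha> (coset ?R p) = lin_ext ?D p"
    using line_coordinate_vquot[OF subspace_span linear_lin_ext, of ?R "gen ` tuples (dim E) E" ?D "gen xs0"]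
    by metis
  show ?thesis
  proof (rule that)
    show "line_coordinate (det_line E) \<alpha>" using \<alpha>(1) by (simp add: det_line_def ext_power_def)
    show "wedge E xs \<in> car (det_line E) \<and> \<alpha> (wedge E xs) = ?D xs" if "xs \<in> tuples (dim E) E" for xs
    proof -
      have "gen xs \<in> ?G" "length xs = dim E" using that by (auto intro: span_base simp: tuples_def)
      then show ?thesis using \<alpha>(2)[of "gen xs"]
        by (simp add: wedge_def det_line_def ext_power_def vquot_def)
    qed
  qed (rule nz)
qed

section \<open>Calculus of smooth maps\<close>

lemma Ck_on_SucD:
  assumes "Ck_on (Suc k) U f" "x \<in> U"
  shows "(f has_derivative frechet_derivative f (at x)) (at x)"
  using assms by (simp add: frechet_derivative_works)

lemma Ck_on_cong:
  assumes "open U" "\<And>x. x \<in> U \<Longrightarrow> f x = g x"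
  shows "Ck_on k U f \<longleftrightarrow> Ck_on k U g"
  using assms(2)
proof (induction k arbitrary: f g)
  case 0
  then show ?case by (simp cong: continuous_on_cong)
next
  case (Suc k)
  have der: "(f has_derivative f') (at x) \<longleftrightarrow> (g has_derivative f') (at x)" if "x \<in> U" for f' x
    using Suc.prems that has_derivative_transform_within_open[OF _ assms(1) that] by metis
  then have "f differentiable (at x) \<longleftrightarrow> g differentiable (at x)"
    "frechet_derivative f (at x) = frechet_derivative g (at x)" if "x \<in> U" for x
    using that by (simp_all add: differentiable_def frechet_derivative_def)
  then show ?case using Suc.IH[of "\<lambda>x. frechet_derivative f (at x) v" "\<lambda>x. frechet_derivative g (at x) v" for v]
    by simp
qed

lemma Ck_on_SucI:
  assumes "open U" "\<And>x. x \<in> U \<Longrightarrow> (f has_derivative f' x) (at x)" "\<And>v. Ck_on k U (\<lambda>x. f' x v)"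
  shows "Ck_on (Suc k) U f"
proof -
  have "frechet_derivative f (at x) = f' x" if "x \<in> U" for x
    using assms(2)[OF that] frechet_derivative_at by metis
  then have "Ck_on k U (\<lambda>x. frechet_derivative f (at x) v)" for v
    using assms(3)[of v] Ck_on_cong[OF assms(1), of "\<lambda>x. frechet_derivative f (at x) v" "\<lambda>x. f' x v"] by simp
  then show ?thesis using assms(2) by (auto simp: differentiable_def)
qed

lemma Ck_on_Suc_imp: "Ck_on (Suc k) U f \<Longrightarrow> Ck_on k U f"
proof (induction k arbitrary: f)
  case 0
  then show ?case
    by (auto intro!: continuous_at_imp_continuous_on differentiable_imp_continuous_within)
next
  case (Suc k)
  then show ?case using Suc.IH by (metis Ck_on.simps(2))
qed

lemma Ck_on_subset: "Ck_on k U f \<Longrightarrow> V \<subseteq> U \<Longrightarrow> Ck_on k V f"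
  by (induction k arbitrary: f) (auto intro: continuous_on_subset)

lemma Ck_on_const: "open U \<Longrightarrow> Ck_on k U (\<lambda>x. c)"
  by (induction k arbitrary: c) (auto intro!: Ck_on_SucI[of U "\<lambda>x. _" "\<lambda>x h. 0"] simp del: Ck_on.simps(2))

lemma Ck_on_linear_compose:
  assumes L: "bounded_linear L" and U: "open U"
  shows "Ck_on k U f \<Longrightarrow> Ck_on k U (\<lambda>x. L (f x))"
proof (induction k arbitrary: f)
  case 0
  then show ?case using bounded_linear.continuous_on[OF L] by simp
next
  case (Suc k)
  show ?case
    by (rule Ck_on_SucI[OF U bounded_linear.has_derivative[OF L Ck_on_SucD[OF Suc.prems]]])
      (use Suc in auto)
qed

lemma Ck_on_add:
  assumes U: "open U"
  shows "Ck_on k U f \<Longrightarrow> Ck_on k U g \<Longrightarrow> Ck_on k U (\<lambda>x. f x + g x)"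
proof (induction k arbitrary: f g)
  case 0
  then show ?case by (simp add: continuous_on_add)
next
  case (Suc k)
  show ?case
    by (rule Ck_on_SucI[OF U has_derivative_add[OF Ck_on_SucD[OF Suc.prems(1)] Ck_on_SucD[OF Suc.prems(2)]]])
      (use Suc in auto)
qed

lemma Ck_on_diff:
  assumes U: "open U" and f: "Ck_on k U f" and g: "Ck_on k U g"
  shows "Ck_on k U (\<lambda>x. f x - g x)"
  using Ck_on_add[OF U f Ck_on_linear_compose[OF bounded_linear_minus[OF bounded_linear_ident] U g]] by simp

lemma Ck_on_sum:
  assumes "open U" "\<And>i. i \<in> I \<Longrightarrow> Ck_on k U (f i)"
  shows "Ck_on k U (\<lambda>x. \<Sum>i\<in>I. f i x)"
  using assms(2)
  by (induction I rule: infinite_finite_induct) (auto intro: Ck_on_add Ck_on_const assms(1))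

lemma Ck_on_bilinear:
  assumes P: "bounded_bilinear P" and U: "open U"
  shows "Ck_on k U f \<Longrightarrow> Ck_on k U g \<Longrightarrow> Ck_on k U (\<lambda>x. P (f x) (g x))"
proof (induction k arbitrary: f g)
  case 0
  then show ?case using bounded_bilinear.continuous_on[OF P] by simp
next
  case (Suc k)
  have "Ck_on k U f" "Ck_on k U g" using Suc.prems Ck_on_Suc_imp by blast+
  then show ?case
    by (intro Ck_on_SucI[OF U bounded_bilinear.FDERIV[OF P Ck_on_SucD[OF Suc.prems(1)] Ck_on_SucD[OF Suc.prems(2)]]]
        Ck_on_add[OF U] Suc.IH) (use Suc.prems in auto)
qed

lemma Ck_on_bounded_linear:
  assumes "bounded_linear L" "open U"
  shows "Ck_on k U L"
proof (cases k)
  case 0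
  then show ?thesis using linear_continuous_on[OF assms(1)] by simp
next
  case (Suc n)
  then show ?thesis
    using Ck_on_SucI[OF assms(2) bounded_linear_imp_has_derivative[OF assms(1)] Ck_on_const[OF assms(2)]] by blast
qed

lemma Ck_on_affine_compose:
  assumes A: "bounded_linear A" and V: "open V" and AV: "\<And>x. x \<in> V \<Longrightarrow> c + A x \<in> U"
  shows "Ck_on k U f \<Longrightarrow> Ck_on k V (\<lambda>x. f (c + A x))"
proof (induction k arbitrary: f)
  case 0
  then show ?case
    using AV linear_continuous_on[OF A]
    by (auto intro!: continuous_on_compose2[of U f V "\<lambda>x. c + A x"] continuous_on_add)
next
  case (Suc k)
  have "((\<lambda>x. c + A x) has_derivative A) (at x)" for x
    using has_derivative_add[OF has_derivative_const bounded_linear_imp_has_derivative[OF A]] by simp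
  then have "((\<lambda>x. f (c + A x)) has_derivative (\<lambda>h. frechet_derivative f (at (c + A x)) (A h))) (at x)" if "x \<in> V" for x
    by (rule has_derivative_compose[where f = "\<lambda>x. c + A x", OF _ Ck_on_SucD[OF Suc.prems AV[OF that]]])
  then show ?case
    by (rule Ck_on_SucI[OF V]) (use Suc in auto)
qed

text \<open>The chain rule is expanded in a basis of the intermediate space, so that the induction only meets
  directional derivatives of \<open>f\<close> along fixed vectors.\<close>

lemma Ck_on_compose:
  fixes g :: "'a::real_normed_vector \<Rightarrow> 'b::euclidean_space"
  assumes U: "open U" and V: "open V" and gV: "g ` V \<subseteq> U"
  shows "Ck_on k U f \<Longrightarrow> Ck_on k V g \<Longrightarrow> Ck_on k V (\<lambda>x. f (g x))"
proof (induction k arbitrary: f)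
  case 0
  then show ?case using continuous_on_compose2[of U f V g] gV by simp
next
  case (Suc k)
  let ?Df = "\<lambda>x. frechet_derivative f (at x)" and ?Dg = "\<lambda>x. frechet_derivative g (at x)"
  have df: "(f has_derivative ?Df (g x)) (at (g x))" if "x \<in> V" for x
    using Ck_on_SucD[OF Suc.prems(1)] gV that by blast
  have g: "Ck_on k V g" using Suc.prems(2) Ck_on_Suc_imp by blast
  have "((\<lambda>x. f (g x)) has_derivative (\<lambda>v. \<Sum>b\<in>Basis. (?Dg x v \<bullet> b) *\<^sub>R ?Df (g x) b)) (at x)" if "x \<in> V" for x
  proof -
    interpret bounded_linear "?Df (g x)" using df[OF that] by (rule has_derivative_bounded_linear)
    have "?Df (g x) (\<Sum>b\<in>Basis. (w \<bullet> b) *\<^sub>R b) = (\<Sum>b\<in>Basis. (w \<bullet> b) *\<^sub>R ?Df (g x) b)" for w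
      by (simp add: sum scale)
    note expand = this[unfolded euclidean_representation]
    show ?thesis
      by (rule has_derivative_eq_rhs[OF has_derivative_compose[OF Ck_on_SucD[OF Suc.prems(2) that] df[OF that]]])
        (rule ext, rule expand)
  qed
  moreover have "Ck_on k V (\<lambda>x. \<Sum>b\<in>Basis. (?Dg x v \<bullet> b) *\<^sub>R ?Df (g x) b)" for v
    by (intro Ck_on_sum[OF V] Ck_on_bilinear[OF bounded_bilinear_scaleR V]
        Ck_on_linear_compose[OF bounded_linear_inner_left V] Suc.IH[OF _ g])
      (use Suc.prems in auto)
  ultimately show ?case by (rule Ck_on_SucI[OF V])
qed

definition rank_one :: "('a::real_normed_vector \<Rightarrow>\<^sub>L real) \<Rightarrow> 'b::real_normed_vector \<Rightarrow> ('a \<Rightarrow>\<^sub>L 'b)" where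
  "rank_one a w = blinfun_scaleR_left w o\<^sub>L a"

lemma rank_one_apply [simp]: "blinfun_apply (rank_one a w) v = a v *\<^sub>R w"
  by (simp add: rank_one_def)

lemma bounded_linear_rank_one: "bounded_linear (rank_one a)"
  unfolding rank_one_def
  by (rule bounded_linear_compose[OF
        bounded_bilinear.bounded_linear_left[OF bounded_bilinear_blinfun_compose]
        bounded_linear_blinfun_scaleR_left])

text \<open>In finite dimension, smoothness of an operator-valued map can be tested on basis vectors, because the
  map is a sum of rank one operators built from its columns.\<close>

lemma Ck_on_blinfun:
  fixes f :: "'x::real_normed_vector \<Rightarrow> ('a::euclidean_space \<Rightarrow>\<^sub>L 'b::real_normed_vector)"
  assumes U: "open U" and f: "\<And>b. b \<in> Basis \<Longrightarrow> Ck_on k U (\<lambda>x. f x b)"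
  shows "Ck_on k U f"
proof -
  have "f x = (\<Sum>b\<in>Basis. rank_one (blinfun_inner_left b) (f x b))" for x
    by (rule blinfun_euclidean_eqI) (simp add: blinfun.sum_left inner_Basis if_distrib[of "\<lambda>c. c *\<^sub>R _"] cong: if_cong)
  moreover have "Ck_on k U (\<lambda>x. \<Sum>b\<in>Basis. rank_one (blinfun_inner_left b) (f x b))"
    by (intro Ck_on_sum[OF U] Ck_on_linear_compose[OF bounded_linear_rank_one U] f)
  ultimately show ?thesis by simp
qed

section \<open>The smooth inverse function theorem\<close>

text \<open>If one factor vanishes at the point, the product rule needs only continuity of the other factor. This
  is what makes the inverse of an operator-valued map differentiable once it is continuous.\<close>

lemma has_derivative_bilinear_vanishing:
  assumes P: "bounded_bilinear P" and f: "isCont f x" and g: "(g has_derivative g') (at x)" "g x = 0"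
  shows "((\<lambda>y. P (f y) (g y)) has_derivative (\<lambda>h. P (f x) (g' h))) (at x)"
proof -
  interpret P: bounded_bilinear P by (rule P)
  interpret g': bounded_linear g' using g(1) by (rule has_derivative_bounded_linear)
  obtain K where K: "\<And>a b. norm (P a b) \<le> norm a * norm b * K" "K > 0" using P.pos_bounded by blast
  obtain C where C: "\<And>h. norm (g' h) \<le> norm h * C" "C > 0" using g'.pos_bounded by blast
  have lip: "\<forall>\<^sub>F y in at x. norm (g y) \<le> (C + 1) * norm (y - x)"
  proof -
    have "\<forall>\<^sub>F y in at x. norm (g y - g x - g' (y - x)) \<le> 1 * norm (y - x)"
      using g(1)[unfolded has_derivative_within_alt2] zero_less_one by blast
    then show ?thesis
    proof eventually_elim
      case (elim y)
      have "norm (g y) \<le> norm (g y - g x - g' (y - x)) + norm (g' (y - x))"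
        using norm_triangle_ineq[of "g y - g x - g' (y - x)" "g' (y - x)"] g(2) by simp
      then show ?case using elim C(1)[of "y - x"] by (simp add: algebra_simps)
    qed
  qed
  have "((\<lambda>y. P (f y - f x) (g y)) has_derivative (\<lambda>h. 0)) (at x)"
    unfolding has_derivative_within_alt2
  proof (intro conjI allI impI)
    fix e :: real assume "e > 0"
    then have "e / (K * (C + 1)) > 0" using K C by simp
    then have "\<forall>\<^sub>F y in at x. dist (f y) (f x) < e / (K * (C + 1))"
      using f unfolding isCont_def by (rule tendstoD[rotated])
    then show "\<forall>\<^sub>F y in at x. norm (P (f y - f x) (g y) - P (f x - f x) (g x) - 0) \<le> e * norm (y - x)"
      using lip
    proof eventually_elim
      case (elim y)
      have "norm (P (f y - f x) (g y)) \<le> norm (f y - f x) * norm (g y) * K" by (rule K)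
      also have "\<dots> \<le> e / (K * (C + 1)) * ((C + 1) * norm (y - x)) * K"
        using elim K(2) C(2) \<open>e > 0\<close> by (intro mult_mono) (auto simp: dist_norm)
      also have "\<dots> = e * norm (y - x)"
        using K(2) C(2) add_pos_pos[OF K(2) mult_pos_pos[OF C(2) K(2)]] by (simp add: field_simps)
      finally show ?case by (simp add: P.zero_left)
    qed
  qed simp
  moreover have "((\<lambda>y. P (f x) (g y)) has_derivative (\<lambda>h. P (f x) (g' h))) (at x)"
    by (rule bounded_linear.has_derivative[OF P.bounded_linear_right g(1)])
  ultimately show ?thesis
    using has_derivative_add by (fastforce simp: P.diff_left)
qed

text \<open>The resolvent identity \<open>R y - R x = R y (A x - A y) R x\<close> first gives local boundedness and continuity
  of the inverse, then the derivative \<open>- R (DA) R\<close>; since this expression involves only \<open>R\<close> itself and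
  \<open>DA\<close>, an induction on the order of differentiability applies.\<close>

lemma Ck_on_blinfun_inverse:
  fixes A R :: "'x::real_normed_vector \<Rightarrow> ('a::real_normed_vector \<Rightarrow>\<^sub>L 'a)"
  assumes U: "open U"
    and inv: "\<And>x. x \<in> U \<Longrightarrow> R x o\<^sub>L A x = id_blinfun" "\<And>x. x \<in> U \<Longrightarrow> A x o\<^sub>L R x = id_blinfun"
  shows "Ck_on k U A \<Longrightarrow> Ck_on k U R"
proof (induction k)
  case 0
  have diff: "R y - R x = R y o\<^sub>L ((A x - A y) o\<^sub>L R x)" if "x \<in> U" "y \<in> U" for x y
  proof (rule blinfun_eqI)
    fix v
    have "R y (A y w) = w" "A x (R x w) = w" for w
      using inv that by (metis blinfun_apply_blinfun_compose blinfun_apply_id_blinfun id_apply)+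
    then show "(R y - R x) v = (R y o\<^sub>L ((A x - A y) o\<^sub>L R x)) v"
      by (simp add: blinfun.diff_left blinfun.diff_right)
  qed
  have "isCont R x" if x: "x \<in> U" for x
  proof -
    have A: "(A \<longlongrightarrow> A x) (at x)"
      using 0 U x by (simp add: continuous_on_eq_continuous_at isCont_def)
    let ?r = "norm (R x)"
    have "1 / (2 * (?r + 1)) > 0" by (simp add: add_nonneg_pos)
    from tendstoD[OF A this] have near: "\<forall>\<^sub>F y in at x. norm (A y - A x) * ?r \<le> 1 / 2"
    proof eventually_elim
      case (elim y)
      have "norm (A y - A x) * ?r \<le> 1 / (2 * (?r + 1)) * ?r"
        using elim by (intro mult_right_mono) (auto simp: dist_norm)
      also have "1 / (2 * (r + 1)) * r \<le> 1 / 2" if "r \<ge> 0" for r :: real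
        using that by (simp add: divide_simps)
      finally show ?case by simp
    qed
    have bound: "\<forall>\<^sub>F y in at x. norm (R y - R x) \<le> 2 * ?r * ?r * norm (A y - A x)"
      using near eventually_at_in_open'[OF U x]
    proof eventually_elim
      case (elim y)
      let ?t = "norm (A y - A x)"
      have step: "norm (R y - R x) \<le> norm (R y) * (?t * ?r)"
        unfolding diff[OF x elim(2)] norm_minus_commute[of "A y" "A x"]
        by (rule order_trans[OF norm_blinfun_compose mult_left_mono[OF norm_blinfun_compose norm_ge_zero]])
      also have "\<dots> \<le> norm (R y) * (1 / 2)" using elim(1) by (intro mult_left_mono) auto
      finally have "norm (R y) \<le> 2 * ?r" using norm_triangle_sub[of "R y" "R x"] by linarith
      then have "norm (R y) * (?t * ?r) \<le> 2 * ?r * (?t * ?r)" by (intro mult_right_mono) auto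
      then show ?case using step by (simp add: mult_ac)
    qed
    have "((\<lambda>y. 2 * ?r * ?r * norm (A y - A x)) \<longlongrightarrow> 0) (at x)"
      by (rule tendsto_eq_intros A refl)+ simp
    then have "((\<lambda>y. R y - R x) \<longlongrightarrow> 0) (at x)"
      by (rule Lim_null_comparison[OF bound])
    then show ?thesis unfolding isCont_def using Lim_null by blast
  qed
  then show ?case by (simp add: continuous_at_imp_continuous_on)
next
  case (Suc k)
  have R: "Ck_on k U R" using Suc Ck_on_Suc_imp by blast
  let ?DA = "\<lambda>x. frechet_derivative A (at x)"
  have "(R has_derivative (\<lambda>h. - (R x o\<^sub>L (?DA x h o\<^sub>L R x)))) (at x)" if x: "x \<in> U" for x
  proof -
    have "continuous_on U R" using R by (cases k) (auto intro!: continuous_at_imp_continuous_on differentiable_imp_continuous_within)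
    then have cont: "isCont R x" using U x by (simp add: continuous_on_eq_continuous_at)
    have "((\<lambda>y. A y - A x) has_derivative ?DA x) (at x)"
      using has_derivative_diff[OF Ck_on_SucD[OF Suc.prems x] has_derivative_const] by simp
    then have "((\<lambda>y. (A y - A x) o\<^sub>L R x) has_derivative (\<lambda>h. ?DA x h o\<^sub>L R x)) (at x)"
      by (rule bounded_linear.has_derivative[OF bounded_bilinear.bounded_linear_left[OF bounded_bilinear_blinfun_compose]])
    from has_derivative_bilinear_vanishing[OF bounded_bilinear_blinfun_compose cont this]
    have "((\<lambda>y. R y o\<^sub>L ((A y - A x) o\<^sub>L R x)) has_derivative (\<lambda>h. R x o\<^sub>L (?DA x h o\<^sub>L R x))) (at x)"
      by simp
    from has_derivative_diff[OF has_derivative_const this]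
    have "((\<lambda>y. R x - (R y o\<^sub>L ((A y - A x) o\<^sub>L R x))) has_derivative (\<lambda>h. - (R x o\<^sub>L (?DA x h o\<^sub>L R x)))) (at x)"
      by simp
    then show ?thesis
    proof (rule has_derivative_transform_within_open[OF _ U x])
      fix y assume y: "y \<in> U"
      have "R y (A y w) = w" "A x (R x w) = w" for w
        using inv x y by (metis blinfun_apply_blinfun_compose blinfun_apply_id_blinfun id_apply)+
      then show "R x - (R y o\<^sub>L ((A y - A x) o\<^sub>L R x)) = R y"
        by (intro blinfun_eqI) (simp add: blinfun.diff_left blinfun.diff_right)
    qed
  qed
  moreover have "Ck_on k U (\<lambda>x. - (R x o\<^sub>L (?DA x h o\<^sub>L R x)))" for h
    by (intro Ck_on_linear_compose[OF bounded_linear_minus[OF bounded_linear_ident] U]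
        Ck_on_bilinear[OF bounded_bilinear_blinfun_compose U] R) (use Suc.prems in auto)
  ultimately show ?case by (rule Ck_on_SucI[OF U])
qed

text \<open>The derivative of the inverse \<open>g\<close> at \<open>y\<close> is the inverse of the derivative of \<open>f\<close> at \<open>g y\<close>; hence
  \<open>k\<close> continuous derivatives of \<open>g\<close> yield one more.\<close>

theorem smooth_inverse_function_theorem:
  fixes f :: "'a::euclidean_space \<Rightarrow> 'a"
  assumes U: "open U" "x0 \<in> U" and f: "\<And>k. Ck_on k U f" and id: "(f has_derivative id) (at x0)"
  obtains U' V g where "open U'" "U' \<subseteq> U" "x0 \<in> U'" "open V" "homeomorphism U' V f g" "\<And>k. Ck_on k V g"
proof -
  define f' where "f' x = Blinfun (frechet_derivative f (at x))" for x
  have f'_apply: "blinfun_apply (f' x) = frechet_derivative f (at x)" if "x \<in> U" for x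
    unfolding f'_def
    using has_derivative_bounded_linear[OF Ck_on_SucD[OF f that]] by (rule bounded_linear_Blinfun_apply)
  have f'_Ck: "Ck_on k U f'" for k
  proof (rule Ck_on_blinfun[OF U(1)])
    fix b :: 'a
    have "Ck_on k U (\<lambda>x. frechet_derivative f (at x) b)" using f[of "Suc k"] by simp
    then show "Ck_on k U (\<lambda>x. blinfun_apply (f' x) b)"
      using Ck_on_cong[OF U(1), of "\<lambda>x. blinfun_apply (f' x) b" "\<lambda>x. frechet_derivative f (at x) b" k] f'_apply by simp
  qed
  have der: "(f has_derivative blinfun_apply (f' x)) (at x)" if "x \<in> U" for x
    using Ck_on_SucD[OF f that] f'_apply[OF that] by simp
  have cont: "continuous_on U f'" using f'_Ck[of 0] by simp
  have "blinfun_apply (f' x0) = id" using has_derivative_unique[OF der[OF U(2)] id] .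
  then have inv0: "id_blinfun o\<^sub>L f' x0 = id_blinfun" by (intro blinfun_eqI) simp
  obtain U' V g g' where g: "open U'" "U' \<subseteq> U" "x0 \<in> U'" "open V" "homeomorphism U' V f g"
    and g': "\<And>y. y \<in> V \<Longrightarrow> (g has_derivative (g' y)) (at y)"
      "\<And>y. y \<in> V \<Longrightarrow> g' y = inv (blinfun_apply (f'(g y)))"
      "\<And>y. y \<in> V \<Longrightarrow> bij (blinfun_apply (f'(g y)))"
    using inverse_function_theorem[OF U(1) der cont U(2) inv0] by metis
  define R where "R y = Blinfun (g' y)" for y
  have R_apply: "blinfun_apply (R y) = g' y" if "y \<in> V" for y
    unfolding R_def using has_derivative_bounded_linear[OF g'(1)[OF that]] by (rule bounded_linear_Blinfun_apply)
  have inv: "R y o\<^sub>L f' (g y) = id_blinfun" "f' (g y) o\<^sub>L R y = id_blinfun" if "y \<in> V" for y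
    using g'(2,3)[OF that] R_apply[OF that]
    by (auto intro!: blinfun_eqI simp: bij_is_inj bij_is_surj surj_f_inv_f)
  have gV: "g ` V \<subseteq> U" using g(2,5) unfolding homeomorphism_def by blast
  have "Ck_on k V g" for k
  proof (induction k)
    case 0
    then show ?case using g(5) by (simp add: homeomorphism_def)
  next
    case (Suc k)
    have "Ck_on k V R"
      by (rule Ck_on_blinfun_inverse[OF g(4), where A = "\<lambda>y. f' (g y)"])
        (use inv Ck_on_compose[OF U(1) g(4) gV f'_Ck Suc] in auto)
    then have "Ck_on k V (\<lambda>y. blinfun_apply (R y) v)" for v
      by (rule Ck_on_linear_compose[OF bounded_bilinear.bounded_linear_left[OF bounded_bilinear_blinfun_apply] g(4)])
    then have "Ck_on k V (\<lambda>y. g' y v)" for v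
      using Ck_on_cong[OF g(4), of "\<lambda>y. blinfun_apply (R y) v" "\<lambda>y. g' y v" k] R_apply by simp
    then show ?case
      using g'(1) by (intro Ck_on_SucI[OF g(4)])
  qed
  then show ?thesis using that g by blast
qed

section \<open>Local geometry of submanifolds\<close>

lemma smooth_on_openI: "open S \<Longrightarrow> (\<And>k. Ck_on k S f) \<Longrightarrow> smooth_on S f"
  unfolding smooth_on_def by blast

text \<open>A chart and its inverse extended to open sets of the ambient space, with domains shrunk until each
  maps the relevant points into the domain of the other.\<close>

lemma submanifold_at_charts:
  fixes M :: "'v::real_normed_vector set"
  assumes "submanifold_at m M p"
  obtains L B Q and g F :: "'v \<Rightarrow> 'v" where "subspace L" "dim L = m" "open B" "open Q" "p \<in> Q" "p \<in> M"
    "\<And>k. Ck_on k B g" "\<And>k. Ck_on k Q F"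
    "\<And>u. u \<in> B \<inter> L \<Longrightarrow> g u \<in> M \<inter> Q \<and> F (g u) = u"
    "\<And>z. z \<in> M \<inter> Q \<Longrightarrow> F z \<in> B \<inter> L \<and> g (F z) = z"
proof -
  obtain U L U' and f :: "'v \<Rightarrow> 'v" where U: "openin (top_of_set M) U" "p \<in> U" and L: "subspace L" "dim L = m"
    and U': "openin (top_of_set L) U'" and f: "diffeo_betw U U' f"
    using assms unfolding submanifold_at_def by blast
  obtain Q0 B0 where Q0: "open Q0" "U = M \<inter> Q0" and B0: "open B0" "U' = L \<inter> B0"
    using U(1) U' unfolding openin_open by blast
  have bij: "bij_betw f U U'" and sf: "smooth_on U f" and sg: "smooth_on U' (inv_into U f)"
    using f by (auto simp: diffeo_betw_def)
  have fp: "f p \<in> U'" using bij U(2) by (auto simp: bij_betw_def)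
  obtain Q1 F where Q1: "open Q1" "p \<in> Q1" "\<And>k. Ck_on k Q1 F" "\<And>y. y \<in> Q1 \<inter> U \<Longrightarrow> F y = f y"
    using bspec[OF sf[unfolded smooth_on_def] U(2)] by blast
  obtain B1 g where B1: "open B1" "f p \<in> B1" "\<And>k. Ck_on k B1 g"
      "\<And>y. y \<in> B1 \<inter> U' \<Longrightarrow> g y = inv_into U f y"
    using bspec[OF sg[unfolded smooth_on_def] fp] by blast
  have inv: "inv_into U f u \<in> U" "f (inv_into U f u) = u" if "u \<in> U'" for u
    using bij that by (auto simp: bij_betw_def inv_into_into f_inv_into_f)
  have inv': "inv_into U f (f z) = z" "f z \<in> U'" if "z \<in> U" for z
    using bij that by (auto simp: bij_betw_inv_into_left bij_betw_def)
  define B where "B = B0 \<inter> (B1 \<inter> g -` (Q0 \<inter> Q1))"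
  have "open (B1 \<inter> g -` (Q0 \<inter> Q1))"
    using B1(3)[of 0] Q0(1) Q1(1) B1(1) by (intro continuous_open_preimage) auto
  then have B: "open B" using B0(1) by (simp add: B_def open_Int)
  define Q where "Q = (Q0 \<inter> Q1) \<inter> F -` B"
  have Q: "open Q"
    unfolding Q_def using Q1(3)[of 0] Q0(1) Q1(1) B
    by (intro continuous_open_preimage) (auto intro: continuous_on_subset)
  have zU: "F z = f z" "f z \<in> B" if "z \<in> M \<inter> Q" for z
    using that Q1(4)[of z] Q0(2) unfolding Q_def by auto
  show ?thesis
  proof (rule that[OF L B Q])
    have "g (f p) = p" using B1(4) fp B1(2) inv'(1)[OF U(2)] by simp
    then have "f p \<in> B" using fp B0(2) B1(2) U(2) Q0(2) Q1(2) unfolding B_def by auto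
    then show "p \<in> Q" using Q1(4)[of p] U(2) Q0(2) Q1(2) unfolding Q_def by auto
    show "p \<in> M" using U(2) Q0(2) by blast
    show "Ck_on k B g" for k by (rule Ck_on_subset[OF B1(3)]) (auto simp: B_def)
    show "Ck_on k Q F" for k by (rule Ck_on_subset[OF Q1(3)]) (auto simp: Q_def)
    show "g u \<in> M \<inter> Q \<and> F (g u) = u" if "u \<in> B \<inter> L" for u
    proof -
      have u: "u \<in> U'" "u \<in> B1" "g u \<in> Q0 \<inter> Q1" using that B0(2) unfolding B_def by auto
      have gu: "g u \<in> U" "f (g u) = u" using B1(4) u inv[OF u(1)] by auto
      then have "F (g u) = u" using Q1(4)[of "g u"] u(3) by auto
      then show ?thesis using gu(1) Q0(2) u(3) that unfolding Q_def by auto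
    qed
    show "F z \<in> B \<inter> L \<and> g (F z) = z" if z: "z \<in> M \<inter> Q" for z
    proof -
      have zU': "z \<in> U" using z Q0(2) unfolding Q_def by auto
      then have "f z \<in> U' \<inter> B1" using inv'(2) zU[OF z] unfolding B_def by auto
      then show ?thesis using zU[OF z] B1(4) inv'(1)[OF zU'] B0(2) by auto
    qed
  qed
qed

lemma has_vector_derivative_compose:
  assumes "(c has_vector_derivative v) (at t)" "(F has_derivative D) (at (c t))"
  shows "((\<lambda>t. F (c t)) has_vector_derivative D v) (at t)"
proof -
  interpret bounded_linear D using assms(2) by (rule has_derivative_bounded_linear)
  show ?thesis
    using has_derivative_compose[OF assms(1)[unfolded has_vector_derivative_def] assms(2)]
    by (simp add: has_vector_derivative_def scale)
qed

lemma has_vector_derivative_eventually_cong: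
  assumes "(c has_vector_derivative v) (at t)" "\<forall>\<^sub>F x in at t. c x = d x" "c t = d t"
  shows "(d has_vector_derivative v) (at t)"
  using assms has_derivative_transform_eventually[of c _ t UNIV d] by (simp add: has_vector_derivative_def)

lemma has_vector_derivative_line: "((\<lambda>t::real. x + t *\<^sub>R v) has_vector_derivative v) (at t)"
  by (auto intro!: derivative_eq_intros)

text \<open>Every functional orthogonal to \<open>L\<close> is constant along the curve, so it annihilates the velocity.\<close>

lemma has_vector_derivative_in_subspace:
  fixes c :: "real \<Rightarrow> 'a::euclidean_space"
  assumes L: "subspace L" and c: "(c has_vector_derivative v) (at 0)" and e: "\<forall>\<^sub>F t in at 0. c t \<in> L" "c 0 \<in> L"
  shows "v \<in> L"
proof -
  have "orthogonal v w" if w: "w \<in> L\<^sup>\<bottom>" for w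
  proof -
    have 1: "((\<lambda>t. c t \<bullet> w) has_vector_derivative v \<bullet> w) (at 0)"
      by (rule has_vector_derivative_compose[OF c]) (auto intro!: derivative_eq_intros)
    have 0: "x \<bullet> w = 0" if "x \<in> L" for x
      using w that by (auto simp: orthogonal_comp_def orthogonal_def inner_commute)
    have "((\<lambda>t::real. 0) has_vector_derivative v \<bullet> w) (at 0)"
      by (rule has_vector_derivative_eventually_cong[OF 1]) (use e 0 in \<open>auto elim: eventually_mono\<close>)
    then show ?thesis
      using vector_derivative_unique_at[OF _ has_vector_derivative_const] by (auto simp: orthogonal_def)
  qed
  then have "v \<in> (L\<^sup>\<bottom>)\<^sup>\<bottom>" unfolding orthogonal_comp_def by (auto simp: orthogonal_commute)
  then show ?thesis using orthogonal_comp_self[OF L] by simp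
qed

lemma tangent_spaceE:
  assumes "v \<in> tangent_space S p"
  obtains c and e :: real where "e > 0" "smooth_on {-e<..<e} c" "\<And>t. t \<in> {-e<..<e} \<Longrightarrow> c t \<in> S" "c 0 = p"
    "(c has_vector_derivative v) (at 0)"
proof -
  obtain c e where "(e::real) > 0 \<and> smooth_on {-e<..<e} c \<and> c ` {-e<..<e} \<subseteq> S \<and> c 0 = p \<and>
          (c has_vector_derivative v) (at 0)"
    using assms by (auto simp: tangent_space_def)
  then show ?thesis by (intro that[of e c]) auto
qed

text \<open>The chart is reparametrized by the tangent space itself, so that its derivative at \<open>0\<close> restricts
  to the identity there. The last conclusion allows curves that are merely differentiable at \<open>0\<close> when
  computing tangent vectors.\<close>

lemma submanifold_at_tangent_chart:
  fixes M :: "'v::euclidean_space set"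
  assumes M: "submanifold_at m M p"
  obtains \<gamma> :: "'v \<Rightarrow> 'v" and B D where "subspace (tangent_space M p)" "dim (tangent_space M p) = m"
    "open B" "0 \<in> B" "\<And>k. Ck_on k B \<gamma>" "\<gamma> 0 = p" "(\<gamma> has_derivative D) (at 0)"
    "\<And>t. t \<in> tangent_space M p \<Longrightarrow> D t = t"
    "\<And>t. t \<in> B \<inter> tangent_space M p \<Longrightarrow> \<gamma> t \<in> M"
    "\<And>B'. open B' \<Longrightarrow> 0 \<in> B' \<Longrightarrow> \<exists>Q. open Q \<and> p \<in> Q \<and> M \<inter> Q \<subseteq> \<gamma> ` (B \<inter> B' \<inter> tangent_space M p)"
    "\<And>c v. (c has_vector_derivative v) (at 0) \<Longrightarrow> c 0 = p \<Longrightarrow> \<forall>\<^sub>F t in at 0. c t \<in> M \<Longrightarrow> v \<in> tangent_space M p"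
proof -
  obtain L B Q and g F :: "'v \<Rightarrow> 'v" where L: "subspace L" "dim L = m" and B: "open B" and Q: "open Q" "p \<in> Q" "p \<in> M"
    and g: "\<And>k. Ck_on k B g" and F: "\<And>k. Ck_on k Q F"
    and gF: "\<And>u. u \<in> B \<inter> L \<Longrightarrow> g u \<in> M \<inter> Q \<and> F (g u) = u"
    and Fg: "\<And>z. z \<in> M \<inter> Q \<Longrightarrow> F z \<in> B \<inter> L \<and> g (F z) = z"
    using submanifold_at_charts[OF M] by blast
  define u0 where "u0 = F p"
  have u0: "u0 \<in> B" "u0 \<in> L" "g u0 = p" using Fg[of p] Q by (auto simp: u0_def)
  define Dg where "Dg = frechet_derivative g (at u0)"
  define DF where "DF = frechet_derivative F (at p)"
  have Dg: "(g has_derivative Dg) (at u0)"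
    unfolding Dg_def by (rule Ck_on_SucD[OF g u0(1)])
  have DF: "(F has_derivative DF) (at p)"
    unfolding DF_def by (rule Ck_on_SucD[OF F Q(2)])
  have lin: "bounded_linear Dg" "bounded_linear DF"
    using Dg DF by (auto intro: has_derivative_bounded_linear)
  note lDg = bounded_linear.linear[OF lin(1)] and lDF = bounded_linear.linear[OF lin(2)]
  have near: "\<forall>\<^sub>F t in at (0::real). u0 + t *\<^sub>R b \<in> B" for b
  proof -
    have "((\<lambda>t::real. u0 + t *\<^sub>R b) \<longlongrightarrow> u0 + 0 *\<^sub>R b) (at 0)"
      by (intro tendsto_intros)
    then show ?thesis using B u0(1) by (auto dest: topological_tendstoD)
  qed
  have curve: "v = Dg (DF v) \<and> DF v \<in> L"
    if c: "(c has_vector_derivative v) (at 0)" "c 0 = p" "\<forall>\<^sub>F t in at 0. c t \<in> M" for c v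
  proof
    have "(c \<longlongrightarrow> p) (at 0)"
      using has_vector_derivative_continuous[OF c(1)] c(2) by (simp add: continuous_at isCont_def)
    then have "\<forall>\<^sub>F t in at 0. c t \<in> Q" using Q by (auto dest: topological_tendstoD)
    then have ev: "\<forall>\<^sub>F t in at 0. F (c t) \<in> L \<and> g (F (c t)) = c t"
      using c(3) by eventually_elim (use Fg in auto)
    have dFc: "((\<lambda>t. F (c t)) has_vector_derivative DF v) (at 0)"
      using has_vector_derivative_compose[OF c(1), of F DF] DF c(2) by simp
    show "DF v \<in> L"
      by (rule has_vector_derivative_in_subspace[OF L(1) dFc]) (use ev u0(2) c(2) u0_def in \<open>auto elim: eventually_mono\<close>)
    have "((\<lambda>t. g (F (c t))) has_vector_derivative Dg (DF v)) (at 0)"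
      using has_vector_derivative_compose[OF dFc, of g Dg] Dg c(2) u0_def by simp
    then have "(c has_vector_derivative Dg (DF v)) (at 0)"
      by (rule has_vector_derivative_eventually_cong)
        (use ev c(2) u0(3) u0_def in \<open>auto elim: eventually_mono\<close>)
    then show "v = Dg (DF v)" using c(1) vector_derivative_unique_at by blast
  qed
  have DFDg: "DF (Dg b) = b" if "b \<in> L" for b
  proof -
    have 1: "((\<lambda>t::real. F (g (u0 + t *\<^sub>R b))) has_vector_derivative DF (Dg b)) (at 0)"
      using has_vector_derivative_compose[OF has_vector_derivative_line[of u0 b 0],
          OF has_derivative_compose[of g Dg _ UNIV F DF]] Dg DF u0(3) by simp
    have 2: "((\<lambda>t::real. u0 + t *\<^sub>R b) has_vector_derivative b) (at 0)"
      by (rule has_vector_derivative_line)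
    have "\<forall>\<^sub>F t in at 0. F (g (u0 + t *\<^sub>R b)) = u0 + t *\<^sub>R b"
      using near[of b] by eventually_elim (use gF u0(2) that L(1) in \<open>auto simp: subspace_add subspace_scale\<close>)
    then have "((\<lambda>t::real. u0 + t *\<^sub>R b) has_vector_derivative DF (Dg b)) (at 0)"
      by (rule has_vector_derivative_eventually_cong[OF 1]) (use u0 u0_def in simp)
    then show ?thesis using 2 vector_derivative_unique_at by blast
  qed
  have T_sub: "v \<in> Dg ` L" if "v \<in> tangent_space M p" for v
  proof -
    obtain c e where c: "(e::real) > 0" "c ` {-e<..<e} \<subseteq> M" "c 0 = p" "(c has_vector_derivative v) (at 0)"
      using \<open>v \<in> tangent_space M p\<close> unfolding tangent_space_def by blast
    have "\<forall>\<^sub>F t in at (0::real). t \<in> {-e<..<e}"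
      using c(1) by (intro eventually_at_in_open') auto
    then have "\<forall>\<^sub>F t in at 0. c t \<in> M" by eventually_elim (use c(2) in auto)
    then show ?thesis using curve[OF c(4,3)] by blast
  qed
  have T_sup: "Dg b \<in> tangent_space M p" if b: "b \<in> L" for b
  proof -
    have "\<exists>d>0. \<forall>t. t \<noteq> 0 \<and> dist t (0::real) < d \<longrightarrow> u0 + t *\<^sub>R b \<in> B"
      using near[of b] by (simp add: eventually_at)
    then obtain d where d: "d > 0" "\<And>t::real. \<bar>t\<bar> < d \<Longrightarrow> u0 + t *\<^sub>R b \<in> B"
      using u0(1) by (metis add_0_right dist_real_def diff_zero scaleR_zero_left)
    have "smooth_on {-d<..<d} (\<lambda>t. g (u0 + t *\<^sub>R b))"
      using d(2) by (intro smooth_on_openI Ck_on_affine_compose[OF bounded_linear_scaleR_left _ _ g]) auto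
    moreover have "(\<lambda>t. g (u0 + t *\<^sub>R b)) ` {-d<..<d} \<subseteq> M"
      using d(2) gF u0(2) b L(1) by (auto simp: subspace_add subspace_scale)
    moreover have "((\<lambda>t. g (u0 + t *\<^sub>R b)) has_vector_derivative Dg b) (at 0)"
      using has_vector_derivative_compose[OF has_vector_derivative_line[of u0 b 0], of g Dg] Dg by simp
    ultimately show ?thesis
      unfolding tangent_space_def using d(1) u0(3) by (intro CollectI exI[of _ "\<lambda>t. g (u0 + t *\<^sub>R b)"] exI[of _ d]) simp
  qed
  have T: "tangent_space M p = Dg ` L" using T_sub T_sup by blast
  have subT: "subspace (tangent_space M p)"
    unfolding T by (rule linear_subspace_image[OF lDg L(1)])
  have injL: "inj_on Dg L" using DFDg by (metis inj_on_inverseI)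
  have dimT: "dim (tangent_space M p) = m"
    unfolding T using dim_image_eq[OF lDg, of L] injL L span_eq_iff by metis
  define \<gamma> where "\<gamma> t = g (u0 + DF t)" for t
  define B0 where "B0 = (\<lambda>t. u0 + DF t) -` B"
  have contDF: "continuous_on UNIV (\<lambda>t. u0 + DF t)"
    by (intro continuous_intros linear_continuous_on lin)
  have B0: "open B0" unfolding B0_def by (rule open_vimage[OF B contDF])
  have zero: "DF 0 = 0" by (rule linear_0[OF lDF])
  have DF_T: "DF t \<in> L" "Dg (DF t) = t" if "t \<in> tangent_space M p" for t
    using that DFDg unfolding T by auto
  show ?thesis
  proof (rule that[OF subT dimT B0])
    show "0 \<in> B0" using u0 zero by (simp add: B0_def)
    show "Ck_on k B0 \<gamma>" for k
      unfolding \<gamma>_def by (rule Ck_on_affine_compose[OF lin(2) B0 _ g]) (simp add: B0_def)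
    show "\<gamma> 0 = p" using u0 zero by (simp add: \<gamma>_def)
    have "((\<lambda>t. u0 + DF t) has_derivative DF) (at 0)"
      using has_derivative_add[OF has_derivative_const bounded_linear_imp_has_derivative[OF lin(2)]] by simp
    moreover have "(g has_derivative Dg) (at (u0 + DF 0))" using Dg zero by simp
    ultimately show "(\<gamma> has_derivative (\<lambda>t. Dg (DF t))) (at 0)"
      unfolding \<gamma>_def by (rule has_derivative_compose)
    show "Dg (DF t) = t" if "t \<in> tangent_space M p" for t using DF_T that by blast
    show "\<gamma> t \<in> M" if "t \<in> B0 \<inter> tangent_space M p" for t
      using that gF DF_T(1) u0(2) subspace_add[OF L(1)] by (auto simp: \<gamma>_def B0_def)
    show "\<exists>Q. open Q \<and> p \<in> Q \<and> M \<inter> Q \<subseteq> \<gamma> ` (B0 \<inter> B' \<inter> tangent_space M p)"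
      if B': "open B'" "0 \<in> B'" for B'
    proof (intro exI conjI)
      let ?\<tau> = "\<lambda>z. Dg (F z - u0)"
      let ?Q = "Q \<inter> ?\<tau> -` B'"
      have "continuous_on Q ?\<tau>"
        using F[of 0] linear_continuous_on[OF lin(1)]
        by (intro continuous_on_compose2[of UNIV Dg Q "\<lambda>z. F z - u0"]) (auto intro!: continuous_intros)
      then show "open ?Q" by (rule continuous_open_preimage[OF _ Q(1) B'(1)])
      show "p \<in> ?Q" using Q(2) B'(2) linear_0[OF lDg] by (simp add: u0_def)
      show "M \<inter> ?Q \<subseteq> \<gamma> ` (B0 \<inter> B' \<inter> tangent_space M p)"
      proof
        fix z assume z: "z \<in> M \<inter> ?Q"
        then have Fz: "F z \<in> B" "F z \<in> L" "g (F z) = z" using Fg by blast+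
        then have "F z - u0 \<in> L" using u0(2) L(1) by (simp add: subspace_diff)
        then have "?\<tau> z \<in> tangent_space M p" "DF (?\<tau> z) = F z - u0" using T DFDg by auto
        then show "z \<in> \<gamma> ` (B0 \<inter> B' \<inter> tangent_space M p)"
          using z Fz by (intro image_eqI[of _ _ "?\<tau> z"]) (auto simp: \<gamma>_def B0_def)
      qed
    qed
    show "v \<in> tangent_space M p"
      if "(c has_vector_derivative v) (at 0)" "c 0 = p" "\<forall>\<^sub>F t in at 0. c t \<in> M" for c v
      using curve[OF that] T by blast
  qed
qed

text \<open>The mean value inequality for \<open>f - D\<close>, whose derivative is small near \<open>x0\<close> by continuity.\<close>

lemma Ck_on_strict_derivative:
  fixes f :: "'a::euclidean_space \<Rightarrow> 'b::real_normed_vector"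
  assumes U: "open U" "x0 \<in> U" and f: "Ck_on (Suc 0) U f" and D: "(f has_derivative D) (at x0)" and e: "e > 0"
  obtains \<delta> where "\<delta> > 0" "ball x0 \<delta> \<subseteq> U"
    "\<And>x y. x \<in> ball x0 \<delta> \<Longrightarrow> y \<in> ball x0 \<delta> \<Longrightarrow> norm (f x - f y - D (x - y)) \<le> e * norm (x - y)"
proof -
  let ?D = "\<lambda>x. frechet_derivative f (at x)"
  define f' where "f' x = Blinfun (?D x)" for x
  have f': "blinfun_apply (f' x) = ?D x" if "x \<in> U" for x
    unfolding f'_def
    using has_derivative_bounded_linear[OF Ck_on_SucD[OF f that]] by (rule bounded_linear_Blinfun_apply)
  have "Ck_on 0 U (\<lambda>x. blinfun_apply (f' x) b)" for b
    using f f' Ck_on_cong[OF U(1), of "\<lambda>x. blinfun_apply (f' x) b" "\<lambda>x. ?D x b" 0] by simp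
  then have "continuous_on U f'" using Ck_on_blinfun[OF U(1), of 0 f'] by simp
  then have "(f' \<longlongrightarrow> f' x0) (at x0)" using U by (simp add: continuous_on_eq_continuous_at isCont_def)
  then obtain d where d: "d > 0" "\<And>x. x \<noteq> x0 \<Longrightarrow> dist x x0 < d \<Longrightarrow> dist (f' x) (f' x0) < e"
    using e unfolding tendsto_iff eventually_at by blast
  obtain r where r: "r > 0" "ball x0 r \<subseteq> U" using U open_contains_ball by blast
  have D_eq: "blinfun_apply (f' x0) = D" using f'[OF U(2)] D frechet_derivative_at by metis
  define \<delta> where "\<delta> = min d r"
  show ?thesis
  proof (rule that)
    show "\<delta> > 0" "ball x0 \<delta> \<subseteq> U" using d r by (auto simp: \<delta>_def)
    fix x y assume xy: "x \<in> ball x0 \<delta>" "y \<in> ball x0 \<delta>"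
    have "norm ((f x - D x) - (f y - D y)) \<le> e * norm (x - y)"
    proof (rule differentiable_bound[OF convex_ball _ _ xy, where f' = "\<lambda>z. blinfun_apply (f' z - f' x0)"])
      fix z assume z: "z \<in> ball x0 \<delta>"
      then have "z \<in> U" using r by (auto simp: \<delta>_def)
      then have "(f has_derivative blinfun_apply (f' z)) (at z)" using Ck_on_SucD[OF f] f' by simp
      moreover have "(D has_derivative D) (at z)"
        using D_eq bounded_linear_imp_has_derivative[OF blinfun.bounded_linear_right] by metis
      ultimately show "((\<lambda>z. f z - D z) has_derivative blinfun_apply (f' z - f' x0)) (at z within ball x0 \<delta>)"
        using has_derivative_diff[of f "blinfun_apply (f' z)" "at z" D D] D_eq
        by (simp add: minus_blinfun.rep_eq has_derivative_at_withinI)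
      have "norm (f' z - f' x0) \<le> e"
      proof (cases "z = x0")
        case False
        then show ?thesis using d(2)[OF False] z by (simp add: \<delta>_def dist_norm norm_minus_commute)
      qed (use e in simp)
      then show "onorm (blinfun_apply (f' z - f' x0)) \<le> e" by (simp add: norm_blinfun.rep_eq)
    qed
    moreover have Dxy: "D (x - y) = D x - D y"
      using D by (intro linear_diff bounded_linear.linear has_derivative_bounded_linear)
    ultimately show "norm (f x - f y - D (x - y)) \<le> e * norm (x - y)"
      unfolding Dxy by (simp add: algebra_simps)
  qed
qed

text \<open>Secants near a point are almost tangent at that point: both end points are parametrized by the
  tangent space, and the parametrization is strictly differentiable with derivative the identity.\<close>

lemma submanifold_at_secant:
  fixes M :: "'v::euclidean_space set"
  assumes M: "submanifold_at m M p" and e: "e > 0"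
  obtains Q where "open Q" "p \<in> Q"
    "\<And>x y. x \<in> M \<inter> Q \<Longrightarrow> y \<in> M \<inter> Q \<Longrightarrow> \<exists>t\<in>tangent_space M p. norm (x - y - t) \<le> e * norm (x - y)"
proof -
  obtain \<gamma> :: "'v \<Rightarrow> 'v" and B D where T: "subspace (tangent_space M p)"
    and B: "open B" "0 \<in> B" "\<And>k. Ck_on k B \<gamma>" and D: "(\<gamma> has_derivative D) (at 0)"
    and DT: "\<And>t. t \<in> tangent_space M p \<Longrightarrow> D t = t"
    and nbhd: "\<And>B'. open B' \<Longrightarrow> 0 \<in> B' \<Longrightarrow> \<exists>Q. open Q \<and> p \<in> Q \<and> M \<inter> Q \<subseteq> \<gamma> ` (B \<inter> B' \<inter> tangent_space M p)"
    by (rule submanifold_at_tangent_chart[OF M]) blast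
  \<comment> \<open>the bound \<open>1 / 2\<close> compares \<open>s - t\<close> with \<open>x - y\<close> at the cost of a factor 2, which \<open>e / 2\<close> absorbs\<close>
  define e' where "e' = min (1/2) (e/2)"
  have e': "e' > 0" "e' \<le> 1/2" "e' \<le> e/2" using e by (auto simp: e'_def)
  obtain \<delta> where \<delta>: "\<delta> > 0" "ball 0 \<delta> \<subseteq> B"
      "\<And>x y. x \<in> ball 0 \<delta> \<Longrightarrow> y \<in> ball 0 \<delta> \<Longrightarrow> norm (\<gamma> x - \<gamma> y - D (x - y)) \<le> e' * norm (x - y)"
    by (rule Ck_on_strict_derivative[OF B(1,2) B(3) D e'(1)], rule that)
  obtain Q where Q: "open Q" "p \<in> Q" "M \<inter> Q \<subseteq> \<gamma> ` (B \<inter> ball 0 \<delta> \<inter> tangent_space M p)"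
    using nbhd[of "ball 0 \<delta>"] \<delta>(1) by auto
  show ?thesis
  proof (rule that[OF Q(1,2)])
    fix x y assume "x \<in> M \<inter> Q" "y \<in> M \<inter> Q"
    then obtain s t where st: "x = \<gamma> s" "y = \<gamma> t" "s \<in> ball 0 \<delta>" "t \<in> ball 0 \<delta>"
        "s \<in> tangent_space M p" "t \<in> tangent_space M p"
      using Q(3) by blast
    have mem: "s - t \<in> tangent_space M p" using st T by (simp add: subspace_diff)
    have 1: "norm (x - y - (s - t)) \<le> e' * norm (s - t)"
      using \<delta>(3)[OF st(3,4)] DT[OF mem] st(1,2) by simp
    have "norm (s - t) \<le> norm (x - y) + norm (x - y - (s - t))"
      using norm_triangle_sub[of "s - t" "x - y"] by (simp add: norm_minus_commute)
    moreover have "e' * norm (s - t) \<le> 1/2 * norm (s - t)" using e'(2) by (intro mult_right_mono) auto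
    ultimately have "norm (s - t) \<le> 2 * norm (x - y)" using 1 by linarith
    then have "e' * norm (s - t) \<le> e' * (2 * norm (x - y))" using e'(1) by (intro mult_left_mono) auto
    also have "\<dots> \<le> e * norm (x - y)"
      using mult_right_mono[OF e'(3), of "2 * norm (x - y)"] by simp
    finally show "\<exists>t\<in>tangent_space M p. norm (x - y - t) \<le> e * norm (x - y)" using 1 mem by force
  qed
qed


lemma span_singleton_scaleR:
  fixes v :: "'a::real_vector"
  assumes "r \<noteq> 0"
  shows "span {r *\<^sub>R v} = span {v}"
proof -
  have "(1 / r) *\<^sub>R (r *\<^sub>R v) \<in> span {r *\<^sub>R v}" by (intro span_scale span_base) simp
  then have "v \<in> span {r *\<^sub>R v}" using assms by simp
  then show ?thesis by (intro antisym span_minimal) (auto intro: span_scale span_base)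
qed

lemma vHom_vquotI:
  "h \<in> car (vHom (vsub l) (vquot E S)) \<Longrightarrow> h ` l \<subseteq> coset S ` E' \<Longrightarrow> h \<in> car (vHom (vsub l) (vquot E' S))"
  by (auto simp: vHom_def vlinear_def vsub_def vquot_def)

lemma affine_chart_image_tangent_annihilated:
  assumes a: "bounded_linear a" and v: "v \<in> tangent_space (affine_chart_image X a) x"
  shows "a v = 0"
proof -
  obtain c e where c: "(e::real) > 0" "smooth_on {-e<..<e} c"
      "\<And>t. t \<in> {-e<..<e} \<Longrightarrow> c t \<in> affine_chart_image X a" "c 0 = x"
      "(c has_vector_derivative v) (at 0)"
    by (rule tangent_spaceE[OF v], rule that)
  have 1: "((\<lambda>t. a (c t)) has_vector_derivative a v) (at 0)"
    by (rule has_vector_derivative_compose[OF c(5) bounded_linear_imp_has_derivative[OF a]])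
  have "\<forall>\<^sub>F t in at (0::real). t \<in> {-e<..<e}"
    using c(1) by (intro eventually_at_in_open') auto
  then have "\<forall>\<^sub>F t in at 0. a (c t) = 1"
    by eventually_elim (use c(3) in \<open>auto simp: affine_chart_image_def\<close>)
  then have "((\<lambda>t::real. 1) has_vector_derivative a v) (at 0)"
    by (rule has_vector_derivative_eventually_cong[OF 1]) (use c(1) c(3)[of 0] in \<open>auto simp: affine_chart_image_def\<close>)
  then show ?thesis using vector_derivative_unique_at[OF _ has_vector_derivative_const] by auto
qed

text \<open>In the affine chart the tangent space of \<open>X\<close> consists of the maps \<open>r x \<mapsto> r t\<close> modulo the line, for
  \<open>t\<close> tangent to the image of \<open>X\<close> in the chart. A lift of a curve in \<open>X\<close> can be rescaled into the
  chart; this changes its velocity by a scalar factor and a multiple of \<open>x\<close>.\<close>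

lemma Y_fibre_eq:
  fixes X :: "'v::euclidean_space set set"
  assumes a: "bounded_linear a" and x: "x \<in> affine_chart_image X a"
    and M: "submanifold_at m (affine_chart_image X a) x"
  shows "Y_fibre X (span {x}) = span (insert x (tangent_space (affine_chart_image X a) x))"
    and "dim (Y_fibre X (span {x})) = m + 1"
    and "y \<in> Y_fibre X (span {x}) \<longleftrightarrow> (\<exists>r. \<exists>t\<in>tangent_space (affine_chart_image X a) x. y = r *\<^sub>R x + t)"
proof -
  let ?M = "affine_chart_image X a" and ?l = "span {x}"
  let ?T = "tangent_space ?M x"
  let ?Y = "span (insert x ?T)"
  interpret a: bounded_linear a by (rule a)
  have T: "subspace ?T" "dim ?T = m"
    and curve: "\<And>c v. (c has_vector_derivative v) (at 0) \<Longrightarrow> c 0 = x \<Longrightarrow> \<forall>\<^sub>F t in at 0. c t \<in> ?M \<Longrightarrow> v \<in> ?T"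
    using submanifold_at_tangent_chart[OF M] by metis+
  have x1: "a x = 1" and lX: "?l \<in> X" using x by (auto simp: affine_chart_image_def)
  have x0: "x \<noteq> 0" using x1 a.zero by auto
  have Y: "y \<in> ?Y \<longleftrightarrow> (\<exists>r. \<exists>t\<in>?T. y = r *\<^sub>R x + t)" for y
  proof -
    have "y \<in> ?Y \<longleftrightarrow> (\<exists>r. y - r *\<^sub>R x \<in> ?T)"
      using span_breakdown_eq[of y x ?T] T(1) by (simp add: span_eq_iff[THEN iffD2])
    also have "\<dots> \<longleftrightarrow> (\<exists>r. \<exists>t\<in>?T. y = r *\<^sub>R x + t)" 
      by (intro iff_exI) (auto intro: bexI[of _ "y - _ *\<^sub>R x"])
    finally show ?thesis .
  qed
  have lproj: "?l \<in> proj UNIV" using x0 by (simp add: proj_def dim_insert)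
  have coset_l: "coset ?l (r *\<^sub>R x + t) = coset ?l t" for r t
    by (simp add: coset_eq_iff span_mul span_base)
  have eq: "proj_tangent_space X ?l = car (vHom (vsub ?l) (vquot ?Y ?l))"
  proof (intro equalityI subsetI)
    fix h assume "h \<in> proj_tangent_space X ?l"
    then obtain c v e where h: "h \<in> car (vHom (vsub ?l) (vquot UNIV ?l))"
      and c: "(e::real) > 0" "\<And>t. t \<in> {-e<..<e} \<Longrightarrow> c t \<noteq> 0 \<and> span {c t} \<in> X" "span {c 0} = ?l"
        "(c has_vector_derivative v) (at 0)" "h (c 0) = coset ?l v"
      unfolding proj_tangent_space_def by blast
    have "c 0 \<in> ?l" using c(3) span_base[of "c 0" "{c 0}"] by simp
    then obtain r where r: "c 0 = r *\<^sub>R x" by (auto simp: span_singleton)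
    have r0: "r \<noteq> 0" using c(1) c(2)[of 0] r by auto
    have ac0: "a (c 0) = r" using r x1 a.scale by simp
    let ?c = "\<lambda>t. (1 / a (c t)) *\<^sub>R c t"
    have "((\<lambda>t. a (c t)) has_vector_derivative a v) (at 0)"
      by (rule has_vector_derivative_compose[OF c(4) bounded_linear_imp_has_derivative[OF a]])
    then have da: "((\<lambda>t. a (c t)) has_real_derivative a v) (at 0)"
      by (simp add: has_real_derivative_iff_has_vector_derivative)
    have "((\<lambda>t. 1 / a (c t)) has_real_derivative - (a v / r\<^sup>2)) (at 0)"
      by (rule derivative_eq_intros da refl | use ac0 r0 in \<open>simp add: power2_eq_square\<close>)+
    then have dc: "(?c has_vector_derivative (1 / r) *\<^sub>R v + (- (a v / r\<^sup>2)) *\<^sub>R c 0) (at 0)"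
      using has_vector_derivative_scaleR[OF _ c(4), of "\<lambda>t. 1 / a (c t)" "- (a v / r\<^sup>2)"] ac0 by simp
    have "((\<lambda>t. a (c t)) \<longlongrightarrow> r) (at 0)"
      using has_vector_derivative_continuous[OF \<open>((\<lambda>t. a (c t)) has_vector_derivative a v) (at 0)\<close>] ac0
      by (simp add: continuous_at isCont_def)
    then have "\<forall>\<^sub>F t in at 0. a (c t) \<noteq> 0" using r0 by (rule tendsto_imp_eventually_ne)
    moreover have "\<forall>\<^sub>F t in at (0::real). t \<in> {-e<..<e}"
      using c(1) by (intro eventually_at_in_open') auto
    ultimately have "\<forall>\<^sub>F t in at 0. ?c t \<in> ?M"
    proof eventually_elim
      case (elim t)
      have "span {?c t} = span {c t}" using elim(1) by (intro span_singleton_scaleR) simp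
      then show ?case using elim c(2)[of t] a.scale by (simp add: affine_chart_image_def)
    qed
    moreover have "?c 0 = x" using r r0 x1 a.scale by simp
    ultimately have mem: "(1 / r) *\<^sub>R v + (- (a v / r\<^sup>2)) *\<^sub>R c 0 \<in> ?T" using curve[OF dc] by blast
    have "v = a v *\<^sub>R x + r *\<^sub>R ((1 / r) *\<^sub>R v + (- (a v / r\<^sup>2)) *\<^sub>R c 0)"
      using r0 r by (simp add: algebra_simps power2_eq_square)
    then have vY: "v \<in> ?Y" using subspace_scale[OF T(1) mem, of r] unfolding Y by blast
    have "h u \<in> coset ?l ` ?Y" if u: "u \<in> ?l" for u
    proof -
      obtain s where "u = s *\<^sub>R c 0" using u c(3) by (metis imageE span_singleton)
      moreover have "h (s *\<^sub>R c 0) = vscale (vquot UNIV ?l) s (h (c 0))"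
        using h \<open>c 0 \<in> ?l\<close> by (auto simp: vHom_def vlinear_def vsub_def)
      moreover have "\<dots> = coset ?l (s *\<^sub>R v)"
        using coset_scale[of ?l s v] c(5) by (simp add: vquot_def)
      ultimately show ?thesis using vY by (simp add: span_mul)
    qed
    then show "h \<in> car (vHom (vsub ?l) (vquot ?Y ?l))" by (intro vHom_vquotI[OF h]) blast
  next
    fix h assume h: "h \<in> car (vHom (vsub ?l) (vquot ?Y ?l))"
    then have "h \<in> ?l \<rightarrow> coset ?l ` ?Y"
      by (simp add: vHom_def vlinear_def vsub_def vquot_def)
    then have hY: "h u \<in> coset ?l ` ?Y" if "u \<in> ?l" for u
      using that by (rule funcset_mem)
    have h': "h \<in> car (vHom (vsub ?l) (vquot UNIV ?l))"
      by (rule vHom_vquotI[OF h]) (use hY in blast)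
    have "h x \<in> coset ?l ` ?Y" by (rule hY) (simp add: span_base)
    then obtain t where t: "t \<in> ?T" "h x = coset ?l t" using Y coset_l by auto
    obtain c e where c: "(e::real) > 0" "smooth_on {-e<..<e} c" "\<And>s. s \<in> {-e<..<e} \<Longrightarrow> c s \<in> ?M" "c 0 = x"
        "(c has_vector_derivative t) (at 0)"
      by (rule tangent_spaceE[OF t(1)], rule that)
    have "c s \<noteq> 0 \<and> span {c s} \<in> X" if "s \<in> {-e<..<e}" for s
      using c(3)[OF that] a.zero by (auto simp: affine_chart_image_def)
    then show "h \<in> proj_tangent_space X ?l"
      unfolding proj_tangent_space_def using h' c t(2) by blast
  qed
  have lY: "?l \<subseteq> ?Y" by (rule span_mono) simp
  show YY: "Y_fibre X ?l = ?Y"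
    unfolding Y_fibre_def
    using eq lY vHom_vquot_determines[OF lproj] by (intro the_equality) (auto simp: subspace_span)
  have "x \<notin> ?T" using affine_chart_image_tangent_annihilated[OF a] x1 by force
  then show "dim (Y_fibre X ?l) = m + 1"
    unfolding YY dim_span using T by (simp add: dim_insert span_eq_iff[THEN iffD2])
  show "y \<in> Y_fibre X ?l \<longleftrightarrow> (\<exists>r. \<exists>t\<in>?T. y = r *\<^sub>R x + t)" unfolding YY by (rule Y)
qed

section \<open>Euclidean coordinates on the space of linear maps\<close>

text \<open>The operator norm is not Euclidean, and the type of linear maps is therefore not a Euclidean space.
  The inverse function theorem is transported to it along these coordinates.\<close>

definition matrix_of_blinfun :: "('v::euclidean_space \<Rightarrow>\<^sub>L 'w::euclidean_space) \<Rightarrow> 'w ^ 'v basis_index" where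
  "matrix_of_blinfun f = (\<chi> i. f (Rep_basis_index i))"

definition blinfun_of_columns :: "'w ^ 'v basis_index \<Rightarrow> ('v::euclidean_space \<Rightarrow>\<^sub>L 'w::euclidean_space)" where
  "blinfun_of_columns x = (\<Sum>i\<in>UNIV. rank_one (blinfun_inner_left (Rep_basis_index i)) (x $ i))"

lemma matrix_of_blinfun_of_columns [simp]: "matrix_of_blinfun (blinfun_of_columns x) = x"
  by (simp add: matrix_of_blinfun_def blinfun_of_columns_def vec_eq_iff blinfun.sum_left
      inner_Rep_basis_index if_distrib[of "\<lambda>c. c *\<^sub>R _"] cong: if_cong)

lemma blinfun_of_columns_of_blinfun [simp]: "blinfun_of_columns (matrix_of_blinfun f) = f"
proof (rule blinfun_eqI)
  fix v
  have "f (\<Sum>b\<in>Basis. (v \<bullet> b) *\<^sub>R b) = (\<Sum>b\<in>Basis. (v \<bullet> b) *\<^sub>R f b)"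
    by (simp add: blinfun.sum_right blinfun.scaleR_right)
  then have "f v = (\<Sum>b\<in>Basis. (v \<bullet> b) *\<^sub>R f b)"
    unfolding euclidean_representation .
  then show "blinfun_of_columns (matrix_of_blinfun f) v = f v"
    by (simp add: matrix_of_blinfun_def blinfun_of_columns_def blinfun.sum_left
        sum_basis_index[of "\<lambda>b. (v \<bullet> b) *\<^sub>R f b"])
qed

lemma linear_blinfun_of_columns: "linear blinfun_of_columns"
  by (rule linearI) (simp_all add: blinfun_of_columns_def sum.distrib scaleR_sum_right
      linear_add[OF bounded_linear.linear[OF bounded_linear_rank_one]]
      linear_scale[OF bounded_linear.linear[OF bounded_linear_rank_one]])

lemma bounded_linear_matrix_of_blinfun:
  "bounded_linear (matrix_of_blinfun :: ('v::euclidean_space \<Rightarrow>\<^sub>L 'w::euclidean_space) \<Rightarrow> _)"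
proof (rule bounded_linear_intro)
  fix f g :: "'v \<Rightarrow>\<^sub>L 'w" and r :: real
  show "matrix_of_blinfun (f + g) = matrix_of_blinfun f + matrix_of_blinfun g"
    "matrix_of_blinfun (r *\<^sub>R f) = r *\<^sub>R matrix_of_blinfun f"
    by (simp_all add: matrix_of_blinfun_def vec_eq_iff blinfun.add_left blinfun.scaleR_left)
  have "norm (matrix_of_blinfun f) \<le> (\<Sum>i\<in>UNIV. norm (f (Rep_basis_index (i :: 'v basis_index))))"
    unfolding norm_vec_def matrix_of_blinfun_def by (rule order_trans[OF L2_set_le_sum]) simp_all
  also have "\<dots> \<le> (\<Sum>i\<in>(UNIV :: 'v basis_index set). norm f)"
  proof (rule sum_mono)
    fix i :: "'v basis_index"
    show "norm (f (Rep_basis_index i)) \<le> norm f"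
      using norm_blinfun[of f "Rep_basis_index i"] norm_Basis[OF Rep_basis_index[of i]] by simp
  qed
  finally show "norm (matrix_of_blinfun f) \<le> norm f * real CARD('v basis_index)"
    by (simp add: mult.commute)
qed

theorem smooth_inverse_function_theorem_blinfun:
  fixes f :: "('v::euclidean_space \<Rightarrow>\<^sub>L 'w::euclidean_space) \<Rightarrow> ('v \<Rightarrow>\<^sub>L 'w)"
  assumes U: "open U" "x0 \<in> U" and f: "\<And>k. Ck_on k U f" and id: "(f has_derivative id) (at x0)"
  obtains U' V g where "open U'" "U' \<subseteq> U" "x0 \<in> U'" "open V" "homeomorphism U' V f g" "\<And>k. Ck_on k V g"
proof -
  let ?\<iota> = "blinfun_of_columns :: 'w ^ 'v basis_index \<Rightarrow> ('v \<Rightarrow>\<^sub>L 'w)"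
  let ?\<kappa> = "matrix_of_blinfun :: ('v \<Rightarrow>\<^sub>L 'w) \<Rightarrow> 'w ^ 'v basis_index"
  have \<kappa>: "bounded_linear ?\<kappa>" by (rule bounded_linear_matrix_of_blinfun)
  have \<iota>: "bounded_linear ?\<iota>" using linear_blinfun_of_columns linear_conv_bounded_linear by blast
  have cont: "continuous_on S ?\<iota>" "continuous_on S' ?\<kappa>" for S S'
    using \<iota> \<kappa> by (auto intro: linear_continuous_on)
  have open_\<iota>: "open (?\<iota> -` S)" if "open S" for S
    using that cont by (intro open_vimage)
  have open_\<kappa>: "open (?\<kappa> -` S)" if "open S" for S
    using that cont by (intro open_vimage)
  define h where "h x = ?\<kappa> (f (?\<iota> x))" for x
  have "Ck_on k (?\<iota> -` U) h" for k
    unfolding h_def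
    using Ck_on_linear_compose[OF \<kappa> open_\<iota>[OF U(1)] Ck_on_affine_compose[OF \<iota> open_\<iota>[OF U(1)] _ f, where c = 0]]
    by simp
  moreover have "(h has_derivative id) (at (?\<kappa> x0))"
  proof -
    have "((\<lambda>x. f (?\<iota> x)) has_derivative (\<lambda>x. id (?\<iota> x))) (at (?\<kappa> x0))"
      by (rule has_derivative_compose[OF bounded_linear_imp_has_derivative[OF \<iota>]]) (use id in \<open>simp add: id_def\<close>)
    from bounded_linear.has_derivative[OF \<kappa> this] show ?thesis
      unfolding h_def by (rule has_derivative_eq_rhs) (simp add: fun_eq_iff)
  qed
  moreover have "?\<kappa> x0 \<in> ?\<iota> -` U" using U(2) by simp
  ultimately obtain U' V g where g: "open U'" "U' \<subseteq> ?\<iota> -` U" "?\<kappa> x0 \<in> U'" "open V" "homeomorphism U' V h g"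
      "\<And>k. Ck_on k V g"
    using smooth_inverse_function_theorem[OF open_\<iota>[OF U(1)], of "?\<kappa> x0" h] by blast
  show ?thesis
  proof (rule that)
    show "open (?\<kappa> -` U')" "open (?\<kappa> -` V)" using g open_\<kappa> by blast+
    show "?\<kappa> -` U' \<subseteq> U" using g(2) by (metis blinfun_of_columns_of_blinfun subsetD subsetI vimage_eq)
    then have fU: "continuous_on (?\<kappa> -` U') f"
      using f[of 0] by (auto intro: continuous_on_subset)
    show "x0 \<in> ?\<kappa> -` U'" using g(3) by simp
    have Ck: "Ck_on k (?\<kappa> -` V) (\<lambda>y. ?\<iota> (g (?\<kappa> y)))" for k
      using Ck_on_linear_compose[OF \<iota> open_\<kappa>[OF g(4)] Ck_on_affine_compose[OF \<kappa> open_\<kappa>[OF g(4)] _ g(6), where c = 0]]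
      by simp
    then show "Ck_on k (?\<kappa> -` V) (\<lambda>y. ?\<iota> (g (?\<kappa> y)))" for k .
    have h: "g (h x) = x" "h x \<in> V" if "x \<in> U'" for x using g(5) that by (auto simp: homeomorphism_def)
    have h': "h (g y) = y" "g y \<in> U'" if "y \<in> V" for y using g(5) that by (auto simp: homeomorphism_def)
    have fh: "?\<kappa> (f q) = h (?\<kappa> q)" for q by (simp add: h_def)
    have hf: "f (?\<iota> x) = ?\<iota> (h x)" for x by (simp add: h_def)
    show "homeomorphism (?\<kappa> -` U') (?\<kappa> -` V) f (\<lambda>y. ?\<iota> (g (?\<kappa> y)))"
      by (rule homeomorphismI) (use fU Ck[of 0] h h' in \<open>auto simp: fh hf\<close>)
  qed
qed

lemma hyperplane_codimension_1:
  fixes v0 :: "'v::euclidean_space" and w0 :: "'w::euclidean_space"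
  assumes "v0 \<noteq> 0" "w0 \<noteq> 0"
  shows "Suc (dim {q :: 'v \<Rightarrow>\<^sub>L 'w. q v0 \<bullet> w0 = 0}) = dim (UNIV :: ('v \<Rightarrow>\<^sub>L 'w) set)"
proof -
  let ?\<iota> = "blinfun_of_columns :: 'w ^ 'v basis_index \<Rightarrow> ('v \<Rightarrow>\<^sub>L 'w)"
  define n where "n = (\<chi> i. (v0 \<bullet> Rep_basis_index i) *\<^sub>R w0 :: 'w ^ 'v basis_index)"
  have eval: "?\<iota> x v0 \<bullet> w0 = n \<bullet> x" for x
    by (simp add: blinfun_of_columns_def n_def blinfun.sum_left inner_sum_right inner_vec_def inner_commute)
  have "n \<noteq> 0"
  proof
    assume "n = 0"
    then have "v0 \<bullet> Rep_basis_index i = 0" for i :: "'v basis_index"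
      using assms(2) by (simp add: n_def vec_eq_iff)
    then have "v0 \<bullet> b = 0" if "b \<in> Basis" for b
      using that by (metis Rep_basis_index_cases)
    then show False using assms(1) euclidean_all_zero_iff by blast
  qed
  have dim_\<iota>: "dim (?\<iota> ` S) = dim S" for S
    by (rule dim_image_eq[OF linear_blinfun_of_columns])
      (metis inj_on_inverseI matrix_of_blinfun_of_columns)
  have "dim {q :: 'v \<Rightarrow>\<^sub>L 'w. q v0 \<bullet> w0 = 0} = dim (?\<iota> ` {x. n \<bullet> x = 0})"
  proof (rule arg_cong[where f = dim], intro equalityI subsetI)
    fix q :: "'v \<Rightarrow>\<^sub>L 'w" assume "q \<in> {q :: 'v \<Rightarrow>\<^sub>L 'w. q v0 \<bullet> w0 = 0}"
    then show "q \<in> ?\<iota> ` {x. n \<bullet> x = 0}"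
      using eval[of "matrix_of_blinfun q"] by (intro image_eqI[of _ _ "matrix_of_blinfun q"]) auto
  qed (auto simp: eval)
  also have "\<dots> = DIM('w ^ 'v basis_index) - 1"
    unfolding dim_\<iota> by (rule dim_hyperplane[OF \<open>n \<noteq> 0\<close>])
  finally have 1: "dim {q :: 'v \<Rightarrow>\<^sub>L 'w. q v0 \<bullet> w0 = 0} = DIM('w ^ 'v basis_index) - 1" .
  have "?\<iota> ` UNIV = UNIV" by (metis blinfun_of_columns_of_blinfun surjI)
  then have "dim (UNIV :: ('v \<Rightarrow>\<^sub>L 'w) set) = DIM('w ^ 'v basis_index)"
    using dim_\<iota>[of UNIV] by (simp only: dim_UNIV)
  then show ?thesis using 1 DIM_positive[where 'a = "'w ^ 'v basis_index"] by simp
qed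

section \<open>The wall near a regular point\<close>

text \<open>The secant \<open>c h - c 0\<close> is \<open>h v\<close> up to an error that is small compared with \<open>h\<close>, so the bound passes
  to \<open>v\<close> after division by \<open>h\<close>.\<close>

lemma has_vector_derivative_norm_lower_bound:
  fixes f :: "'a::real_normed_vector \<Rightarrow>\<^sub>L 'b::real_normed_vector"
  assumes c: "(c has_vector_derivative v) (at 0)" and k: "k > 0"
    and bound: "\<forall>\<^sub>F h in at 0. k * norm (c h - c 0) \<le> norm (f (c h - c 0))"
  shows "k * norm v \<le> norm (f v)"
proof (rule field_le_epsilon)
  fix e :: real assume e: "e > 0"
  define d where "d = e / (norm f + k)"
  have n: "norm f + k > 0" using k by (simp add: add_nonneg_pos)
  then have d: "d > 0" "(norm f + k) * d = e" using e by (simp_all add: d_def)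
  have "\<forall>\<^sub>F h in at (0::real). norm (c h - c 0 - (h - 0) *\<^sub>R v) \<le> d * norm (h - 0)"
    using c d(1) unfolding has_vector_derivative_def has_derivative_within_alt2 by blast
  moreover have "\<forall>\<^sub>F h in at (0::real). h \<noteq> 0" by (rule eventually_neq_at_within)
  ultimately have "\<forall>\<^sub>F h in at (0::real). k * norm v \<le> norm (f v) + e"
    using bound
  proof eventually_elim
    case (elim h)
    let ?r = "c h - c 0 - h *\<^sub>R v"
    have r: "norm ?r \<le> d * \<bar>h\<bar>" using elim(1) by simp
    have "\<bar>h\<bar> * norm v \<le> norm (c h - c 0) + norm ?r"
      using norm_triangle_ineq4[of "c h - c 0" ?r] by simp
    then have 1: "k * (\<bar>h\<bar> * norm v) \<le> k * norm (c h - c 0) + k * (d * \<bar>h\<bar>)"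
      using mult_left_mono[of "\<bar>h\<bar> * norm v" "norm (c h - c 0) + d * \<bar>h\<bar>" k] r k by (simp add: distrib_left)
    have "f (c h - c 0) = h *\<^sub>R f v + f ?r"
      by (simp add: blinfun.diff_right blinfun.scaleR_right)
    then have "norm (f (c h - c 0)) \<le> \<bar>h\<bar> * norm (f v) + norm (f ?r)"
      using norm_triangle_ineq[of "h *\<^sub>R f v" "f ?r"] by simp
    moreover have "norm (f ?r) \<le> norm f * (d * \<bar>h\<bar>)"
      by (rule order_trans[OF norm_blinfun mult_left_mono[OF r]]) simp
    ultimately have "k * (\<bar>h\<bar> * norm v) \<le> \<bar>h\<bar> * norm (f v) + (norm f + k) * d * \<bar>h\<bar>"
      using 1 elim(3) by (simp add: algebra_simps)
    then have "\<bar>h\<bar> * (k * norm v) \<le> \<bar>h\<bar> * (norm (f v) + e)"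
      unfolding d(2) by (simp add: algebra_simps)
    then show ?case using elim(2) by simp
  qed
  then show "k * norm v \<le> norm (f v) + e" by simp
qed

text \<open>A right inverse of \<open>f0\<close> stays injective after composition with a map close to \<open>f0\<close>.\<close>

lemma surj_blinfun_stable:
  fixes f0 :: "'v::euclidean_space \<Rightarrow>\<^sub>L 'w::euclidean_space"
  assumes "surj (blinfun_apply f0)"
  obtains r where "r > 0" "\<And>f. norm (f - f0) < r \<Longrightarrow> surj (blinfun_apply f)"
proof -
  have "linear (blinfun_apply f0)" by (rule bounded_linear.linear[OF blinfun.bounded_linear_right])
  then obtain g where g: "linear g" "blinfun_apply f0 \<circ> g = id"
    using linear_surjective_right_inverse[OF _ assms] by blast
  define R where "R = Blinfun g"
  have "bounded_linear g" using g(1) linear_conv_bounded_linear by blast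
  then have R: "f0 (R w) = w" for w
    using g(2) by (simp add: R_def bounded_linear_Blinfun_apply fun_eq_iff)
  have n: "norm R + 1 > 0" by (simp add: add_nonneg_pos)
  show ?thesis
  proof (rule that[of "1 / (norm R + 1)"])
    show "1 / (norm R + 1) > 0" using n by simp
    fix f assume f: "norm (f - f0) < 1 / (norm R + 1)"
    have "w = 0" if "f (R w) = 0" for w
    proof (rule ccontr)
      assume w: "w \<noteq> 0"
      have "norm w = norm ((f - f0) (R w))" using that R by (simp add: blinfun.diff_left)
      also have "\<dots> \<le> norm (f - f0) * norm (R w)" by (rule norm_blinfun)
      also have "\<dots> \<le> norm (f - f0) * (norm R * norm w)"
        by (intro mult_left_mono norm_blinfun) simp
      also have "\<dots> \<le> norm (f - f0) * ((norm R + 1) * norm w)"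
        by (intro mult_left_mono mult_right_mono) simp_all
      also have "\<dots> < 1 / (norm R + 1) * ((norm R + 1) * norm w)"
        using f n w by (intro mult_strict_right_mono) simp_all
      also have "\<dots> = norm w" using n by simp
      finally show False by simp
    qed
    moreover have lin: "linear (\<lambda>w. f (R w))"
      by (intro bounded_linear.linear bounded_linear_compose[OF blinfun.bounded_linear_right blinfun.bounded_linear_right])
    ultimately have "inj (\<lambda>w. f (R w))" using linear_injective_0 by blast
    then have "surj (\<lambda>w. f (R w))" using lin linear_injective_imp_surjective by blast
    then show "surj (blinfun_apply f)" by (metis surjI surj_f_inv_f)
  qed
qed

lemma span_singleton_in_proj_ker:
  assumes "v \<noteq> 0" "blinfun_apply f v = 0"
  shows "span {v} \<in> proj (ker f)"
proof -
  have "span {v} \<subseteq> ker f"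
    using assms(2) by (auto simp: ker_def span_singleton blinfun.scaleR_right)
  then show ?thesis using assms(1) by (simp add: proj_def dim_insert)
qed

text \<open>The vector \<open>z0\<close> spans the line \<open>\<xi>0\<close>; it is a parameter because it fixes an affine chart.\<close>

locale regular_wall_point =
  fixes X :: "'v::euclidean_space set set" and m :: nat
    and f0 :: "'v \<Rightarrow>\<^sub>L 'w::euclidean_space" and z0 :: 'v
  assumes dim_W: "DIM('w) = m + 1"
    and submanifold: "proj_submanifold m X"
    and compact: "compactin proj_topology X"
    and surj_f0: "surj (blinfun_apply f0)"
    and z0: "z0 \<noteq> 0"
    and kernel_point: "X \<inter> proj (ker f0) = {span {z0}}"
    and transversal: "ker f0 \<inter> Y_fibre X (span {z0}) = span {z0}"
begin

text \<open>The functional of an affine chart around \<open>\<xi>0\<close>; any functional with value 1 at \<open>z0\<close> would serve.\<close>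

definition a :: "'v \<Rightarrow>\<^sub>L real" where
  "a = (1 / (z0 \<bullet> z0)) *\<^sub>R blinfun_inner_left z0"

abbreviation M :: "'v set" where "M \<equiv> affine_chart_image X (blinfun_apply a)"

abbreviation T :: "'v set" where "T \<equiv> tangent_space M z0"

lemma a_z0: "a z0 = 1"
  using z0 by (simp add: a_def blinfun.scaleR_left)

lemma M_iff: "x \<in> M \<longleftrightarrow> a x = 1 \<and> span {x} \<in> X"
  by (simp add: affine_chart_image_def)

lemma M_nonzero: "x \<in> M \<Longrightarrow> x \<noteq> 0"
  by (auto simp: M_iff blinfun.zero_right)

lemma z0_M: "z0 \<in> M"
  using kernel_point a_z0 by (auto simp: M_iff)

lemma f0_z0: "f0 z0 = 0"
  using kernel_point span_base[of z0 "{z0}"] by (auto simp: proj_def ker_def)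

lemma submanifold_M: "x \<in> M \<Longrightarrow> submanifold_at m M x"
  using submanifold blinfun.bounded_linear_right[of a]
  unfolding proj_submanifold_def submanifold_def by (auto dest: bounded_linear.linear)

lemma Y_fibre_M:
  assumes "x \<in> M"
  shows "dim (Y_fibre X (span {x})) = m + 1"
    and "y \<in> Y_fibre X (span {x}) \<longleftrightarrow> (\<exists>r. \<exists>t\<in>tangent_space M x. y = r *\<^sub>R x + t)"
    and "subspace (Y_fibre X (span {x}))"
  using Y_fibre_eq[OF blinfun.bounded_linear_right assms submanifold_M[OF assms]] by (auto simp: subspace_span)

lemma subspace_T: "subspace T" and dim_T: "dim T = m"
  using submanifold_at_tangent_chart[OF submanifold_M[OF z0_M]] by metis+

lemma a_T: "t \<in> T \<Longrightarrow> a t = 0"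
  by (rule affine_chart_image_tangent_annihilated[OF blinfun.bounded_linear_right])

lemma f0_T_injective:
  assumes "t \<in> T" "f0 t = 0"
  shows "t = 0"
proof -
  have "t \<in> Y_fibre X (span {z0})"
    using assms(1) unfolding Y_fibre_M(2)[OF z0_M] by (intro exI[of _ 0] bexI[of _ t]) auto
  then have "t \<in> span {z0}" using assms(2) transversal by (auto simp: ker_def)
  then obtain r where r: "t = r *\<^sub>R z0" by (auto simp: span_singleton)
  then have "r = 0" using a_T[OF assms(1)] a_z0 by (simp add: blinfun.scaleR_right)
  then show ?thesis using r by simp
qed

lemma inj_on_f0_T: "inj_on (blinfun_apply f0) T"
proof (rule inj_onI)
  fix x y assume xy: "x \<in> T" "y \<in> T" "f0 x = f0 y"
  then have "x - y = 0"
    by (intro f0_T_injective) (auto simp: subspace_diff[OF subspace_T] blinfun.diff_right)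
  then show "x = y" by simp
qed

lemma linear_f0: "linear (blinfun_apply f0)"
  by (rule bounded_linear.linear[OF blinfun.bounded_linear_right])

definition w0 :: 'w where
  "w0 = (SOME w. norm w = 1 \<and> (\<forall>h. h \<in> f0 ` T \<longleftrightarrow> h \<bullet> w = 0))"

text \<open>The map \<open>f0\<close> is injective on \<open>T\<close>, so \<open>f0 ` T\<close> has dimension \<open>m\<close> and is a hyperplane of \<open>W\<close>.\<close>

lemma w0: "norm w0 = 1" "h \<in> f0 ` T \<longleftrightarrow> h \<bullet> w0 = 0"
proof -
  let ?H = "f0 ` T"
  have H: "subspace ?H" by (rule linear_subspace_image[OF linear_f0 subspace_T])
  have dimH: "dim ?H = m"
    using dim_image_eq[OF linear_f0, of T] inj_on_f0_T subspace_T dim_T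
    by (simp add: span_eq_iff[THEN iffD2])
  then obtain w where w: "w \<noteq> 0" "\<And>h. h \<in> span ?H \<Longrightarrow> orthogonal w h"
    using orthogonal_to_subspace_exists[of ?H] dim_W by auto
  let ?w = "w /\<^sub>R norm w"
  have "?H = {h. ?w \<bullet> h = 0}"
  proof (rule subspace_dim_equal[OF H subspace_hyperplane])
    show "?H \<subseteq> {h. ?w \<bullet> h = 0}" using w(2) by (auto simp: orthogonal_def intro: span_base)
    show "dim ?H \<ge> dim {h. ?w \<bullet> h = 0}"
      using dim_hyperplane[of ?w] w(1) dimH dim_W by simp
  qed
  then have "norm ?w = 1 \<and> (\<forall>h. h \<in> ?H \<longleftrightarrow> h \<bullet> ?w = 0)" using w(1) by (simp add: inner_commute)
  then have "norm w0 = 1 \<and> (\<forall>h. h \<in> ?H \<longleftrightarrow> h \<bullet> w0 = 0)" unfolding w0_def by (rule someI)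
  then show "norm w0 = 1" "h \<in> f0 ` T \<longleftrightarrow> h \<bullet> w0 = 0" by blast+
qed

lemma w0_nonzero: "w0 \<noteq> 0" using w0(1) by auto

text \<open>On \<open>T\<close> the map \<open>f0\<close> is bounded below, and adding a multiple of the normal vector \<open>w0\<close> can only
  increase the norm of its values. Secants of \<open>M\<close> near \<open>z0\<close> are almost in \<open>T\<close>, so the bound survives for
  them and for maps close to \<open>f0\<close>. With \<open>s = 0\<close> it says that the kernel of such a map contains at most
  one point of \<open>M\<close> near \<open>z0\<close>.\<close>

lemma kernel_point_unique:
  obtains k r Q where "k > 0" "r > 0" "open Q" "z0 \<in> Q"
    "\<And>f x y s. norm (f - f0) < r \<Longrightarrow> x \<in> M \<inter> Q \<Longrightarrow> y \<in> M \<inter> Q \<Longrightarrow>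
       k * norm (x - y) \<le> norm (blinfun_apply f (x - y) + s *\<^sub>R w0)"
proof -
  obtain c where c: "c > 0" "\<And>t. t \<in> T \<Longrightarrow> c * norm t \<le> norm (f0 t)"
    using injective_imp_isometric[OF closed_subspace[OF subspace_T] subspace_T blinfun.bounded_linear_right, of f0]
      f0_T_injective by (auto simp: mult.commute)
  define e where "e = min (1/2) (c / (8 * (norm f0 + 1)))"
  have n1: "norm f0 + 1 > 0" by (simp add: add_nonneg_pos)
  have e: "e > 0" "e \<le> 1/2" "e \<le> c / (8 * (norm f0 + 1))"
    using c(1) n1 unfolding e_def by (simp, (intro min.cobounded1 min.cobounded2)+)
  have "norm f0 * e \<le> (norm f0 + 1) * (c / (8 * (norm f0 + 1)))" using e n1 by (intro mult_mono) auto
  also have "x * (c / (8 * x)) = c / 8" if "x > 0" for x using that by simp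
  from this[OF n1] have "(norm f0 + 1) * (c / (8 * (norm f0 + 1))) = c / 8" .
  finally have f0e: "norm f0 * e \<le> c / 8" .
  obtain Q where Q: "open Q" "z0 \<in> Q"
    "\<And>x y. x \<in> M \<inter> Q \<Longrightarrow> y \<in> M \<inter> Q \<Longrightarrow> \<exists>t\<in>T. norm (x - y - t) \<le> e * norm (x - y)"
    by (rule submanifold_at_secant[OF submanifold_M[OF z0_M] e(1)], rule that)
  show ?thesis
  proof (rule that[of "c / 4" "c / 8" Q])
    fix f x y s assume f: "norm (f - f0) < c / 8" and xy: "x \<in> M \<inter> Q" "y \<in> M \<inter> Q"
    let ?d = "x - y"
    obtain t where t: "t \<in> T" "norm (?d - t) \<le> e * norm ?d" using Q(3)[OF xy] by blast
    have "norm ?d \<le> norm t + norm (?d - t)" using norm_triangle_sub[of ?d t] by simp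
    moreover have "e * norm ?d \<le> 1/2 * norm ?d" using e(2) by (intro mult_right_mono) auto
    ultimately have "norm ?d \<le> 2 * norm t" using t(2) by linarith
    then have "c * norm ?d \<le> 2 * (c * norm t)" using mult_left_mono[of "norm ?d" "2 * norm t" c] c(1) by simp
    then have 1: "c / 2 * norm ?d \<le> norm (f0 t)" using c(2)[OF t(1)] by linarith
    have orth: "f0 t \<bullet> w0 = 0" using w0(2) t(1) by blast
    have "(norm (f0 t))\<^sup>2 \<le> (norm (f0 t + s *\<^sub>R w0))\<^sup>2"
      using orth by (simp add: power2_norm_eq_inner mult.assoc[symmetric] inner_add_left inner_add_right inner_commute[of w0 "f0 t"])
    then have 2: "norm (f0 t) \<le> norm (f0 t + s *\<^sub>R w0)" by (rule power2_le_imp_le) simp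
    have 3: "norm (f0 (?d - t)) \<le> c / 8 * norm ?d"
    proof -
      have "norm (f0 (?d - t)) \<le> norm f0 * (e * norm ?d)"
        by (rule order_trans[OF norm_blinfun mult_left_mono[OF t(2)]]) simp
      also have "\<dots> \<le> c / 8 * norm ?d" using mult_right_mono[OF f0e, of "norm ?d"] by (simp add: mult.assoc)
      finally show ?thesis .
    qed
    have 4: "norm ((f - f0) ?d) \<le> c / 8 * norm ?d"
      by (rule order_trans[OF norm_blinfun mult_right_mono]) (use f in auto)
    have eq: "f0 t + s *\<^sub>R w0 = (f ?d + s *\<^sub>R w0) - (f0 (?d - t) + (f - f0) ?d)"
      by (simp add: blinfun.diff_left blinfun.diff_right)
    have "norm (f0 t + s *\<^sub>R w0) \<le> norm (f ?d + s *\<^sub>R w0) + norm (f0 (?d - t) + (f - f0) ?d)"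
      unfolding eq by (rule norm_triangle_ineq4)
    moreover have "norm (f0 (?d - t) + (f - f0) ?d) \<le> c / 8 * norm ?d + c / 8 * norm ?d"
      using norm_triangle_ineq[of "f0 (?d - t)" "(f - f0) ?d"] 3 4 by linarith
    ultimately show "c / 4 * norm ?d \<le> norm (f ?d + s *\<^sub>R w0)"
      using 1 2 by (simp add: field_simps)
  qed (use c(1) Q in auto)
qed

text \<open>The lines in \<open>X\<close> away from \<open>\<xi>0\<close> are not killed by \<open>f0\<close>. The open sets \<open>OC c\<close>, on which \<open>f0\<close> is bounded
  below by \<open>c\<close>, cover them, and by compactness one constant suffices; maps closer to \<open>f0\<close> than this
  constant do not kill these lines either.\<close>

lemma kernel_point_close:
  assumes Q: "open Q" "z0 \<in> Q"
  obtains r where "r > 0"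
    "\<And>f l. norm (f - f0) < r \<Longrightarrow> l \<in> X \<inter> proj (ker f) \<Longrightarrow> \<exists>x\<in>M \<inter> Q. l = span {x}"
proof -
  define OQ where "OQ = {l \<in> proj UNIV. \<exists>x\<in>Q. a x = 1 \<and> l = span {x}}"
  define OC where "OC c = {l \<in> proj UNIV. \<forall>u\<in>l. u \<noteq> 0 \<longrightarrow> c * norm u < norm (f0 u)}" for c :: real
  have line: "span {v} \<in> proj UNIV" if "v \<noteq> 0" for v :: 'v
    using that by (simp add: proj_def dim_insert)
  have span_eq: "span {(1 / a v) *\<^sub>R v} = span {v}" if "a v \<noteq> 0" for v
    using that by (intro span_singleton_scaleR) simp
  have "{v. v \<noteq> 0 \<and> span {v} \<in> OQ} = {v. a v \<noteq> 0} \<inter> (\<lambda>v. (1 / a v) *\<^sub>R v) -` Q"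
  proof (intro equalityI subsetI)
    fix v assume v: "v \<in> {v. v \<noteq> 0 \<and> span {v} \<in> OQ}"
    then obtain x where x: "x \<in> Q" "a x = 1" "span {v} = span {x}" by (auto simp: OQ_def)
    have "v \<in> span {x}" using x(3) span_base[of v "{v}"] by simp
    then obtain r where r: "v = r *\<^sub>R x" by (auto simp: span_singleton)
    then show "v \<in> {v. a v \<noteq> 0} \<inter> (\<lambda>v. (1 / a v) *\<^sub>R v) -` Q"
      using v x by (auto simp: blinfun.scaleR_right)
  next
    fix v assume v: "v \<in> {v. a v \<noteq> 0} \<inter> (\<lambda>v. (1 / a v) *\<^sub>R v) -` Q"
    then have "v \<noteq> 0" by (auto simp: blinfun.zero_right)
    then show "v \<in> {v. v \<noteq> 0 \<and> span {v} \<in> OQ}"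
      using v line span_eq[of v] unfolding OQ_def
      by (auto simp: blinfun.scaleR_right intro!: bexI[of _ "(1 / a v) *\<^sub>R v"])
  qed
  moreover have "open ({v. a v \<noteq> 0} \<inter> (\<lambda>v. (1 / a v) *\<^sub>R v) -` Q)"
    by (intro continuous_open_preimage continuous_intros open_Collect_neq Q(1)) auto
  ultimately have openQ: "openin proj_topology OQ"
    by (auto simp: openin_proj_topology OQ_def)
  have openC: "openin proj_topology (OC c)" for c
  proof -
    have "{v. v \<noteq> 0 \<and> span {v} \<in> OC c} = {v. v \<noteq> 0} \<inter> {v. c * norm v < norm (f0 v)}"
    proof (intro equalityI subsetI)
      fix v assume "v \<in> {v. v \<noteq> 0} \<inter> {v. c * norm v < norm (f0 v)}"
      then show "v \<in> {v. v \<noteq> 0 \<and> span {v} \<in> OC c}"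
        using line[of v] by (auto simp: OC_def span_singleton blinfun.scaleR_right mult.left_commute)
    qed (auto simp: OC_def intro: span_base)
    moreover have "open ({v. v \<noteq> 0} \<inter> {v. c * norm v < norm (f0 v)})"
      by (intro open_Int open_Collect_neq open_Collect_less continuous_intros)
    ultimately show ?thesis by (auto simp: openin_proj_topology OC_def)
  qed
  have "X \<subseteq> \<Union> (insert OQ (OC ` {0<..}))"
  proof
    fix l assume l: "l \<in> X"
    then have lp: "l \<in> proj UNIV" using submanifold by (auto simp: proj_submanifold_def)
    then have sl: "subspace l" "dim l = 1" by (auto simp: proj_def)
    then obtain v where v: "v \<in> l" "v \<noteq> 0"
      by (metis dim_eq_0 subsetI singletonI zero_neq_one)
    have lv: "l = span {v}"
      using v sl by (intro subspace_dim_equal[symmetric] span_minimal) (auto simp: subspace_span dim_insert)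
    show "l \<in> \<Union> (insert OQ (OC ` {0<..}))"
    proof (cases "f0 v = 0")
      case True
      then have "l \<in> X \<inter> proj (ker f0)"
        using l lp lv by (auto simp: proj_def ker_def span_singleton blinfun.scaleR_right)
      then have "l = span {z0}" using kernel_point by simp
      then show ?thesis using Q a_z0 lp by (auto simp: OQ_def)
    next
      case False
      define c where "c = norm (f0 v) / (2 * norm v)"
      have c: "c > 0" "c * norm v < norm (f0 v)" using False v(2) by (auto simp: c_def)
      then have "l \<in> OC c"
        using lp unfolding OC_def lv by (auto simp: span_singleton blinfun.scaleR_right mult.left_commute)
      then show ?thesis using c(1) by blast
    qed
  qed
  moreover have "\<forall>U\<in>insert OQ (OC ` {0<..}). openin proj_topology U" using openQ openC by blast
  ultimately have "\<exists>F. finite F \<and> F \<subseteq> insert OQ (OC ` {0<..}) \<and> X \<subseteq> \<Union> F"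
    using compact[unfolded compactin_def, THEN conjunct2, rule_format, of "insert OQ (OC ` {0<..})"] by blast
  then obtain F where F: "finite F" "F \<subseteq> insert OQ (OC ` {0<..})" "X \<subseteq> \<Union> F"
    by (elim exE conjE)
  have "F - {OQ} \<subseteq> OC ` {0<..}" using F(2) by blast
  then obtain C where C: "finite C" "C \<subseteq> {0<..}" "F - {OQ} = OC ` C"
    using finite_subset_image[OF finite_Diff[OF F(1)]] by metis
  define r where "r = Min (insert 1 C)"
  have r: "r > 0" "\<And>c. c \<in> C \<Longrightarrow> r \<le> c" using C by (auto simp: r_def)
  show ?thesis
  proof (rule that[OF r(1)])
    fix f l assume f: "norm (f - f0) < r" and l: "l \<in> X \<inter> proj (ker f)"
    have "l \<notin> OC c" if "c \<in> C" for c
    proof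
      assume lc: "l \<in> OC c"
      have sl: "subspace l" "dim l = 1" "l \<subseteq> ker f" using l by (auto simp: proj_def)
      then obtain v where v: "v \<in> l" "v \<noteq> 0"
        by (metis dim_eq_0 subsetI singletonI zero_neq_one)
      have "f v = 0" using v sl(3) by (auto simp: ker_def)
      then have "norm (f0 v) = norm ((f - f0) v)" by (simp add: blinfun.diff_left)
      also have "\<dots> \<le> norm (f - f0) * norm v" by (rule norm_blinfun)
      also have "\<dots> \<le> c * norm v" using f r(2)[OF that] by (intro mult_right_mono) auto
      finally show False using lc v by (auto simp: OC_def)
    qed
    then have "l \<in> OQ" using F(3) C(3) l by blast
    then show "\<exists>x\<in>M \<inter> Q. l = span {x}" using l by (auto simp: OQ_def M_iff)
  qed
qed

text \<open>A kernel point exists on the wall, and the estimate on secants makes it unique. Applied to secants of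
  a curve with velocity \<open>t\<close> in \<open>M\<close>, the same estimate gives \<open>f t \<noteq> 0\<close> for nonzero tangent vectors \<open>t\<close> at
  the kernel point, which is the transversality to the fibre of \<open>Y\<close>.\<close>

lemma wall_point_regular:
  obtains r where "r > 0" "\<And>f. f \<in> wall X \<Longrightarrow> norm (f - f0) < r \<Longrightarrow> f \<in> regular_wall X"
proof -
  obtain k r1 Q where k: "k > 0" "r1 > 0" and Q: "open Q" "z0 \<in> Q"
    and sep: "\<And>f x y s. norm (f - f0) < r1 \<Longrightarrow> x \<in> M \<inter> Q \<Longrightarrow> y \<in> M \<inter> Q \<Longrightarrow>
       k * norm (x - y) \<le> norm (blinfun_apply f (x - y) + s *\<^sub>R w0)"
    by (rule kernel_point_unique, rule that)
  obtain r2 where r2: "r2 > 0"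
    "\<And>f l. norm (f - f0) < r2 \<Longrightarrow> l \<in> X \<inter> proj (ker f) \<Longrightarrow> \<exists>x\<in>M \<inter> Q. l = span {x}"
    by (rule kernel_point_close[OF Q], rule that)
  obtain r3 where r3: "r3 > 0" "\<And>f. norm (f - f0) < r3 \<Longrightarrow> surj (blinfun_apply f)"
    by (rule surj_blinfun_stable[OF surj_f0], rule that)
  show ?thesis
  proof (rule that[of "min r1 (min r2 r3)"])
    show "min r1 (min r2 r3) > 0" using k r2(1) r3(1) by simp
    fix f assume fw: "f \<in> wall X" and f: "norm (f - f0) < min r1 (min r2 r3)"
    have zero: "x \<in> l \<Longrightarrow> f x = 0" if "l \<in> X \<inter> proj (ker f)" for x l
      using that by (auto simp: proj_def ker_def)
    obtain l where l: "l \<in> X \<inter> proj (ker f)" using fw by (auto simp: wall_def)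
    then obtain x where x: "x \<in> M \<inter> Q" "l = span {x}" using r2(2)[of f l] f by auto
    have fx: "f x = 0" by (rule zero[OF l]) (simp add: x(2) span_base)
    have "l' = l" if l': "l' \<in> X \<inter> proj (ker f)" for l'
    proof -
      obtain y where y: "y \<in> M \<inter> Q" "l' = span {y}" using r2(2)[of f l'] f l' by auto
      have "f y = 0" by (rule zero[OF l']) (simp add: y(2) span_base)
      then have "k * norm (x - y) \<le> 0"
        using sep[of f x y 0] f x(1) y(1) fx by (simp add: blinfun.diff_right)
      then have "x = y" using k(1) by (simp add: mult_le_0_iff)
      show ?thesis unfolding x(2) y(2) \<open>x = y\<close> ..
    qed
    then have single: "X \<inter> proj (ker f) = {l}" using l by blast
    have "ker f \<inter> Y_fibre X l = l"
    proof
      show "l \<subseteq> ker f \<inter> Y_fibre X l"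
      proof
        fix u assume u: "u \<in> l"
        then obtain r where "u = r *\<^sub>R x" using x(2) by (auto simp: span_singleton)
        moreover have "0 \<in> tangent_space M x"
          using submanifold_at_tangent_chart[OF submanifold_M[of x]] x(1) subspace_0 by blast
        ultimately have "u \<in> Y_fibre X l"
          unfolding x(2) using Y_fibre_M(2)[of x u] x(1) by force
        then show "u \<in> ker f \<inter> Y_fibre X l" using zero[OF l u] by (simp add: ker_def)
      qed
      show "ker f \<inter> Y_fibre X l \<subseteq> l"
      proof
        fix y assume y: "y \<in> ker f \<inter> Y_fibre X l"
        then obtain r t where rt: "t \<in> tangent_space M x" "y = r *\<^sub>R x + t"
          using Y_fibre_M(2)[of x y] x by auto
        have ft: "f t = 0" using y rt(2) fx by (simp add: ker_def blinfun.add_right blinfun.scaleR_right)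
        obtain c e where c: "(e::real) > 0" "smooth_on {-e<..<e} c" "\<And>h. h \<in> {-e<..<e} \<Longrightarrow> c h \<in> M" "c 0 = x"
            "(c has_vector_derivative t) (at 0)"
          by (rule tangent_spaceE[OF rt(1)], rule that)
        have "(c \<longlongrightarrow> x) (at 0)"
          using has_vector_derivative_continuous[OF c(5)] c(4) by (simp add: continuous_at isCont_def)
        then have "\<forall>\<^sub>F h in at 0. c h \<in> Q" using Q(1) x(1) by (auto dest: topological_tendstoD)
        moreover have "\<forall>\<^sub>F h in at (0::real). h \<in> {-e<..<e}"
          using c(1) by (intro eventually_at_in_open') auto
        ultimately have "\<forall>\<^sub>F h in at 0. k * norm (c h - c 0) \<le> norm (f (c h - c 0))"
        proof eventually_elim
          case (elim h)
          then show ?case using sep[of f "c h" x 0] f x(1) c(3)[of h] c(4) by simp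
        qed
        then have "k * norm t \<le> 0"
          using has_vector_derivative_norm_lower_bound[OF c(5) k(1)] ft by fastforce
        then have "t = 0" using k(1) by (simp add: mult_le_0_iff)
        then show "y \<in> l" using rt(2) x(2) by (simp add: span_mul span_base)
      qed
    qed
    then show "f \<in> regular_wall X"
      using fw single r3(2)[of f] f by (auto simp: regular_wall_def)
  qed
qed

text \<open>The map \<open>\<Psi>\<close> described at the beginning, restricted to a neighbourhood on which all estimates hold.\<close>

lemma wall_chart:
  obtains A B \<Psi> G where "open A" "open B" "f0 \<in> A" "f0 \<in> B" "homeomorphism A B \<Psi> G"
    "\<And>k. Ck_on k A \<Psi>" "\<And>k. Ck_on k B G" "\<Psi> f0 = f0" "(\<Psi> has_derivative id) (at f0)"
    "\<And>q. q \<in> A \<Longrightarrow> \<Psi> q \<in> wall X \<longleftrightarrow> q z0 \<bullet> w0 = 0"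
proof -
  obtain k r1 Q where k: "k > 0" "r1 > 0" and Q: "open Q" "z0 \<in> Q"
    and sep: "\<And>f x y s. norm (f - f0) < r1 \<Longrightarrow> x \<in> M \<inter> Q \<Longrightarrow> y \<in> M \<inter> Q \<Longrightarrow>
       k * norm (x - y) \<le> norm (blinfun_apply f (x - y) + s *\<^sub>R w0)"
    by (rule kernel_point_unique, rule that)
  obtain r2 where r2: "r2 > 0"
    "\<And>f l. norm (f - f0) < r2 \<Longrightarrow> l \<in> X \<inter> proj (ker f) \<Longrightarrow> \<exists>x\<in>M \<inter> Q. l = span {x}"
    by (rule kernel_point_close[OF Q], rule that)
  obtain \<gamma> :: "'v \<Rightarrow> 'v" and C D where C: "open C" "0 \<in> C" and \<gamma>: "\<And>k. Ck_on k C \<gamma>" "\<gamma> 0 = z0"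
    and D: "(\<gamma> has_derivative D) (at 0)" "\<And>t. t \<in> T \<Longrightarrow> D t = t"
    and \<gamma>M: "\<And>t. t \<in> C \<inter> T \<Longrightarrow> \<gamma> t \<in> M"
    by (rule submanifold_at_tangent_chart[OF submanifold_M[OF z0_M]]) blast
  obtain g where g: "range g \<subseteq> T" "linear g" "\<And>t. t \<in> T \<Longrightarrow> g (f0 t) = t"
    using linear_exists_left_inverse_on[OF linear_f0 subspace_T inj_on_f0_T] by blast
  have bl_g: "bounded_linear g" using g(2) linear_conv_bounded_linear by blast
  define s where "s q = q z0 \<bullet> w0" for q :: "'v \<Rightarrow>\<^sub>L 'w"
  have bl_eval: "bounded_linear (\<lambda>q :: 'v \<Rightarrow>\<^sub>L 'w. q z0)"
    by (rule blinfun.bounded_linear_left)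
  have bl_s: "bounded_linear s"
    unfolding s_def by (rule bounded_linear_compose[OF bounded_linear_inner_left bl_eval])
  have bl_sw: "bounded_linear (\<lambda>q :: 'v \<Rightarrow>\<^sub>L 'w. s q *\<^sub>R w0)"
    by (rule bounded_linear_compose[OF bounded_linear_scaleR_left bl_s])
  \<comment> \<open>the sign makes \<open>\<gamma> (\<tau> q)\<close> the first order solution of \<open>q (\<gamma> t) = s q *\<^sub>R w0\<close>\<close>
  define \<tau> where "\<tau> q = - g (q z0 - s q *\<^sub>R w0)" for q :: "'v \<Rightarrow>\<^sub>L 'w"
  have bl_\<tau>: "bounded_linear \<tau>"
    unfolding \<tau>_def
    by (intro bounded_linear_minus bounded_linear_compose[OF bl_g] bounded_linear_sub bl_eval bl_sw)
  have \<tau>T: "\<tau> q \<in> T" for q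
    unfolding \<tau>_def using g(1) subspace_T by (intro subspace_neg) auto
  have split: "q z0 = s q *\<^sub>R w0 - f0 (\<tau> q)" for q :: "'v \<Rightarrow>\<^sub>L 'w"
  proof -
    have "(q z0 - s q *\<^sub>R w0) \<bullet> w0 = 0"
      using w0(1) by (simp add: s_def inner_diff_left dot_square_norm)
    then obtain t where t: "t \<in> T" "q z0 - s q *\<^sub>R w0 = f0 t" using w0(2) by blast
    then show ?thesis using g(3)[OF t(1)] by (simp add: \<tau>_def blinfun.minus_right algebra_simps)
  qed
  have s0: "s f0 = 0" and \<tau>0: "\<tau> f0 = 0"
    using linear_0[OF g(2)] by (simp_all add: s_def \<tau>_def f0_z0)
  define p where "p q = \<gamma> (\<tau> q)" for q :: "'v \<Rightarrow>\<^sub>L 'w"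
  define \<Psi> where "\<Psi> q = q - rank_one a (q (p q) - s q *\<^sub>R w0)" for q :: "'v \<Rightarrow>\<^sub>L 'w"
  have p0: "p f0 = z0" using \<tau>0 \<gamma>(2) by (simp add: p_def)
  have \<Psi>0: "\<Psi> f0 = f0"
    using s0 p0 f0_z0 linear_0[OF bounded_linear.linear[OF bounded_linear_rank_one]] by (simp add: \<Psi>_def)
  have open_C: "open (\<tau> -` C)"
    by (rule open_vimage[OF C(1) linear_continuous_on[OF bl_\<tau>]])
  have p_Ck: "Ck_on k (\<tau> -` C) p" for k
    using Ck_on_affine_compose[OF bl_\<tau> open_C _ \<gamma>(1), of 0 k] by (simp add: p_def[abs_def])
  have \<Psi>_Ck: "Ck_on k (\<tau> -` C) \<Psi>" for k
    unfolding \<Psi>_def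
    by (intro Ck_on_diff[OF open_C] Ck_on_linear_compose[OF bounded_linear_rank_one open_C]
        Ck_on_bilinear[OF bounded_bilinear_blinfun_apply open_C] p_Ck
        Ck_on_bounded_linear[OF bounded_linear_ident open_C] Ck_on_bounded_linear[OF bl_sw open_C])
  have f0C: "f0 \<in> \<tau> -` C" using \<tau>0 C(2) by simp
  have D\<Psi>: "(\<Psi> has_derivative id) (at f0)"
  proof -
    have "(p has_derivative (\<lambda>h. D (\<tau> h))) (at f0)"
      unfolding p_def
      by (rule has_derivative_compose[OF bounded_linear_imp_has_derivative[OF bl_\<tau>]]) (use D(1) \<tau>0 in simp)
    then have "((\<lambda>q. q (p q)) has_derivative (\<lambda>h. f0 (D (\<tau> h)) + h (p f0))) (at f0)"
      by (rule bounded_bilinear.FDERIV[OF bounded_bilinear_blinfun_apply has_derivative_ident])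
    from has_derivative_diff[OF has_derivative_ident bounded_linear.has_derivative[OF bounded_linear_rank_one
          has_derivative_diff[OF this bounded_linear_imp_has_derivative[OF bl_sw]]], of a]
    have "(\<Psi> has_derivative (\<lambda>h. h - rank_one a (f0 (D (\<tau> h)) + h (p f0) - s h *\<^sub>R w0))) (at f0)"
      by (simp add: \<Psi>_def[abs_def])
    moreover have "h - rank_one a (f0 (D (\<tau> h)) + h (p f0) - s h *\<^sub>R w0) = h" for h
      using split[of h] D(2)[OF \<tau>T, of h] p0 linear_0[OF bounded_linear.linear[OF bounded_linear_rank_one]] by simp
    ultimately show ?thesis by (simp add: id_def)
  qed
  define U where "U = (\<tau> -` C) \<inter> ((p -` Q) \<inter> (\<Psi> -` ball f0 r2) \<inter> ball f0 r1)"
  have "continuous_on (\<tau> -` C) p" "continuous_on (\<tau> -` C) \<Psi>" using p_Ck[of 0] \<Psi>_Ck[of 0] by simp_all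
  then have "open ((\<tau> -` C \<inter> p -` Q) \<inter> (\<tau> -` C \<inter> \<Psi> -` ball f0 r2) \<inter> ball f0 r1)"
    by (intro open_Int continuous_open_preimage open_C Q(1) open_ball)
  moreover have "U = (\<tau> -` C \<inter> p -` Q) \<inter> (\<tau> -` C \<inter> \<Psi> -` ball f0 r2) \<inter> ball f0 r1"
    by (auto simp: U_def)
  ultimately have openU: "open U" by simp
  have f0U: "f0 \<in> U" using f0C p0 Q(2) \<Psi>0 k(2) r2(1) by (simp add: U_def)
  have \<Psi>U: "Ck_on k U \<Psi>" for k by (rule Ck_on_subset[OF \<Psi>_Ck]) (auto simp: U_def)
  have iff: "\<Psi> q \<in> wall X \<longleftrightarrow> q z0 \<bullet> w0 = 0" if q: "q \<in> U" for q :: "'v \<Rightarrow>\<^sub>L 'w"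
  proof -
    have qs: "p q \<in> M" "p q \<in> Q" "norm (q - f0) < r1" "norm (\<Psi> q - f0) < r2"
      using q \<gamma>M \<tau>T by (auto simp: U_def p_def dist_norm norm_minus_commute)
    have at: "\<Psi> q x = q (x - p q) + s q *\<^sub>R w0" if "x \<in> M" for x
      using that by (simp add: \<Psi>_def M_iff blinfun.diff_left blinfun.diff_right)
    show ?thesis
    proof
      assume "\<Psi> q \<in> wall X"
      then obtain l where l: "l \<in> X \<inter> proj (ker (\<Psi> q))" by (auto simp: wall_def)
      then obtain x where x: "x \<in> M \<inter> Q" "l = span {x}" using r2(2)[OF qs(4)] by blast
      have "\<Psi> q x = 0" using l x(2) span_base[of x "{x}"] by (auto simp: proj_def ker_def)
      then have 0: "q (x - p q) + s q *\<^sub>R w0 = 0" using at x(1) by simp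
      have "k * norm (x - p q) \<le> 0" using sep[OF qs(3) x(1), of "p q" "s q"] qs 0 by simp
      then have "x = p q" using k(1) by (simp add: mult_le_0_iff)
      then have "s q *\<^sub>R w0 = 0" using 0 by (simp add: blinfun.zero_right)
      then show "q z0 \<bullet> w0 = 0" using w0_nonzero by (simp add: s_def)
    next
      assume "q z0 \<bullet> w0 = 0"
      then have "\<Psi> q (p q) = 0" using at[OF qs(1)] by (simp add: s_def blinfun.zero_right)
      then have "span {p q} \<in> proj (ker (\<Psi> q))"
        using M_nonzero[OF qs(1)] by (intro span_singleton_in_proj_ker)
      then show "\<Psi> q \<in> wall X" using qs(1) by (auto simp: wall_def M_iff)
    qed
  qed
  obtain A B G where G: "open A" "A \<subseteq> U" "f0 \<in> A" "open B" "homeomorphism A B \<Psi> G" "\<And>k. Ck_on k B G"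
    by (rule smooth_inverse_function_theorem_blinfun[OF openU f0U \<Psi>U D\<Psi>], rule that)
  show ?thesis
  proof (rule that[OF G(1,4,3) _ G(5) _ G(6) \<Psi>0 D\<Psi>])
    have "\<Psi> f0 \<in> B" using G(3,5) unfolding homeomorphism_def by blast
    then show "f0 \<in> B" using \<Psi>0 by simp
    show "Ck_on k A \<Psi>" for k by (rule Ck_on_subset[OF \<Psi>U G(2)])
    show "\<Psi> q \<in> wall X \<longleftrightarrow> q z0 \<bullet> w0 = 0" if "q \<in> A" for q using iff G(2) that by blast
  qed
qed


theorem hypersurface_at_wall: "hypersurface_at (wall X) f0"
proof -
  obtain A B \<Psi> G where A: "open A" "open B" "f0 \<in> A" "f0 \<in> B" and hom: "homeomorphism A B \<Psi> G"
    and Ck: "\<And>k. Ck_on k A \<Psi>" "\<And>k. Ck_on k B G"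
    and \<Psi>: "\<And>q. q \<in> A \<Longrightarrow> \<Psi> q \<in> wall X \<longleftrightarrow> q z0 \<bullet> w0 = 0" and \<Psi>0: "\<Psi> f0 = f0"
    by (rule wall_chart) blast
  let ?L = "{q :: 'v \<Rightarrow>\<^sub>L 'w. q z0 \<bullet> w0 = 0}"
  let ?U = "wall X \<inter> B" and ?U' = "?L \<inter> A"
  have h: "G y \<in> A" "\<Psi> (G y) = y" if "y \<in> B" for y
    using hom that by (auto simp: homeomorphism_def)
  have h': "\<Psi> q \<in> B" "G (\<Psi> q) = q" if "q \<in> A" for q
    using hom that by (auto simp: homeomorphism_def)
  have GU: "G y \<in> ?U'" if "y \<in> ?U" for y
    using that h[of y] \<Psi>[of "G y"] by auto
  have \<Psi>U: "\<Psi> q \<in> ?U" if "q \<in> ?U'" for q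
    using that h'[of q] \<Psi>[of q] by auto
  have bij: "bij_betw G ?U ?U'"
    by (rule bij_betw_byWitness[of _ \<Psi>]) (use GU \<Psi>U h h' in auto)
  have inv: "inv_into ?U G q = \<Psi> q" if "q \<in> ?U'" for q
    by (rule inv_into_f_eq[OF bij_betw_imp_inj_on[OF bij] \<Psi>U[OF that]]) (use that h' in blast)
  have "smooth_on ?U G"
    unfolding smooth_on_def using A(2) Ck(2) by blast
  moreover have "smooth_on ?U' (inv_into ?U G)"
    unfolding smooth_on_def using A(1) Ck(1) inv by (intro ballI exI[of _ A] exI[of _ \<Psi>]) auto
  ultimately have diffeo: "diffeo_betw ?U ?U' G" using bij by (simp add: diffeo_betw_def)
  have "subspace ?L"
    by (auto simp: subspace_def blinfun.zero_left blinfun.add_left blinfun.scaleR_left inner_add_left)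
  moreover have "f0 \<in> ?U" using \<Psi>[OF A(3)] A(4) \<Psi>0 by (simp add: f0_z0)
  moreover have "openin (top_of_set (wall X)) ?U" "openin (top_of_set ?L) ?U'"
    using A(1,2) by (auto simp: openin_open)
  ultimately have "submanifold_at (dim ?L) (wall X) f0"
    unfolding submanifold_at_def using diffeo by blast
  then show ?thesis
    unfolding hypersurface_at_def using hyperplane_codimension_1[OF z0 w0_nonzero] by blast
qed

text \<open>A curve in the wall is mapped by \<open>G\<close> to a curve in the hyperplane, and \<open>G\<close> has derivative the identity
  at \<open>f0\<close>. In the other direction \<open>\<Psi>\<close> maps the line through \<open>f0\<close> in a direction of the hyperplane to a
  curve in the wall, which consists of regular points for small parameters.\<close>

theorem tangent_space_regular_wall: "tangent_space (regular_wall X) f0 = {\<phi> :: 'v \<Rightarrow>\<^sub>L 'w. \<phi> z0 \<bullet> w0 = 0}"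
proof -
  obtain A B \<Psi> G where A: "open A" "open B" "f0 \<in> A" "f0 \<in> B" and hom: "homeomorphism A B \<Psi> G"
    and Ck: "\<And>k. Ck_on k A \<Psi>" "\<And>k. Ck_on k B G"
    and \<Psi>: "\<And>q. q \<in> A \<Longrightarrow> \<Psi> q \<in> wall X \<longleftrightarrow> q z0 \<bullet> w0 = 0" and \<Psi>0: "\<Psi> f0 = f0"
    and D\<Psi>: "(\<Psi> has_derivative id) (at f0)"
    by (rule wall_chart) blast
  obtain r where r: "r > 0" "\<And>f. f \<in> wall X \<Longrightarrow> norm (f - f0) < r \<Longrightarrow> f \<in> regular_wall X"
    by (rule wall_point_regular, rule that)
  have bl_s: "bounded_linear (\<lambda>q :: 'v \<Rightarrow>\<^sub>L 'w. q z0 \<bullet> w0)"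
    by (rule bounded_linear_compose[OF bounded_linear_inner_left blinfun.bounded_linear_left])
  have G0: "G f0 = f0" using hom A(3) \<Psi>0 by (metis homeomorphism_apply1)
  have DG: "(G has_derivative id) (at f0)"
  proof -
    define D where "D = frechet_derivative G (at f0)"
    have D: "(G has_derivative D) (at f0)" unfolding D_def by (rule Ck_on_SucD[OF Ck(2) A(4)])
    have "((\<lambda>y. \<Psi> (G y)) has_derivative (\<lambda>h. id (D h))) (at f0)"
      by (rule has_derivative_compose[OF D]) (use D\<Psi> in \<open>simp add: G0 id_def\<close>)
    then have "((\<lambda>y. y) has_derivative (\<lambda>h. id (D h))) (at f0)"
      by (rule has_derivative_transform_within_open[OF _ A(2,4)]) (use hom in \<open>auto simp: homeomorphism_def\<close>)
    then have "(\<lambda>h. id (D h)) = (\<lambda>h. h)" by (rule has_derivative_unique[OF _ has_derivative_ident])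
    then have "D = id" by (simp add: fun_eq_iff)
    then show ?thesis using D by simp
  qed
  show ?thesis
  proof (intro equalityI subsetI)
    fix \<phi> assume \<phi>: "\<phi> \<in> tangent_space (regular_wall X) f0"
    obtain c e where c: "(e::real) > 0" "smooth_on {-e<..<e} c" "\<And>h. h \<in> {-e<..<e} \<Longrightarrow> c h \<in> regular_wall X"
        "c 0 = f0" "(c has_vector_derivative \<phi>) (at 0)"
      by (rule tangent_spaceE[OF \<phi>], rule that)
    have 1: "((\<lambda>h. G (c h)) has_vector_derivative id \<phi>) (at 0)"
      by (rule has_vector_derivative_compose[OF c(5), where D = id]) (simp add: c(4) DG)
    have 2: "((\<lambda>h. G (c h) z0 \<bullet> w0) has_vector_derivative id \<phi> z0 \<bullet> w0) (at 0)"
      by (rule has_vector_derivative_compose[OF 1 bounded_linear_imp_has_derivative[OF bl_s]])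
    have "(c \<longlongrightarrow> f0) (at 0)"
      using has_vector_derivative_continuous[OF c(5)] c(4) by (simp add: continuous_at isCont_def)
    then have "\<forall>\<^sub>F h in at 0. c h \<in> B" using A(2,4) by (auto dest: topological_tendstoD)
    moreover have "\<forall>\<^sub>F h in at (0::real). h \<in> {-e<..<e}"
      using c(1) by (intro eventually_at_in_open') auto
    ultimately have "\<forall>\<^sub>F h in at 0. G (c h) z0 \<bullet> w0 = 0"
    proof eventually_elim
      case (elim h)
      have "G (c h) \<in> A" "\<Psi> (G (c h)) = c h" using hom elim(1) by (auto simp: homeomorphism_def)
      moreover have "c h \<in> wall X" using c(3)[OF elim(2)] by (simp add: regular_wall_def)
      ultimately show ?case using \<Psi>[of "G (c h)"] by simp
    qed
    then have "((\<lambda>h::real. 0) has_vector_derivative id \<phi> z0 \<bullet> w0) (at 0)"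
      by (rule has_vector_derivative_eventually_cong[OF 2]) (simp add: c(4) G0 f0_z0)
    then have "id \<phi> z0 \<bullet> w0 = 0"
      using vector_derivative_unique_at[OF _ has_vector_derivative_const] by blast
    then show "\<phi> \<in> {\<phi> :: 'v \<Rightarrow>\<^sub>L 'w. \<phi> z0 \<bullet> w0 = 0}" by simp
  next
    fix \<phi> :: "'v \<Rightarrow>\<^sub>L 'w" assume \<phi>: "\<phi> \<in> {\<phi> :: 'v \<Rightarrow>\<^sub>L 'w. \<phi> z0 \<bullet> w0 = 0}"
    let ?A = "A \<inter> \<Psi> -` ball f0 r"
    have "open ?A" using Ck(1)[of 0] A(1) by (intro continuous_open_preimage) auto
    moreover have "((\<lambda>h::real. f0 + h *\<^sub>R \<phi>) \<longlongrightarrow> f0 + 0 *\<^sub>R \<phi>) (at 0)"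
      by (intro tendsto_intros)
    ultimately have "\<forall>\<^sub>F h in at (0::real). f0 + h *\<^sub>R \<phi> \<in> ?A"
      using A(3) \<Psi>0 r(1) by (auto dest!: topological_tendstoD)
    then obtain d where d: "d > 0" "\<And>h::real. h \<noteq> 0 \<Longrightarrow> \<bar>h\<bar> < d \<Longrightarrow> f0 + h *\<^sub>R \<phi> \<in> ?A"
      unfolding eventually_at by auto
    have mem: "f0 + h *\<^sub>R \<phi> \<in> ?A" if "h \<in> {-d<..<d}" for h
      using d(2)[of h] that A(3) \<Psi>0 r(1) by (cases "h = 0") auto
    have "smooth_on {-d<..<d} (\<lambda>h. \<Psi> (f0 + h *\<^sub>R \<phi>))"
      using mem by (intro smooth_on_openI Ck_on_affine_compose[OF bounded_linear_scaleR_left _ _ Ck(1)]) auto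
    moreover have "\<Psi> (f0 + h *\<^sub>R \<phi>) \<in> regular_wall X" if "h \<in> {-d<..<d}" for h
    proof (rule r(2))
      show "\<Psi> (f0 + h *\<^sub>R \<phi>) \<in> wall X"
        using \<Psi>[of "f0 + h *\<^sub>R \<phi>"] mem[OF that] \<phi>
        by (simp add: blinfun.add_left blinfun.scaleR_left f0_z0)
      show "norm (\<Psi> (f0 + h *\<^sub>R \<phi>) - f0) < r"
        using mem[OF that] by (simp add: dist_norm norm_minus_commute)
    qed
    moreover have "((\<lambda>h. \<Psi> (f0 + h *\<^sub>R \<phi>)) has_vector_derivative id \<phi>) (at 0)"
      by (rule has_vector_derivative_compose[OF has_vector_derivative_line, where D = id]) (simp add: D\<Psi>)
    ultimately show "\<phi> \<in> tangent_space (regular_wall X) f0"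
      unfolding tangent_space_def using d(1) \<Psi>0
      by (intro CollectI exI[of _ "\<lambda>h. \<Psi> (f0 + h *\<^sub>R \<phi>)"] exI[of _ d]) auto
  qed
qed

section \<open>The normal line and the determinant lines\<close>

text \<open>The coordinates are \<open>\<phi> \<mapsto> \<phi> z0 \<bullet> w0\<close> on the normal line, the determinant on \<open>det W\<close>, and the determinant
  after \<open>\<theta>\<close> on \<open>det Y\<close>. The map \<open>\<theta>\<close> agrees with \<open>f0\<close> up to multiples of \<open>w0\<close> and sends \<open>z0\<close> to \<open>w0\<close>,
  so row operations compare the two determinants.\<close>

theorem canonical_normal_isomorphism:
  "\<exists>!\<psi>. \<psi> \<in> extensional (car (normal_line X f0)) \<and>
     viso (normal_line X f0) (vHom (det_line (Y_fibre X (span {z0}))) (det_line (UNIV :: 'w set))) \<psi> \<and>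
     canonical_normal_map X f0 (span {z0}) \<psi>"
proof -
  let ?\<xi> = "span {z0}"
  let ?Y = "Y_fibre X ?\<xi>"
  let ?N = "normal_line X f0" and ?A = "det_line ?Y" and ?B = "det_line (UNIV :: 'w set)"
  let ?T = "tangent_space (regular_wall X) f0"
  note Y = Y_fibre_M[OF z0_M]
  define \<theta> where "\<theta> v = f0 v + a v *\<^sub>R w0" for v
  have lin_\<theta>: "linear \<theta>"
    by (rule linearI) (simp_all add: \<theta>_def blinfun.add_right blinfun.scaleR_right algebra_simps)
  have w0w0: "w0 \<bullet> w0 = 1" using w0(1) by (simp add: dot_square_norm)
  have \<theta>_Y: "y = 0" if "y \<in> ?Y" "\<theta> y = 0" for y
  proof -
    obtain r t where y: "t \<in> T" "y = r *\<^sub>R z0 + t" using \<open>y \<in> ?Y\<close> Y(2) by blast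
    have \<theta>y: "\<theta> y = r *\<^sub>R w0 + f0 t"
      unfolding y(2) \<theta>_def using a_T[OF y(1)] a_z0 f0_z0
      by (simp add: blinfun.add_right blinfun.scaleR_right)
    have "f0 t \<bullet> w0 = 0" using w0(2) y(1) by blast
    then have "\<theta> y \<bullet> w0 = r" using w0w0 by (simp add: \<theta>y inner_add_left)
    then have "r = 0" using that(2) by simp
    moreover have "t = 0" using f0_T_injective[OF y(1)] \<theta>y that(2) \<open>r = 0\<close> by simp
    ultimately show ?thesis using y(2) by simp
  qed
  have inj_\<theta>: "inj_on \<theta> ?Y"
  proof (rule inj_onI)
    fix x y assume xy: "x \<in> ?Y" "y \<in> ?Y" "\<theta> x = \<theta> y"
    then have "x - y = 0" using \<theta>_Y[of "x - y"] subspace_diff[OF Y(3)] linear_diff[OF lin_\<theta>] by simp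
    then show "x = y" by simp
  qed
  have dimY: "dim ?Y = DIM('w)" using Y(1) dim_W by simp
  have lin_s: "linear (\<lambda>\<phi> :: 'v \<Rightarrow>\<^sub>L 'w. \<phi> z0 \<bullet> w0)"
    by (intro bounded_linear.linear bounded_linear_compose[OF bounded_linear_inner_left blinfun.bounded_linear_left])
  obtain \<sigma> where \<sigma>: "line_coordinate ?N \<sigma>" "\<And>\<phi> :: 'v \<Rightarrow>\<^sub>L 'w. \<sigma> (coset ?T \<phi>) = \<phi> z0 \<bullet> w0"
  proof -
    have T: "?T = {\<phi> \<in> (UNIV :: ('v \<Rightarrow>\<^sub>L 'w) set). \<phi> z0 \<bullet> w0 = 0}"
      using tangent_space_regular_wall by simp
    have nz: "rank_one a w0 z0 \<bullet> w0 \<noteq> 0" using a_z0 w0w0 by simp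
    obtain \<sigma> where "line_coordinate (vquot UNIV ?T) \<sigma>"
        "\<And>\<phi> :: 'v \<Rightarrow>\<^sub>L 'w. \<phi> \<in> UNIV \<Longrightarrow> \<sigma> (coset ?T \<phi>) = \<phi> z0 \<bullet> w0"
      by (rule line_coordinate_vquot[OF subspace_UNIV lin_s T UNIV_I nz], rule that)
    then show ?thesis using that[of \<sigma>] by (simp add: normal_line_def)
  qed
  obtain \<alpha> where \<alpha>: "line_coordinate ?A \<alpha>"
      "\<And>xs. xs \<in> tuples (dim ?Y) ?Y \<Longrightarrow> wedge ?Y xs \<in> car ?A \<and> \<alpha> (wedge ?Y xs) = list_det (map \<theta> xs)"
      "\<And>bs. distinct bs \<Longrightarrow> set bs \<subseteq> ?Y \<Longrightarrow> ?Y \<subseteq> span (set bs) \<Longrightarrow> length bs = dim ?Y \<Longrightarrow>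
         list_det (map \<theta> bs) \<noteq> 0"
    by (rule line_coordinate_det_line[OF Y(3) lin_\<theta> inj_\<theta> dimY], rule that)
  obtain \<beta> where \<beta>: "line_coordinate ?B \<beta>"
      "\<And>xs. xs \<in> tuples (dim (UNIV :: 'w set)) UNIV \<Longrightarrow>
         wedge UNIV xs \<in> car ?B \<and> \<beta> (wedge UNIV xs) = list_det (map id xs)"
    by (rule line_coordinate_det_line[OF subspace_UNIV linear_id inj_on_id dim_UNIV], rule that)
  obtain \<psi> where \<psi>: "\<psi> \<in> extensional (car ?N)" "viso ?N (vHom ?A ?B) \<psi>"
    "\<And>n x. n \<in> car ?N \<Longrightarrow> x \<in> car ?A \<Longrightarrow> \<psi> n x \<in> car ?B \<and> \<beta> (\<psi> n x) = \<sigma> n * \<alpha> x"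
    by (rule line_coordinate_Hom[OF \<sigma>(1) \<alpha>(1) \<beta>(1)], rule that)
  have carN: "car ?N = range (coset ?T)" by (simp add: normal_line_def vquot_def)
  have \<xi>Y: "?\<xi> \<subseteq> ?Y" using transversal by blast
  have "canonical_normal_map X f0 ?\<xi> \<psi>"
    unfolding canonical_normal_map_def
  proof (intro allI ballI impI)
    fix \<phi> :: "'v \<Rightarrow>\<^sub>L 'w" and y0 ys assume y0: "y0 \<in> ?\<xi>" and "length ys + 1 = dim ?Y \<and> set ys \<subseteq> ?Y"
    then have ys: "length ys + 1 = DIM('w)" "y0 # ys \<in> tuples (dim ?Y) ?Y" "set ys \<subseteq> ?Y"
      using \<xi>Y dimY by (auto simp: tuples_def)
    obtain r where r: "y0 = r *\<^sub>R z0" using y0 by (auto simp: span_singleton)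
    let ?fs = "map (blinfun_apply f0) ys" and ?h = "\<phi> z0 - (\<phi> z0 \<bullet> w0) *\<^sub>R w0"
    have "list_det (map \<theta> (y0 # ys)) = list_det ([] @ [r *\<^sub>R w0] @ map \<theta> ys)"
      using a_z0 f0_z0 by (simp add: r \<theta>_def blinfun.scaleR_right)
    also have "\<dots> = r * list_det (w0 # map \<theta> ys)"
      using list_det_scale[of "[]" "map \<theta> ys" r w0] ys(1) by simp
    also have "list_det (w0 # map \<theta> ys) = list_det (w0 # ?fs)"
      using list_det_shear[of "[]" ys w0 "blinfun_apply f0" "blinfun_apply a"] ys(1)
      by (simp add: \<theta>_def[abs_def])
    finally have 1: "list_det (map \<theta> (y0 # ys)) = r * list_det (w0 # ?fs)" .
    \<comment> \<open>all entries lie in the hyperplane \<open>f0 ` T\<close>\<close>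
    have "list_det (?h # ?fs) = 0"
    proof (rule list_det_eq_0[OF w0_nonzero])
      fix x assume "x \<in> set (?h # ?fs)"
      then consider "x = ?h" | y where "y \<in> ?Y" "x = f0 y" using ys(3) by auto
      then show "x \<bullet> w0 = 0"
      proof cases
        case 1
        then show ?thesis using w0w0 by (simp add: inner_diff_left)
      next
        case 2
        then obtain r' t where "t \<in> T" "y = r' *\<^sub>R z0 + t" using Y(2) by blast
        then have "x = f0 t" using 2 f0_z0 by (simp add: blinfun.add_right blinfun.scaleR_right)
        then show ?thesis using w0(2) \<open>t \<in> T\<close> by blast
      qed
    qed (use ys(1) in simp)
    moreover have "list_det (\<phi> z0 # ?fs) = (\<phi> z0 \<bullet> w0) * list_det (w0 # ?fs) + list_det (?h # ?fs)"
      using list_det_add[of "[]" ?fs "(\<phi> z0 \<bullet> w0) *\<^sub>R w0" ?h] list_det_scale[of "[]" ?fs "\<phi> z0 \<bullet> w0" w0] ys(1)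
      by simp
    ultimately have "list_det (\<phi> y0 # ?fs) = r * ((\<phi> z0 \<bullet> w0) * list_det (w0 # ?fs))"
      using list_det_scale[of "[]" ?fs r "\<phi> z0"] ys(1) by (simp add: r blinfun.scaleR_right)
    then have 2: "list_det (\<phi> y0 # ?fs) = (\<phi> z0 \<bullet> w0) * list_det (map \<theta> (y0 # ys))"
      unfolding 1 by simp
    have A: "wedge ?Y (y0 # ys) \<in> car ?A" "\<alpha> (wedge ?Y (y0 # ys)) = list_det (map \<theta> (y0 # ys))"
      using \<alpha>(2)[OF ys(2)] by blast+
    have "\<phi> y0 # ?fs \<in> tuples (dim (UNIV :: 'w set)) UNIV" using ys(1) by (simp add: tuples_def)
    from \<beta>(2)[OF this] have B: "wedge UNIV (\<phi> y0 # ?fs) \<in> car ?B"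
      "\<beta> (wedge UNIV (\<phi> y0 # ?fs)) = list_det (\<phi> y0 # ?fs)" by (simp_all add: map_idI)
    have n: "coset ?T \<phi> \<in> car ?N" using carN by blast
    show "\<psi> (coset ?T \<phi>) (wedge ?Y (y0 # ys)) = wedge UNIV (\<phi> y0 # ?fs)"
      using line_coordinateD(5)[OF \<beta>(1)] \<psi>(3)[OF n A(1)] B A(2) \<sigma>(2) 2 by simp
  qed
  moreover have "\<psi>' = \<psi>''"
    if \<psi>': "\<psi>' \<in> extensional (car ?N)" "viso ?N (vHom ?A ?B) \<psi>'" "canonical_normal_map X f0 ?\<xi> \<psi>'"
      and \<psi>'': "\<psi>'' \<in> extensional (car ?N)" "viso ?N (vHom ?A ?B) \<psi>''" "canonical_normal_map X f0 ?\<xi> \<psi>''"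
    for \<psi>' \<psi>''
  proof (rule extensionalityI[OF \<psi>'(1) \<psi>''(1)])
    fix n assume n: "n \<in> car ?N"
    then obtain \<phi> :: "'v \<Rightarrow>\<^sub>L 'w" where \<phi>: "n = coset ?T \<phi>" using carN by blast
    \<comment> \<open>the canonical formula only concerns wedges whose first factor is on the line, so the basis is
      arranged to start with \<open>z0\<close>\<close>
    have "{z0} \<subseteq> ?Y" "independent {z0}" using \<xi>Y z0 span_base[of z0 "{z0}"] by auto
    then obtain bs where bs: "distinct bs" "set bs \<subseteq> ?Y" "?Y \<subseteq> span (set bs)" "length bs = dim ?Y" "{z0} \<subseteq> set bs"
      by (rule list_basis_exists[OF Y(3)])
    then obtain us vs where split: "bs = us @ z0 # vs" by (meson insert_subset split_list)
    let ?ys = "us @ vs"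
    have b: "distinct (z0 # ?ys)" "set (z0 # ?ys) \<subseteq> ?Y" "?Y \<subseteq> span (set (z0 # ?ys))" "length (z0 # ?ys) = dim ?Y"
      using bs(1-4) unfolding split by auto
    have tup: "z0 # ?ys \<in> tuples (dim ?Y) ?Y" using b by (simp add: tuples_def)
    have nz: "wedge ?Y (z0 # ?ys) \<in> car ?A" "\<alpha> (wedge ?Y (z0 # ?ys)) \<noteq> 0"
      using \<alpha>(2)[OF tup] \<alpha>(3)[OF b] by simp_all
    have "\<psi> n (wedge ?Y (z0 # ?ys)) = wedge UNIV (\<phi> z0 # map (blinfun_apply f0) ?ys)"
      if "canonical_normal_map X f0 ?\<xi> \<psi>" for \<psi>
      using that b(2,4) span_base[of z0 "{z0}"] unfolding canonical_normal_map_def \<phi> by auto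
    then have "\<psi>' n (wedge ?Y (z0 # ?ys)) = \<psi>'' n (wedge ?Y (z0 # ?ys))" using \<psi>'(3) \<psi>''(3) by metis
    moreover have "\<psi>' n \<in> car (vHom ?A ?B)" "\<psi>'' n \<in> car (vHom ?A ?B)"
      using \<psi>'(2) \<psi>''(2) n by (auto simp: viso_def bij_betw_def)
    ultimately show "\<psi>' n = \<psi>'' n" using vHom_eqI[OF \<alpha>(1) _ _ nz] by blast
  qed
  ultimately show ?thesis using \<psi>(1,2) by blast
qed

end

lemma regular_wall_pointI:
  fixes X :: "'v::euclidean_space set set" and f0 :: "'v \<Rightarrow>\<^sub>L 'w::euclidean_space"
  assumes "DIM('w) = m + 1" "proj_submanifold m X" "compactin proj_topology X"
    and f0: "f0 \<in> regular_wall X" and \<xi>: "X \<inter> proj (ker f0) = {\<xi>}"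
  obtains z0 where "regular_wall_point X m f0 z0" "\<xi> = span {z0}"
proof -
  have reg: "surj (blinfun_apply f0)" "ker f0 \<inter> Y_fibre X \<xi> = \<xi>"
    using f0 \<xi> by (auto simp: regular_wall_def)
  have l: "subspace \<xi>" "dim \<xi> = 1" using \<xi> by (auto simp: proj_def)
  then obtain v where v: "v \<in> \<xi>" "v \<noteq> 0"
    by (metis dim_eq_0 subsetI singletonI zero_neq_one)
  have \<xi>v: "\<xi> = span {v}"
    using v l by (intro subspace_dim_equal[symmetric] span_minimal) (auto simp: subspace_span dim_insert)
  have "regular_wall_point X m f0 v"
    using assms(1-3) reg \<xi> v(2) unfolding \<xi>v by unfold_locales
  then show ?thesis using that \<xi>v by blast
qed

theorem proposition2p4:
  fixes X :: "'v::euclidean_space set set" and m :: nat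
  assumes "m + 1 < DIM('v)"
    and "DIM('w::euclidean_space) = m + 1"
    and "proj_submanifold m X"
    and "compactin proj_topology X"
  shows "(\<forall>f\<^sub>0 :: 'v \<Rightarrow>\<^sub>L 'w. f\<^sub>0 \<in> regular_wall X \<longrightarrow> hypersurface_at (wall X) f\<^sub>0) \<and>
    (\<forall>(f\<^sub>0 :: 'v \<Rightarrow>\<^sub>L 'w) \<xi>\<^sub>0. f\<^sub>0 \<in> regular_wall X \<and> X \<inter> proj (ker f\<^sub>0) = {\<xi>\<^sub>0} \<longrightarrow>
       (\<exists>!\<psi>. \<psi> \<in> extensional (car (normal_line X f\<^sub>0)) \<and>
          viso (normal_line X f\<^sub>0)
            (vHom (det_line (Y_fibre X \<xi>\<^sub>0)) (det_line (UNIV :: 'w set))) \<psi> \<and>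
          canonical_normal_map X f\<^sub>0 \<xi>\<^sub>0 \<psi>))"
proof (intro conjI allI impI)
  fix f0 :: "'v \<Rightarrow>\<^sub>L 'w" assume f0: "f0 \<in> regular_wall X"
  then obtain \<xi> where \<xi>: "X \<inter> proj (ker f0) = {\<xi>}" by (auto simp: regular_wall_def)
  obtain z0 where "regular_wall_point X m f0 z0"
    using regular_wall_pointI[OF assms(2-4) f0 \<xi>] by blast
  then show "hypersurface_at (wall X) f0" by (rule regular_wall_point.hypersurface_at_wall)
next
  fix f0 :: "'v \<Rightarrow>\<^sub>L 'w" and \<xi>
  assume "f0 \<in> regular_wall X \<and> X \<inter> proj (ker f0) = {\<xi>}"
  then have f0: "f0 \<in> regular_wall X" and \<xi>: "X \<inter> proj (ker f0) = {\<xi>}" by blast+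
  obtain z0 where "regular_wall_point X m f0 z0" and "\<xi> = span {z0}"
    using regular_wall_pointI[OF assms(2-4) f0 \<xi>] by blast
  then show "\<exists>!\<psi>. \<psi> \<in> extensional (car (normal_line X f0)) \<and>
      viso (normal_line X f0) (vHom (det_line (Y_fibre X \<xi>)) (det_line (UNIV :: 'w set))) \<psi> \<and>
      canonical_normal_map X f0 \<xi> \<psi>"
    using regular_wall_point.canonical_normal_isomorphism by simp
qed

end
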